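(* Let $\tau>0$, $t>\tau$, $q>0$, $0<c_2<1$, $\iota>0$, $k_0>\frac1{4\iota}$, $k_1>0$, $\omega>0$, $\theta=\omega^2$, and $A,B\in\mathbb{R}$ with $A^2+B^2>0$. Let $\tilde\varepsilon,\tilde\varepsilon_s$ be the state-observer errors on $[0,t-\tau]$ defined in the context. For any initial condition $(\tilde\varepsilon(\cdot,0),\tilde\varepsilon_s(\cdot,0))\in\mathcal{H}_3=H^1(0,1)\times L^2(0,1)$ (with the underlying data $(\tilde z(\cdot,0),\tilde z_s(\cdot,0),\tilde Y_2(\cdot,0))\in\mathcal{H}_4$ and $(\xi(0),\hat\chi_1(0),\hat\varphi(0),\hat\theta(0))\in\mathbb{R}^4$), there exists a unique solution $(\tilde\varepsilon,\tilde\varepsilon_s)\in C([0,t-\tau];\mathcal{H}_3)$ to the error system, and it satisfies $$\|(\tilde\varepsilon(\cdot,s),\tilde\varepsilon_s(\cdot,s))\|_{\mathcal{H}_3}\le M_3e^{-\mu_3s},\qquad s\in[0,t-\tau],$$ for some constants $M_3,\mu_3>0$ (independent of $s$ and $t$).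
   Context: Spaces: $\mathcal{H}_3=H^1(0,1)\times L^2(0,1)$; $\mathcal{H}_4=\{(f,g,h)\in H^1(0,1)\times L^2(0,1)\times H^1(0,1): f(1)=-h(1),\ h(0)=-c_2f(0)\}$. Disturbance model: $S_\eta=\begin{bmatrix}0&\omega\\-\omega&0\end{bmatrix}$, $\gamma_\eta=[1\ \ 0]$, $\dot\eta(s)=S_\eta\eta(s)$, $\eta(0)=[A\ \ B]^\top$. Plant (after regulator transformation): $\varepsilon_{ss}(x,s)=\varepsilon_{xx}(x,s)$ on $0<x<1$, $\varepsilon_x(0,s)=-q\varepsilon(0,s)$, $\varepsilon(1,s)=u(s)-\gamma_\eta\eta(s)$, where $u$ is the control input; the available measurement is $e(s+\tau)=\varepsilon(0,s)$, $s\in[0,t-\tau]$. Compensator: $Y_{1s}=-Y_{1x}$, $Y_1(0,s)=-c_2e(s+\tau)$. Decoupling: let $g_1,g_2:[0,1]\to\mathbb{R}^{1\times2}$ be the unique solution of $g_1''=g_1S_\eta^2$, $g_1'(0)=0$, $g_1(1)=-\gamma_\eta-g_2(1)$, $g_2'=-g_2S_\eta$, $g_2(0)=-c_2g_1(0)$. Set $z(x,s)=\varepsilon(x,s)-g_1(x)\eta(s)$ and $Y_2(x,s)=Y_1(x,s)-g_2(x)\eta(s)$. State observer: $\hat z_{ss}=\hat z_{xx}$, $\hat z_x(0,s)=-qe(s+\tau)$, $\hat z(1,s)=u(s)-(\hat Y_2(1,s)-Y_1(1,s))$, $\hat Y_{2s}=-\hat Y_{2x}$, $\hat Y_2(0,s)=-c_2\hat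 z(0,s)$. The errors $\tilde z=z-\hat z$, $\tilde Y_2=Y_2-\hat Y_2$ satisfy $\tilde z_{ss}=\tilde z_{xx}$, $\tilde z_x(0,s)=0$, $\tilde z(1,s)=-\tilde Y_2(1,s)$, $\tilde Y_{2s}=-\tilde Y_{2x}$, $\tilde Y_2(0,s)=-c_2\tilde z(0,s)$, considered in the state space $\mathcal{H}_4$ for $(\tilde z,\tilde z_s,\tilde Y_2)$. Canonical form: for $\vartheta\in\mathbb{R}$, $S_c(\vartheta)=\begin{bmatrix}0&1\\-\vartheta&0\end{bmatrix}$. Let $T$ be the nonsingular matrix with $S_c(\theta)=TS_\eta T^{-1}$ and $\gamma_\eta=g_1(0)T^{-1}$, and let $d(s)=T\eta(s)$, so $\dot d=S_c(\theta)d$. Adaptive observer: with $y_d(s)=e(s+\tau)-\hat z(0,s)=\gamma_\eta d(s)+\tilde z(0,s)$, $\dot\xi=-\iota\xi-y_d$, $\dot{\hat\chi}_1=\hat\varphi+\iota y_d+\hat\theta\xi+k_0(y_d-\hat\chi_1)$, $\dot{\hat\varphi}=-\iota\hat\varphi-\iota^2y_d$, $\dot{\hat\theta}=k_1\xi(y_d-\hat\chi_1)$, and $\hat d=(\hat\chi_1,\ \hat\varphi+\xi\hat\theta+\iota\hat\chi_1)^\top$. Let $f_1(\cdot,\vartheta)$ be the solution of $f_1''=f_1S_c(\vartheta)^2$, $f_1'(0)=0$, $f_1(0)=\gamma_\eta$ (primes are $x$-derivatives). The estimates of $(\varepsilon,\varepsilon_s)$ are $\hat\varepsilon(x,s)=\hat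 z(x,s)+f_1(x,\hat\theta(s))\hat d(s)$ and $\hat\varepsilon_s(x,s)=\hat z_s(x,s)+f_1(x,\hat\theta(s))S_c(\hat\theta(s))\hat d(s)$ (here $\hat\varepsilon_s$ is a notation defined by this formula). The errors $\tilde\varepsilon=\varepsilon-\hat\varepsilon$ and $\tilde\varepsilon_s=\varepsilon_s-\hat\varepsilon_s$ are given by $$\tilde\varepsilon(x,s)=\tilde z(x,s)+f_1(x,\theta)d(s)-f_1(x,\hat\theta(s))\hat d(s),$$ $$\tilde\varepsilon_s(x,s)=\tilde z_s(x,s)+f_1(x,\theta)S_c(\theta)d(s)-f_1(x,\hat\theta(s))S_c(\hat\theta(s))\hat d(s).$$ *)

theory Defs
  imports "HOL-Analysis.Analysis"
begin

section \<open>Function spaces on the unit interval\<close>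

text \<open>
  Elements of \<open>L\<^sup>2(0,1)\<close> are represented by square integrable functions, identified when they agree
  almost everywhere.  Elements of \<open>H\<^sup>1(0,1)\<close> are represented by their absolutely continuous
  representative on \<open>[0,1]\<close> (so that boundary values make sense) and are identified when they
  agree on \<open>[0,1]\<close>.  Values outside \<open>[0,1]\<close> are irrelevant throughout.
\<close>

definition L2 :: "(real \<Rightarrow> real) set" where
  "L2 = {f. f \<in> borel_measurable (lebesgue_on {0..1}) \<and>
            integrable (lebesgue_on {0..1}) (\<lambda>x. (f x)\<^sup>2)}"

definition l2_norm :: "(real \<Rightarrow> real) \<Rightarrow> real" where
  "l2_norm f = sqrt (\<integral>x. (f x)\<^sup>2 \<partial>lebesgue_on {0..1})"

definition l2_eq :: "(real \<Rightarrow> real) \<Rightarrow> (real \<Rightarrow> real) \<Rightarrow> bool" where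
  "l2_eq f g \<longleftrightarrow> (AE x in lebesgue_on {0..1}. f x = g x)"

text \<open>For \<open>g \<in> L2\<close> the gauge integral below is the Lebesgue integral, so this says that
  \<open>f\<close> is absolutely continuous on \<open>[0,1]\<close> with (weak) derivative \<open>g\<close>, which is
  determined almost everywhere.\<close>

definition has_h1_deriv :: "(real \<Rightarrow> real) \<Rightarrow> (real \<Rightarrow> real) \<Rightarrow> bool" where
  "has_h1_deriv f g \<longleftrightarrow> g \<in> L2 \<and> (\<forall>x\<in>{0..1}. (g has_integral (f x - f 0)) {0..x})"

definition H1 :: "(real \<Rightarrow> real) set" where
  "H1 = {f. \<exists>g. has_h1_deriv f g}"

definition h1_eq :: "(real \<Rightarrow> real) \<Rightarrow> (real \<Rightarrow> real) \<Rightarrow> bool" where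
  "h1_eq f g \<longleftrightarrow> (\<forall>x\<in>{0..1}. f x = g x)"

definition h1_norm :: "(real \<Rightarrow> real) \<Rightarrow> real" where
  "h1_norm f = sqrt ((l2_norm f)\<^sup>2 + (l2_norm (SOME g. has_h1_deriv f g))\<^sup>2)"

type_synonym state3 = "(real \<Rightarrow> real) \<times> (real \<Rightarrow> real)"
type_synonym state4 = "(real \<Rightarrow> real) \<times> (real \<Rightarrow> real) \<times> (real \<Rightarrow> real)"

definition H3 :: "state3 set" where
  "H3 = H1 \<times> L2"

definition norm_H3 :: "state3 \<Rightarrow> real" where
  "norm_H3 = (\<lambda>(f, g). sqrt ((h1_norm f)\<^sup>2 + (l2_norm g)\<^sup>2))"

definition eq_H3 :: "state3 \<Rightarrow> state3 \<Rightarrow> bool" where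
  "eq_H3 = (\<lambda>(f, g) (f', g'). h1_eq f f' \<and> l2_eq g g')"

definition H4 :: "real \<Rightarrow> state4 set" where
  "H4 c2 = {(f, g, h). f \<in> H1 \<and> g \<in> L2 \<and> h \<in> H1 \<and> f 1 = - h 1 \<and> h 0 = - c2 * f 0}"

definition norm_H4 :: "state4 \<Rightarrow> real" where
  "norm_H4 = (\<lambda>(f, g, h). sqrt ((h1_norm f)\<^sup>2 + (l2_norm g)\<^sup>2 + (h1_norm h)\<^sup>2))"

definition eq_H4 :: "state4 \<Rightarrow> state4 \<Rightarrow> bool" where
  "eq_H4 = (\<lambda>(f, g, h) (f', g', h'). h1_eq f f' \<and> l2_eq g g' \<and> h1_eq h h')"

definition scale4 :: "real \<Rightarrow> state4 \<Rightarrow> state4" where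
  "scale4 a = (\<lambda>(f, g, h). (\<lambda>x. a * f x, \<lambda>x. a * g x, \<lambda>x. a * h x))"

text \<open>\<open>C([0,T]; H)\<close> for a space \<open>H\<close> with norm \<open>N\<close>; differences of states are taken
  componentwise and pointwise.\<close>

definition continuous_into ::
  "('v::minus) set \<Rightarrow> ('v \<Rightarrow> real) \<Rightarrow> real \<Rightarrow> (real \<Rightarrow> 'v) \<Rightarrow> bool" where
  "continuous_into H N T \<Phi> \<longleftrightarrow>
     (\<forall>s\<in>{0..T}. \<Phi> s \<in> H \<and> ((\<lambda>r. N (\<Phi> r - \<Phi> s)) \<longlongrightarrow> 0) (at s within {0..T}))"


section \<open>The wave--transport error system\<close>

text \<open>
  The graph of the system operator \<open>A(f, g, h) = (g, f'', - h')\<close> on \<open>H4\<close> with domain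
  \<open>{(f, g, h) \<in> H4. A(f, g, h) \<in> H4 \<and> f'(0) = 0}\<close>, i.e. the system
  \<open>z\<^sub>s\<^sub>s = z\<^sub>x\<^sub>x\<close>, \<open>z\<^sub>x(0,s) = 0\<close>, \<open>z(1,s) = - Y(1,s)\<close>, \<open>Y\<^sub>s = - Y\<^sub>x\<close>,
  \<open>Y(0,s) = - c2 z(0,s)\<close> for the state \<open>(z, z\<^sub>s, Y)\<close>.  The conditions \<open>z(1,s) = - Y(1,s)\<close> and
  \<open>Y(0,s) = - c2 z(0,s)\<close> are part of \<open>H4\<close>.
\<close>

definition system_operator :: "real \<Rightarrow> state4 \<Rightarrow> state4 \<Rightarrow> bool" where
  "system_operator c2 = (\<lambda>(f, g, h) (F, G, H).
     (f, g, h) \<in> H4 c2 \<and> (F, G, H) \<in> H4 c2 \<and>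
     l2_eq F g \<and>
     (\<exists>f'. has_h1_deriv f f' \<and> f' 0 = 0 \<and> has_h1_deriv f' G) \<and>
     has_h1_deriv h (\<lambda>x. - H x))"

text \<open>
  Mild solutions in the sense of semigroup theory: \<open>\<Phi> \<in> C([0,T]; H4)\<close> with
  \<open>\<integral>\<^sub>0\<^sup>s \<Phi>(r) dr \<in> D(A)\<close> and \<open>\<Phi>(s) = \<Phi>(0) + A \<integral>\<^sub>0\<^sup>s \<Phi>(r) dr\<close>.
  The \<open>H4\<close>-valued integral of the continuous function \<open>\<Phi>\<close> enters as its primitive \<open>\<Psi>\<close>,
  \<open>\<Psi>(0) = 0\<close> and \<open>\<Psi>' = \<Phi>\<close> in \<open>H4\<close>; an integral taken pointwise in \<open>x\<close> would depend on
  the choice of the representatives of the \<open>L\<^sup>2\<close> component.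
\<close>

definition mild_solution :: "real \<Rightarrow> real \<Rightarrow> state4 \<Rightarrow> (real \<Rightarrow> state4) \<Rightarrow> bool" where
  "mild_solution c2 T \<Phi>0 \<Phi> \<longleftrightarrow>
     continuous_into (H4 c2) norm_H4 T \<Phi> \<and>
     eq_H4 (\<Phi> 0) \<Phi>0 \<and>
     (\<exists>\<Psi>. \<Psi> 0 = (\<lambda>x. 0, \<lambda>x. 0, \<lambda>x. 0) \<and>
          (\<forall>s\<in>{0..T}.
             ((\<lambda>r. norm_H4 (\<Psi> r - \<Psi> s - scale4 (r - s) (\<Phi> s)) / \<bar>r - s\<bar>) \<longlongrightarrow> 0)
               (at s within {0..T}) \<and>
             system_operator c2 (\<Psi> s) (\<Phi> s - \<Phi> 0)))"


section \<open>Disturbance, decoupling functions and canonical form\<close>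

definition S_eta :: "real \<Rightarrow> real^2^2" where
  "S_eta \<omega> = vector [vector [0, \<omega>], vector [- \<omega>, 0]]"

definition S_c :: "real \<Rightarrow> real^2^2" where
  "S_c \<nu> = vector [vector [0, 1], vector [- \<nu>, 0]]"

text \<open>Row and column vectors are both of type \<open>real^2\<close>: a row times a matrix is \<open>v*\<close>, a matrix
  times a column is \<open>*v\<close>, and a row times a column is the inner product.\<close>

definition gamma_eta :: "real^2" where
  "gamma_eta = vector [1, 0]"

definition disturbance :: "real \<Rightarrow> real \<Rightarrow> real \<Rightarrow> (real \<Rightarrow> real^2) \<Rightarrow> bool" where
  "disturbance \<omega> A B \<eta> \<longleftrightarrow>
     \<eta> 0 = vector [A, B] \<and>
     (\<forall>s\<ge>0. (\<eta> has_vector_derivative (S_eta \<omega> *v \<eta> s)) (at s within {0..}))"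

definition decoupling :: "real \<Rightarrow> real \<Rightarrow> (real \<Rightarrow> real^2) \<Rightarrow> (real \<Rightarrow> real^2) \<Rightarrow> bool" where
  "decoupling \<omega> c2 g1 g2 \<longleftrightarrow>
     (\<exists>g1'. (\<forall>x\<in>{0..1}.
               (g1 has_vector_derivative g1' x) (at x within {0..1}) \<and>
               (g1' has_vector_derivative (g1 x v* (S_eta \<omega> ** S_eta \<omega>))) (at x within {0..1})) \<and>
            g1' 0 = 0) \<and>
     g1 1 = - gamma_eta - g2 1 \<and>
     (\<forall>x\<in>{0..1}. (g2 has_vector_derivative (- (g2 x v* S_eta \<omega>))) (at x within {0..1})) \<and>
     g2 0 = - c2 *\<^sub>R g1 0"

definition canonical_transformation ::
  "real \<Rightarrow> real \<Rightarrow> (real \<Rightarrow> real^2) \<Rightarrow> real^2^2 \<Rightarrow> bool" where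
  "canonical_transformation \<omega> \<theta> g1 T \<longleftrightarrow>
     invertible T \<and>
     S_c \<theta> = T ** S_eta \<omega> ** matrix_inv T \<and>
     gamma_eta = g1 0 v* matrix_inv T"

text \<open>\<open>f1 \<nu>\<close> is the row-vector valued function \<open>x \<mapsto> f\<^sub>1(x,\<nu>)\<close>.\<close>

definition output_profile :: "(real \<Rightarrow> real \<Rightarrow> real^2) \<Rightarrow> bool" where
  "output_profile f1 \<longleftrightarrow>
     (\<forall>\<nu>. f1 \<nu> 0 = gamma_eta \<and>
        (\<exists>f1'. (\<forall>x\<in>{0..1}.
                  (f1 \<nu> has_vector_derivative f1' x) (at x within {0..1}) \<and>
                  (f1' has_vector_derivative (f1 \<nu> x v* (S_c \<nu> ** S_c \<nu>))) (at x within {0..1})) \<and>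
               f1' 0 = 0))"


section \<open>Adaptive observer and state estimation errors\<close>

text \<open>The adaptive observer on \<open>[0,T]\<close>, driven by \<open>y = y\<^sub>d\<close>; the variables \<open>\<xi>\<close>, \<open>chi\<close>, \<open>\<phi>\<close>, \<open>\<theta>h\<close>
  stand for \<open>\<xi>\<close> and the estimates of \<open>\<chi>\<^sub>1\<close>, \<open>\<phi>\<close> and \<open>\<theta>\<close>.\<close>

definition adaptive_observer ::
  "real \<Rightarrow> real \<Rightarrow> real \<Rightarrow> real \<Rightarrow> (real \<Rightarrow> real) \<Rightarrow>
   (real \<Rightarrow> real) \<Rightarrow> (real \<Rightarrow> real) \<Rightarrow> (real \<Rightarrow> real) \<Rightarrow> (real \<Rightarrow> real) \<Rightarrow> bool" where
  "adaptive_observer \<iota> k0 k1 T y \<xi> chi \<phi> \<theta>h \<longleftrightarrow>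
     (\<forall>s\<in>{0..T}.
        (\<xi> has_real_derivative (- \<iota> * \<xi> s - y s)) (at s within {0..T}) \<and>
        (chi has_real_derivative (\<phi> s + \<iota> * y s + \<theta>h s * \<xi> s + k0 * (y s - chi s)))
          (at s within {0..T}) \<and>
        (\<phi> has_real_derivative (- \<iota> * \<phi> s - \<iota>\<^sup>2 * y s)) (at s within {0..T}) \<and>
        (\<theta>h has_real_derivative (k1 * \<xi> s * (y s - chi s))) (at s within {0..T}))"

definition d_hat :: "real \<Rightarrow> real \<Rightarrow> real \<Rightarrow> real \<Rightarrow> real \<Rightarrow> real^2" where
  "d_hat \<iota> \<xi> chi \<phi> \<theta>h = vector [chi, \<phi> + \<xi> * \<theta>h + \<iota> * chi]"

text \<open>The errors of the estimates of \<open>(\<epsilon>, \<epsilon>\<^sub>s)\<close> at one instant, from the values there of the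
  state \<open>(z, w, Y)\<close> of the wave--transport error system, of \<open>d\<close>, and of \<open>dh\<close> and \<open>\<theta>h\<close>
  (the estimates of \<open>d\<close> and \<open>\<theta>\<close>).\<close>

definition estimation_error ::
  "(real \<Rightarrow> real \<Rightarrow> real^2) \<Rightarrow> real \<Rightarrow> real^2 \<Rightarrow> state4 \<Rightarrow> real^2 \<Rightarrow> real \<Rightarrow> state3" where
  "estimation_error f1 \<theta> d = (\<lambda>(z, w, Y) dh \<theta>h.
     (\<lambda>x. z x + f1 \<theta> x \<bullet> d - f1 \<theta>h x \<bullet> dh,
      \<lambda>x. w x + (f1 \<theta> x v* S_c \<theta>) \<bullet> d - (f1 \<theta>h x v* S_c \<theta>h) \<bullet> dh))"

text \<open>Solutions in \<open>C([0,T]; H3)\<close> of the error system with initial value \<open>E0\<close> and underlying data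
  \<open>\<Phi>0\<close>, \<open>(\<xi>0, chi0, \<phi>0, \<theta>h0)\<close>.  Here \<open>fst (\<Phi> s) 0\<close> is the boundary value of the first component
  of the wave--transport error state, so \<open>\<gamma> d + fst (\<Phi> s) 0\<close> is \<open>y\<^sub>d\<close>.\<close>

definition error_solution ::
  "real \<Rightarrow> real \<Rightarrow> real \<Rightarrow> real \<Rightarrow> real \<Rightarrow> (real \<Rightarrow> real \<Rightarrow> real^2) \<Rightarrow> (real \<Rightarrow> real^2) \<Rightarrow>
   state4 \<Rightarrow> real \<Rightarrow> real \<Rightarrow> real \<Rightarrow> real \<Rightarrow> state3 \<Rightarrow> real \<Rightarrow> (real \<Rightarrow> state3) \<Rightarrow> bool" where
  "error_solution c2 \<iota> k0 k1 \<theta> f1 d \<Phi>0 \<xi>0 chi0 \<phi>0 \<theta>h0 E0 T E \<longleftrightarrow>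
     continuous_into H3 norm_H3 T E \<and>
     eq_H3 (E 0) E0 \<and>
     (\<exists>\<Phi> \<xi> chi \<phi> \<theta>h.
        mild_solution c2 T \<Phi>0 \<Phi> \<and>
        adaptive_observer \<iota> k0 k1 T (\<lambda>s. gamma_eta \<bullet> d s + fst (\<Phi> s) 0) \<xi> chi \<phi> \<theta>h \<and>
        \<xi> 0 = \<xi>0 \<and> chi 0 = chi0 \<and> \<phi> 0 = \<phi>0 \<and> \<theta>h 0 = \<theta>h0 \<and>
        (\<forall>s\<in>{0..T}. eq_H3 (E s)
           (estimation_error f1 \<theta> (d s) (\<Phi> s) (d_hat \<iota> (\<xi> s) (chi s) (\<phi> s) (\<theta>h s)) (\<theta>h s))))"

end

(* The wave--transport error system is solved explicitly: with a(s) = z(0,s) one has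
   z(x,s) = (a(s+x) + a(s-x))/2 and Y(x,s) = y(s-x), and the boundary conditions reduce to the recursion
   a(s+2) = (2 c2 - 1) a(s).  Since |2 c2 - 1| < 1, the state decays exponentially.  Continuity and
   differentiability in time are continuity and differentiability of translations in L2.  Uniqueness follows by tracing
   f + int g, f - int g and h back along characteristics for the primitive of a mild solution.  The
   observer errors satisfy a linear system driven by a sinusoid, up to exponentially decaying terms; a
   Lyapunov function with a cross term and a term that averages the excitation over a period is strictly
   decreasing for it.  Finally, the output profile f1(., nu) is Lipschitz in nu in H1, so the estimation
   error inherits the decay of z, of d - dh and of theta - theta_h. *)

theory Submission
  imports Defs
begin

section \<open>Square integrable functions on an interval\<close>

text \<open>The recursion is one round trip of the wave: at \<open>x = 1\<close> the condition reads
  \<open>a(s+1) + a(s-1) = - 2 y(s-1)\<close>, and the condition at \<open>x = 0\<close> replaces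
  \<open>y(s-1)\<close> by \<open>- c2 a(s-1)\<close>. States lie only in \<open>H1\<close> and
  \<open>L2\<close>, so the equations hold for time primitives; for an explicit solution the
  primitive is explicit as well. In the adaptive part decay is not automatic: the energy
  \<open>k1 x^2 + p^2\<close> of the unperturbed observer errors has the rate
  \<open>- 2 k0 k1 x^2\<close>, which says nothing about the parameter error \<open>p\<close>.
  Information on \<open>p\<close> sits in the sinusoid multiplying it, and that has zeros: the cross
  term alone gives a rate degenerating there, and averaging replaces \<open>\<sigma>^2\<close> by
  half the conserved squared amplitude, positive because \<open>A^2 + B^2 > 0\<close>. Some
  perturbations are multiplied by the errors, but their coefficients decay exponentially, so they
  cost a constant factor and cap the rate. The profile is Lipschitz only for bounded
  \<open>\<nu>\<close>; hence the estimate of \<open>\<theta>\<close> is bounded before the profile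
  is compared. The decay constants depend on parameters and initial data, never on the
  horizon.\<close>

definition sq_integrable :: "real \<Rightarrow> real \<Rightarrow> (real \<Rightarrow> real) \<Rightarrow> bool" where
  "sq_integrable m n f \<longleftrightarrow> f integrable_on {m..n} \<and> (\<lambda>x. (f x)\<^sup>2) integrable_on {m..n}"

lemma integrable_bounded:
  fixes f g :: "real \<Rightarrow> real"
  assumes "f \<in> borel_measurable (lebesgue_on {m..n})" "g integrable_on {m..n}"
    "\<And>x. x \<in> {m..n} \<Longrightarrow> \<bar>f x\<bar> \<le> g x"
  shows "f integrable_on {m..n}"
  using measurable_bounded_by_integrable_imp_absolutely_integrable[of f "{m..n}" g] assms
  by (auto simp: absolutely_integrable_on_def)

text \<open>This is why \<open>sq_integrable\<close> asks for integrability of \<open>f\<close>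
  itself besides that of its square: gauge integrability carries measurability, so the pair of
  conditions encodes membership in \<open>L2\<close> of an interval.\<close>

lemma sq_integrable_measurable:
  "sq_integrable m n f \<Longrightarrow> f \<in> borel_measurable (lebesgue_on {m..n})"
  unfolding sq_integrable_def using integrable_imp_measurable by blast

lemma abs_le_one_plus_sq: "\<bar>t\<bar> \<le> 1 + t\<^sup>2" for t :: real
proof -
  have "0 \<le> (\<bar>t\<bar> - 1)\<^sup>2" by simp
  then have "2 * \<bar>t\<bar> \<le> 1 + t\<^sup>2" by (simp add: power2_diff)
  then show ?thesis by linarith
qed

lemma sq_integrableI:
  assumes "f \<in> borel_measurable (lebesgue_on {m..n})" "(\<lambda>x. (f x)\<^sup>2) integrable_on {m..n}"
  shows "sq_integrable m n f"
proof -
  have "(\<lambda>x. 1 + (f x)\<^sup>2) integrable_on {m..n}"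
    by (intro integrable_add assms(2)) auto
  then show ?thesis
    unfolding sq_integrable_def using assms abs_le_one_plus_sq integrable_bounded by blast
qed

lemma sq_integrable_mult:
  assumes "sq_integrable m n f" "sq_integrable m n g"
  shows "(\<lambda>x. f x * g x) integrable_on {m..n}"
proof (rule integrable_bounded)
  show "(\<lambda>x. f x * g x) \<in> borel_measurable (lebesgue_on {m..n})"
    using assms[THEN sq_integrable_measurable] by measurable
  show "(\<lambda>x. (f x)\<^sup>2 + (g x)\<^sup>2) integrable_on {m..n}"
    using assms unfolding sq_integrable_def by (intro integrable_add) auto
  fix x
  have "0 \<le> (\<bar>f x\<bar> - \<bar>g x\<bar>)\<^sup>2" by simp
  then have "2 * (\<bar>f x\<bar> * \<bar>g x\<bar>) \<le> (f x)\<^sup>2 + (g x)\<^sup>2" by (simp add: power2_diff)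
  moreover have "0 \<le> \<bar>f x\<bar> * \<bar>g x\<bar>" by simp
  ultimately show "\<bar>f x * g x\<bar> \<le> (f x)\<^sup>2 + (g x)\<^sup>2" unfolding abs_mult by linarith
qed

lemma sq_integrable_add:
  assumes "sq_integrable m n f" "sq_integrable m n g"
  shows "sq_integrable m n (\<lambda>x. f x + g x)"
proof -
  have "(\<lambda>x. (f x)\<^sup>2 + (g x)\<^sup>2 + 2 * (f x * g x)) integrable_on {m..n}"
    using assms sq_integrable_mult[OF assms] unfolding sq_integrable_def
    by (intro integrable_add) auto
  then show ?thesis
    using assms unfolding sq_integrable_def by (auto simp: power2_sum integrable_add algebra_simps)
qed

lemma sq_integrable_cmult: "sq_integrable m n f \<Longrightarrow> sq_integrable m n (\<lambda>x. c * f x)"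
  unfolding sq_integrable_def
  using integrable_cmul[of f "{m..n}" c] integrable_cmul[of "\<lambda>x. (f x)\<^sup>2" "{m..n}" "c\<^sup>2"]
  by (simp add: power_mult_distrib)

lemma sq_integrable_minus: "sq_integrable m n f \<Longrightarrow> sq_integrable m n (\<lambda>x. - f x)"
  using sq_integrable_cmult[of m n f "-1"] by simp

lemma sq_integrable_diff:
  "sq_integrable m n f \<Longrightarrow> sq_integrable m n g \<Longrightarrow> sq_integrable m n (\<lambda>x. f x - g x)"
  using sq_integrable_add[OF _ sq_integrable_minus, of m n f g] by simp

lemma sq_integrable_continuous: "continuous_on {m..n} f \<Longrightarrow> sq_integrable m n f"
  unfolding sq_integrable_def
  by (auto intro!: integrable_continuous_real continuous_intros)

lemma sq_integrable_subinterval: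
  "sq_integrable m n f \<Longrightarrow> m \<le> m' \<Longrightarrow> n' \<le> n \<Longrightarrow> sq_integrable m' n' f"
  unfolding sq_integrable_def by (auto intro: integrable_on_subinterval)

lemma sq_integrable_translate:
  assumes "sq_integrable (m + s) (n + s) f"
  shows "sq_integrable m n (\<lambda>x. f (s + x))"
  using assms integrable_on_shift_Icc_real[of f s m n] integrable_on_shift_Icc_real[of "\<lambda>x. (f x)\<^sup>2" s m n]
  unfolding sq_integrable_def by (simp add: comp_def)

lemma sq_integrable_cong:
  "(\<And>x. x \<in> {m..n} \<Longrightarrow> f x = g x) \<Longrightarrow> sq_integrable m n f \<longleftrightarrow> sq_integrable m n g"
  unfolding sq_integrable_def
  by (metis (mono_tags, lifting) integrable_cong)

lemma integral_mono_interval: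
  fixes f :: "real \<Rightarrow> real"
  assumes "f integrable_on {m..n}" "m \<le> m'" "n' \<le> n" "\<And>x. 0 \<le> f x"
  shows "integral {m'..n'} f \<le> integral {m..n} f"
  using assms by (intro integral_subset_le integrable_on_subinterval[OF assms(1)]) auto

lemma integral_translate:
  fixes f :: "real \<Rightarrow> real"
  shows "integral {m..n} (\<lambda>x. f (s + x)) = integral {m + s..n + s} f"
  using integral_shift_Icc_real[of m n f s] by (simp add: comp_def)

text \<open>Plays the role of the triangle inequality, without square roots. Pointwise the right
  side exceeds the left by the squares of the three pairwise differences, whence the factor
  3.\<close>

lemma integral_sq_sum3_le:
  assumes "sq_integrable m n f" "sq_integrable m n g" "sq_integrable m n h"
  shows "integral {m..n} (\<lambda>x. (f x + g x + h x)\<^sup>2)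
    \<le> 3 * integral {m..n} (\<lambda>x. (f x)\<^sup>2) + 3 * integral {m..n} (\<lambda>x. (g x)\<^sup>2) + 3 * integral {m..n} (\<lambda>x. (h x)\<^sup>2)"
proof -
  note i = assms[unfolded sq_integrable_def]
  have "integral {m..n} (\<lambda>x. (f x + g x + h x)\<^sup>2)
    \<le> integral {m..n} (\<lambda>x. 3 * (f x)\<^sup>2 + 3 * (g x)\<^sup>2 + 3 * (h x)\<^sup>2)"
  proof (rule integral_le)
    show "(\<lambda>x. (f x + g x + h x)\<^sup>2) integrable_on {m..n}"
      using sq_integrable_add[OF sq_integrable_add[OF assms(1,2)] assms(3)]
      by (simp add: sq_integrable_def)
    show "(\<lambda>x. 3 * (f x)\<^sup>2 + 3 * (g x)\<^sup>2 + 3 * (h x)\<^sup>2) integrable_on {m..n}"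
      using i by (intro integrable_add) auto
    fix x
    have "0 \<le> (f x - g x)\<^sup>2 + (f x - h x)\<^sup>2 + (g x - h x)\<^sup>2" by simp
    then show "(f x + g x + h x)\<^sup>2 \<le> 3 * (f x)\<^sup>2 + 3 * (g x)\<^sup>2 + 3 * (h x)\<^sup>2"
      by (simp add: power2_eq_square algebra_simps)
  qed
  also have "\<dots> = 3 * integral {m..n} (\<lambda>x. (f x)\<^sup>2) + 3 * integral {m..n} (\<lambda>x. (g x)\<^sup>2) + 3 * integral {m..n} (\<lambda>x. (h x)\<^sup>2)"
    using i by (simp add: Henstock_Kurzweil_Integration.integral_add integrable_add)
  finally show ?thesis .
qed

text \<open>Cauchy--Schwarz against the constant 1: with \<open>J\<close> the integral of
  \<open>g\<close>, the integral of \<open>((n - m) * g - J)^2\<close> is nonnegative and equals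
  \<open>n - m\<close> times the difference of the two sides. Cancelling that factor leaves
  \<open>m = n\<close> as a separate case.\<close>

lemma sq_integral_le_integral_sq:
  assumes "sq_integrable m n g" "m \<le> n"
  shows "(integral {m..n} g)\<^sup>2 \<le> (n - m) * integral {m..n} (\<lambda>x. (g x)\<^sup>2)"
proof -
  define J where "J = integral {m..n} g"
  have i: "g integrable_on {m..n}" "(\<lambda>x. (g x)\<^sup>2) integrable_on {m..n}"
    using assms by (auto simp: sq_integrable_def)
  have "((\<lambda>x. (n - m)\<^sup>2 * (g x)\<^sup>2 - 2 * (n - m) * J * g x + J\<^sup>2) has_integral
      (n - m)\<^sup>2 * integral {m..n} (\<lambda>x. (g x)\<^sup>2) - 2 * (n - m) * J * J + (n - m) *\<^sub>R J\<^sup>2) {m..n}"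
    unfolding J_def
    using has_integral_const_real[of "J\<^sup>2" m n] assms(2)
    by (intro has_integral_add has_integral_diff has_integral_mult_right integrable_integral i)
       (simp_all add: J_def)
  moreover have "0 \<le> (n - m)\<^sup>2 * (g x)\<^sup>2 - 2 * (n - m) * J * g x + J\<^sup>2" for x
  proof -
    have "(n - m)\<^sup>2 * (g x)\<^sup>2 - 2 * (n - m) * J * g x + J\<^sup>2 = ((n - m) * g x - J)\<^sup>2"
      by (simp add: power2_eq_square algebra_simps)
    then show ?thesis by simp
  qed
  ultimately have "0 \<le> (n - m)\<^sup>2 * integral {m..n} (\<lambda>x. (g x)\<^sup>2) - 2 * (n - m) * J * J + (n - m) *\<^sub>R J\<^sup>2"
    by (rule has_integral_nonneg)
  then have "0 \<le> (n - m) * ((n - m) * integral {m..n} (\<lambda>x. (g x)\<^sup>2) - J\<^sup>2)"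
    by (simp add: power2_eq_square algebra_simps)
  then show ?thesis
    using assms(2) J_def by (cases "m = n") (auto simp: zero_le_mult_iff)
qed

text \<open>Truncation followed by dominated convergence.\<close>

lemma sq_integrable_approx:
  assumes f: "sq_integrable m n f" and "0 < e"
  obtains g where "continuous_on UNIV g" "integral {m..n} (\<lambda>x. (f x - g x)\<^sup>2) < e"
proof -
  define cl :: "real \<Rightarrow> real \<Rightarrow> real" where "cl K t = max (- K) (min K t)" for K t
  have cl_meas: "cl K \<in> borel_measurable borel" for K
    unfolding cl_def by measurable
  have clf: "sq_integrable m n (\<lambda>x. cl K (f x))" if "K \<ge> 0" for K
  proof (rule sq_integrableI)
    show m: "(\<lambda>x. cl K (f x)) \<in> borel_measurable (lebesgue_on {m..n})"
      using measurable_compose[OF sq_integrable_measurable[OF f] cl_meas] .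
    show "(\<lambda>x. (cl K (f x))\<^sup>2) integrable_on {m..n}"
    proof (rule integrable_bounded)
      show "(\<lambda>x. (cl K (f x))\<^sup>2) \<in> borel_measurable (lebesgue_on {m..n})"
        using m by measurable
      show "(\<lambda>x. (f x)\<^sup>2) integrable_on {m..n}" using f by (simp add: sq_integrable_def)
      show "\<bar>(cl K (f x))\<^sup>2\<bar> \<le> (f x)\<^sup>2" for x
        using that by (auto simp: cl_def abs_le_square_iff[symmetric])
    qed
  qed
  have "(\<lambda>k. integral {m..n} (\<lambda>x. (f x - cl (real k) (f x))\<^sup>2)) \<longlonglongrightarrow> integral {m..n} (\<lambda>x. 0)"
  proof (rule dominated_convergence(2))
    show "(\<lambda>x. (f x - cl (real k) (f x))\<^sup>2) integrable_on {m..n}" for k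
      using sq_integrable_diff[OF f clf[of "real k"]] by (simp add: sq_integrable_def)
    show "(\<lambda>x. (f x)\<^sup>2) integrable_on {m..n}" using f by (simp add: sq_integrable_def)
    show "norm ((f x - cl (real k) (f x))\<^sup>2) \<le> (f x)\<^sup>2" for k x
      by (auto simp: cl_def abs_le_square_iff[symmetric])
    show "(\<lambda>k. (f x - cl (real k) (f x))\<^sup>2) \<longlonglongrightarrow> 0" for x
    proof (rule tendsto_eventually)
      obtain N :: nat where "\<bar>f x\<bar> \<le> real N" using real_arch_simple by blast
      then have "\<forall>k\<ge>N. (f x - cl (real k) (f x))\<^sup>2 = 0" by (auto simp: cl_def max_def min_def)
      then show "\<forall>\<^sub>F k in sequentially. (f x - cl (real k) (f x))\<^sup>2 = 0"
        unfolding eventually_sequentially by blast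
    qed
  qed
  then have "(\<lambda>k. integral {m..n} (\<lambda>x. (f x - cl (real k) (f x))\<^sup>2)) \<longlonglongrightarrow> 0" by simp
  \<comment> \<open>Two errors of size \<open>e / 6\<close> are allowed, since
    \<open>integral_sq_sum3_le\<close> multiplies each of them by 3.\<close>
  then have "\<forall>\<^sub>F k in sequentially. integral {m..n} (\<lambda>x. (f x - cl (real k) (f x))\<^sup>2) < e / 6"
    using \<open>0 < e\<close> by (auto intro!: order_tendstoD(2))
  then obtain k where k: "integral {m..n} (\<lambda>x. (f x - cl (real k) (f x))\<^sup>2) < e / 6"
    by (auto simp: eventually_sequentially)
  define K where "K = real k"
  have K0: "K \<ge> 0" by (simp add: K_def)
  have "(\<lambda>x. if x \<in> {m..n} then f x else 0) \<in> borel_measurable lebesgue"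
    using sq_integrable_measurable[OF f] by (intro borel_measurable_if_I) auto
  then have "(\<lambda>x. if x \<in> {m..n} then f x else 0) measurable_on {m..n}"
    by (intro lebesgue_measurable_imp_measurable_on_real) auto
  then obtain N g where N: "negligible N" and g: "\<And>j. continuous_on UNIV (g j)"
    and lim: "\<And>x. x \<notin> N \<Longrightarrow> (\<lambda>j. g j x) \<longlonglongrightarrow> (if x \<in> {m..n} then f x else (0::real))"
    unfolding measurable_on_def by (smt (verit))
  \<comment> \<open>Clamping the approximants as well bounds the integrand by
    \<open>(2 * K)^2\<close>, and \<open>cl K (g j x)\<close> still tends to
    \<open>cl K (f x)\<close> because \<open>cl K\<close> is continuous.\<close>
  define G where "G j x = cl K (g j x)" for j :: nat and x :: real
  have G: "continuous_on UNIV (G j)" for j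
    unfolding G_def cl_def using g by (intro continuous_intros)
  have Gs: "sq_integrable m n (G j)" for j
    using sq_integrable_continuous continuous_on_subset[OF G] by blast
  have int: "(\<lambda>x. (cl K (f x) - G j x)\<^sup>2) integrable_on {m..n}" for j
    using sq_integrable_diff[OF clf[OF K0] Gs] by (simp add: sq_integrable_def)
  have "(\<lambda>j. integral ({m..n} - N) (\<lambda>x. (cl K (f x) - G j x)\<^sup>2)) \<longlonglongrightarrow> integral ({m..n} - N) (\<lambda>x. 0)"
  proof (rule dominated_convergence(2))
    have sp: "h integrable_on {m..n} \<Longrightarrow> h integrable_on {m..n} - N" for h :: "real \<Rightarrow> real"
      by (rule integrable_spike_set) (auto intro: negligible_subset[OF N])
    show "(\<lambda>x. (cl K (f x) - G j x)\<^sup>2) integrable_on {m..n} - N" for j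
      by (intro sp int)
    show "(\<lambda>x. (2 * K)\<^sup>2) integrable_on {m..n} - N" by (intro sp) auto
    show "norm ((cl K (f x) - G j x)\<^sup>2) \<le> (2 * K)\<^sup>2" for j x
    proof -
      have "\<bar>cl K (f x) - G j x\<bar> \<le> \<bar>2 * K\<bar>" using K0 by (auto simp: cl_def G_def)
      then show ?thesis by (simp only: abs_le_square_iff) simp
    qed
    show "(\<lambda>j. (cl K (f x) - G j x)\<^sup>2) \<longlonglongrightarrow> 0" if "x \<in> {m..n} - N" for x
    proof -
      have "(\<lambda>j. g j x) \<longlonglongrightarrow> f x" using lim[of x] that by auto
      then have "(\<lambda>j. (cl K (f x) - G j x)\<^sup>2) \<longlonglongrightarrow> (cl K (f x) - cl K (f x))\<^sup>2"
        unfolding G_def cl_def by (intro tendsto_intros)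
      then show ?thesis by simp
    qed
  qed
  moreover have "integral ({m..n} - N) (\<lambda>x. (cl K (f x) - G j x)\<^sup>2) = integral {m..n} (\<lambda>x. (cl K (f x) - G j x)\<^sup>2)" for j
    by (rule integral_spike_set) (auto intro: negligible_subset[OF N])
  ultimately have "(\<lambda>j. integral {m..n} (\<lambda>x. (cl K (f x) - G j x)\<^sup>2)) \<longlonglongrightarrow> 0" by simp
  then have "\<forall>\<^sub>F j in sequentially. integral {m..n} (\<lambda>x. (cl K (f x) - G j x)\<^sup>2) < e / 6"
    using \<open>0 < e\<close> by (auto intro!: order_tendstoD(2))
  then obtain j where j: "integral {m..n} (\<lambda>x. (cl K (f x) - G j x)\<^sup>2) < e / 6"
    by (auto simp: eventually_sequentially)
  have "integral {m..n} (\<lambda>x. ((f x - cl K (f x)) + (cl K (f x) - G j x) + 0)\<^sup>2)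
    \<le> 3 * integral {m..n} (\<lambda>x. (f x - cl K (f x))\<^sup>2) + 3 * integral {m..n} (\<lambda>x. (cl K (f x) - G j x)\<^sup>2)
      + 3 * integral {m..n} (\<lambda>x. 0\<^sup>2)"
    by (intro integral_sq_sum3_le sq_integrable_diff f clf K0 Gs sq_integrable_continuous) auto
  also have "\<dots> < e" using j k by (simp add: K_def)
  finally show ?thesis using that[OF G[of j]] by simp
qed

section \<open>Calculus in \<open>L2\<close> and \<open>H1\<close>\<close>

text \<open>Links the Lebesgue integral in the definition of \<open>L2\<close> with the gauge
  integral of the estimates; for the nonnegative \<open>f^2\<close> the two notions of integrability
  coincide.\<close>

lemma L2_iff: "f \<in> L2 \<longleftrightarrow> sq_integrable 0 1 f"
proof
  assume "f \<in> L2"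
  then show "sq_integrable 0 1 f"
    unfolding L2_def by (auto intro!: sq_integrableI integrable_on_lebesgue_on)
next
  assume f: "sq_integrable 0 1 f"
  then have "(\<lambda>x. (f x)\<^sup>2) absolutely_integrable_on {0..1}"
    by (intro nonnegative_absolutely_integrable_1) (auto simp: sq_integrable_def)
  then have "integrable (lebesgue_on {0..1}) (\<lambda>x. (f x)\<^sup>2)"
    by (simp add: absolutely_integrable_measurable_real)
  then show "f \<in> L2"
    using sq_integrable_measurable[OF f] by (simp add: L2_def)
qed

lemma l2_norm_sq: "f \<in> L2 \<Longrightarrow> (l2_norm f)\<^sup>2 = integral {0..1} (\<lambda>x. (f x)\<^sup>2)"
  unfolding l2_norm_def L2_def
  by (subst lebesgue_integral_eq_integral[symmetric]) auto

lemma l2_norm_nonneg [simp]: "0 \<le> l2_norm f"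
  unfolding l2_norm_def by simp

lemma h1_norm_nonneg [simp]: "0 \<le> h1_norm f"
  unfolding h1_norm_def by simp

lemma l2_norm_leI:
  assumes "f \<in> L2" "0 \<le> K" "integral {0..1} (\<lambda>x. (f x)\<^sup>2) \<le> K\<^sup>2"
  shows "l2_norm f \<le> K"
  by (rule power2_le_imp_le) (use assms in \<open>simp_all add: l2_norm_sq\<close>)

lemma l2_norm_bounded:
  assumes "f \<in> L2" "0 \<le> K" "\<And>x. x \<in> {0..1} \<Longrightarrow> \<bar>f x\<bar> \<le> K"
  shows "l2_norm f \<le> K"
proof (rule l2_norm_leI)
  have "integral {0..1} (\<lambda>x. (f x)\<^sup>2) \<le> integral {0..1} (\<lambda>x::real. K\<^sup>2)"
  proof (rule integral_le)
    show "(\<lambda>x. (f x)\<^sup>2) integrable_on {0..1}" using assms(1) by (simp add: L2_iff sq_integrable_def)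
    show "(f x)\<^sup>2 \<le> K\<^sup>2" if "x \<in> {0..1}" for x
      using assms(2) assms(3)[OF that] by (simp add: abs_le_square_iff[symmetric])
  qed auto
  then show "integral {0..1} (\<lambda>x. (f x)\<^sup>2) \<le> K\<^sup>2" by simp
qed (use assms in auto)

lemma L2_add: "f \<in> L2 \<Longrightarrow> g \<in> L2 \<Longrightarrow> (\<lambda>x. f x + g x) \<in> L2"
  and L2_diff: "f \<in> L2 \<Longrightarrow> g \<in> L2 \<Longrightarrow> (\<lambda>x. f x - g x) \<in> L2"
  and L2_cmult: "f \<in> L2 \<Longrightarrow> (\<lambda>x. c * f x) \<in> L2"
  and L2_continuous: "continuous_on {0..1} f \<Longrightarrow> f \<in> L2"
  by (simp_all add: L2_iff sq_integrable_add sq_integrable_diff sq_integrable_cmult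
      sq_integrable_continuous)

lemma L2_cong: "(\<And>x. x \<in> {0..1} \<Longrightarrow> f x = g x) \<Longrightarrow> f \<in> L2 \<longleftrightarrow> g \<in> L2"
  unfolding L2_iff by (rule sq_integrable_cong) auto

lemma l2_norm_cong_AE:
  assumes "f \<in> L2" "g \<in> L2" "l2_eq f g"
  shows "l2_norm f = l2_norm g"
  unfolding l2_norm_def
  using assms by (intro arg_cong[where f = sqrt] integral_cong_AE) (auto simp: L2_def l2_eq_def)

lemma l2_norm_cong: "(\<And>x. x \<in> {0..1} \<Longrightarrow> f x = g x) \<Longrightarrow> l2_norm f = l2_norm g"
  unfolding l2_norm_def
  by (intro arg_cong[where f = sqrt] Bochner_Integration.integral_cong) auto

text \<open>The factor 2 comes from \<open>integral_sq_sum3_le\<close> with third function 0, as 3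
  is at most \<open>2^2\<close>. It is harmless, because norms enter later only through limits and
  exponential rates.\<close>

lemma l2_norm_add_le:
  assumes "f \<in> L2" "g \<in> L2"
  shows "l2_norm (\<lambda>x. f x + g x) \<le> 2 * (l2_norm f + l2_norm g)"
proof (rule l2_norm_leI)
  note s = assms[unfolded L2_iff]
  have "integral {0..1} (\<lambda>x. (f x + g x + 0)\<^sup>2)
     \<le> 3 * integral {0..1} (\<lambda>x. (f x)\<^sup>2) + 3 * integral {0..1} (\<lambda>x. (g x)\<^sup>2) + 3 * integral {0..1} (\<lambda>x::real. 0\<^sup>2)"
    by (intro integral_sq_sum3_le s sq_integrable_continuous) auto
  also have "\<dots> = 3 * (l2_norm f)\<^sup>2 + 3 * (l2_norm g)\<^sup>2"
    using assms by (simp add: l2_norm_sq)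
  also have "\<dots> \<le> (2 * (l2_norm f + l2_norm g))\<^sup>2"
    by (simp add: power2_eq_square algebra_simps)
  finally show "integral {0..1} (\<lambda>x. (f x + g x)\<^sup>2) \<le> (2 * (l2_norm f + l2_norm g))\<^sup>2" by simp
qed (use assms in \<open>auto intro: L2_add\<close>)

lemma l2_norm_cmult:
  "l2_norm (\<lambda>x. c * f x) = \<bar>c\<bar> * l2_norm f"
  unfolding l2_norm_def by (simp add: power_mult_distrib real_sqrt_mult)

text \<open>At almost every point the averages over short intervals to its right converge to the value.\<close>

lemma l2_eq_zeroI:
  assumes "\<And>x. x \<in> {0..1} \<Longrightarrow> (g has_integral 0) {0..x}"
  shows "l2_eq g (\<lambda>x. 0)"
proof -
  define G where "G x = (if x \<in> {0..1} then g x else 0)" for x :: real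
  have g1: "g integrable_on {0..1}" using assms[of 1] by auto
  have "(\<lambda>x. if x \<in> {0..1} then g x else 0) integrable_on UNIV"
    using g1 by (simp only: integrable_restrict_UNIV)
  then have "G integrable_on UNIV" unfolding G_def .
  then have "G integrable_on cbox a b" for a b
    by (rule integrable_on_subcbox) auto
  then obtain N where N: "negligible N"
    and NE: "\<And>x e. \<lbrakk>x \<notin> N; 0 < e\<rbrakk> \<Longrightarrow> \<exists>d>0. \<forall>h. 0 < h \<and> h < d \<longrightarrow>
       norm (integral (cbox x (x + h *\<^sub>R One)) G /\<^sub>R h ^ DIM(real) - G x) < e"
    by (rule integrable_ccontinuous_explicit[of G]) blast
  \<comment> \<open>Otherwise the averages of \<open>G\<close> to the right of \<open>x\<close>,
    which all vanish, would have to be close to the nonzero \<open>g x\<close>. The point 1 is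
    excluded because no interval to its right stays in \<open>{0..1}\<close>.\<close>
  have zero: "g x = 0" if x: "x \<in> {0..1}" "x \<notin> N \<union> {1}" for x
  proof (rule ccontr)
    assume "g x \<noteq> 0"
    then obtain d where d: "d > 0" and le: "\<And>h. 0 < h \<Longrightarrow> h < d \<Longrightarrow> norm (integral (cbox x (x + h *\<^sub>R One)) G /\<^sub>R h ^ DIM(real) - G x) < \<bar>g x\<bar>"
      using NE[of x "\<bar>g x\<bar>"] x by auto
    define h where "h = min (d / 2) (1 - x)"
    have h: "0 < h" "h < d" "x + h \<le> 1" using d x by (auto simp: h_def)
    have c: "integral {0..x} g + integral {x..x + h} g = integral {0..x + h} g"
      using x h by (intro Henstock_Kurzweil_Integration.integral_combine integrable_on_subinterval[OF g1]) auto
    have "integral {x..x + h} G = integral {x..x + h} g"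
      using x h by (intro Henstock_Kurzweil_Integration.integral_cong) (auto simp: G_def)
    also have "\<dots> = 0"
      using c integral_unique[OF assms[of x]] integral_unique[OF assms[of "x + h"]] x h by auto
    finally show False using le[of h] h x by (simp add: G_def)
  qed
  have "negligible (N \<union> {1})" using N by auto
  then have "N \<union> {1} \<in> null_sets lebesgue" using negligible_iff_null_sets by blast
  then have "AE x in lebesgue. x \<notin> N \<union> {1}" by (rule AE_not_in)
  then have "AE x in lebesgue. x \<in> {0..1} \<longrightarrow> g x = 0"
    by (rule AE_mp) (use zero in \<open>auto intro!: AE_I2\<close>)
  then show ?thesis
    unfolding l2_eq_def by (simp add: AE_restrict_space_iff)
qed

section \<open>Weak derivatives and the norm of \<open>H1\<close>\<close>

lemma has_h1_deriv_diff:
  "has_h1_deriv f g \<Longrightarrow> has_h1_deriv f' g' \<Longrightarrow> has_h1_deriv (\<lambda>x. f x - f' x) (\<lambda>x. g x - g' x)"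
  unfolding has_h1_deriv_def
proof (elim conjE, intro conjI ballI)
  fix x :: real assume x: "x \<in> {0..1}"
    and "\<forall>x\<in>{0..1}. (g has_integral f x - f 0) {0..x}" "\<forall>x\<in>{0..1}. (g' has_integral f' x - f' 0) {0..x}"
  then have "((\<lambda>x. g x - g' x) has_integral (f x - f 0) - (f' x - f' 0)) {0..x}"
    by (intro has_integral_diff) auto
  then show "((\<lambda>x. g x - g' x) has_integral f x - f' x - (f 0 - f' 0)) {0..x}"
    by (simp add: algebra_simps)
qed (rule L2_diff)

lemma has_h1_deriv_add:
  "has_h1_deriv f g \<Longrightarrow> has_h1_deriv f' g' \<Longrightarrow> has_h1_deriv (\<lambda>x. f x + f' x) (\<lambda>x. g x + g' x)"
  unfolding has_h1_deriv_def
proof (elim conjE, intro conjI ballI)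
  fix x :: real assume x: "x \<in> {0..1}"
    and "\<forall>x\<in>{0..1}. (g has_integral f x - f 0) {0..x}" "\<forall>x\<in>{0..1}. (g' has_integral f' x - f' 0) {0..x}"
  then have "((\<lambda>x. g x + g' x) has_integral (f x - f 0) + (f' x - f' 0)) {0..x}"
    by (intro has_integral_add) auto
  then show "((\<lambda>x. g x + g' x) has_integral f x + f' x - (f 0 + f' 0)) {0..x}"
    by (simp add: algebra_simps)
qed (rule L2_add)

lemma has_h1_deriv_cmult:
  "has_h1_deriv f g \<Longrightarrow> has_h1_deriv (\<lambda>x. c * f x) (\<lambda>x. c * g x)"
  unfolding has_h1_deriv_def
proof (elim conjE, intro conjI ballI)
  fix x :: real assume x: "x \<in> {0..1}"
    and "\<forall>x\<in>{0..1}. (g has_integral f x - f 0) {0..x}"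
  then have "((\<lambda>x. c * g x) has_integral c * (f x - f 0)) {0..x}"
    by (intro has_integral_mult_right) auto
  then show "((\<lambda>x. c * g x) has_integral c * f x - c * f 0) {0..x}"
    by (simp add: algebra_simps)
qed (rule L2_cmult)

lemma has_h1_deriv_cong:
  assumes "has_h1_deriv f g" "\<And>x. x \<in> {0..1} \<Longrightarrow> f x = f' x" "\<And>x. x \<in> {0..1} \<Longrightarrow> g x = g' x"
  shows "has_h1_deriv f' g'"
  unfolding has_h1_deriv_def
proof (intro conjI ballI)
  show "g' \<in> L2" using assms(1) L2_cong[OF assms(3)] by (auto simp: has_h1_deriv_def)
  fix x :: real assume x: "x \<in> {0..1}"
  have "(g has_integral f x - f 0) {0..x}" using assms(1) x by (simp add: has_h1_deriv_def)
  then have "(g' has_integral f x - f 0) {0..x}"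
    by (rule has_integral_eq[rotated]) (use x assms(3) in auto)
  then show "(g' has_integral f' x - f' 0) {0..x}" using assms(2) x by auto
qed

lemma has_h1_deriv_unique:
  assumes "has_h1_deriv f g" "has_h1_deriv f g'"
  shows "l2_eq g g'"
proof -
  have "l2_eq (\<lambda>x. g x - g' x) (\<lambda>x. 0)"
    using has_h1_deriv_diff[OF assms] by (intro l2_eq_zeroI) (simp add: has_h1_deriv_def)
  then show ?thesis by (simp add: l2_eq_def)
qed

lemma has_h1_deriv_continuous: "has_h1_deriv f g \<Longrightarrow> continuous_on {0..1} f"
proof -
  assume f: "has_h1_deriv f g"
  have "continuous_on {0..1} (\<lambda>x. f 0 + integral {0..x} g)"
    using f by (intro continuous_intros indefinite_integral_continuous_1)
      (auto simp: has_h1_deriv_def L2_iff sq_integrable_def)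
  moreover have "f 0 + integral {0..x} g = f x" if "x \<in> {0..1}" for x
    using f that integral_unique[of g "f x - f 0" "{0..x}"] by (auto simp: has_h1_deriv_def)
  ultimately show ?thesis by (rule continuous_on_eq)
qed

lemma has_h1_deriv_L2: "has_h1_deriv f g \<Longrightarrow> f \<in> L2" "has_h1_deriv f g \<Longrightarrow> g \<in> L2"
  using has_h1_deriv_continuous L2_continuous by (blast, simp add: has_h1_deriv_def)

lemma has_h1_deriv_H1: "has_h1_deriv f g \<Longrightarrow> f \<in> H1"
  by (auto simp: H1_def)

text \<open>The norm is defined with an arbitrarily chosen weak derivative; uniqueness up to null
  sets allows computing it with any other.\<close>

lemma h1_norm_sq:
  assumes "has_h1_deriv f g"
  shows "(h1_norm f)\<^sup>2 = (l2_norm f)\<^sup>2 + (l2_norm g)\<^sup>2"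
proof -
  have s: "has_h1_deriv f (SOME g. has_h1_deriv f g)"
    using assms by (rule someI[where P = "has_h1_deriv f"])
  have "l2_norm (SOME g. has_h1_deriv f g) = l2_norm g"
    using has_h1_deriv_unique[OF s assms] has_h1_deriv_L2(2)[OF s] has_h1_deriv_L2(2)[OF assms]
    by (intro l2_norm_cong_AE)
  then show ?thesis unfolding h1_norm_def by simp
qed

lemma h1_norm_le:
  assumes "has_h1_deriv f g"
  shows "h1_norm f \<le> l2_norm f + l2_norm g"
proof (rule power2_le_imp_le)
  have "0 \<le> l2_norm f * l2_norm g" by simp
  then show "(h1_norm f)\<^sup>2 \<le> (l2_norm f + l2_norm g)\<^sup>2"
    using h1_norm_sq[OF assms] by (simp add: power2_sum)
qed simp

lemma l2_norm_le_h1_norm: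
  assumes "has_h1_deriv f g"
  shows "l2_norm f \<le> h1_norm f" "l2_norm g \<le> h1_norm f"
  by (rule power2_le_imp_le; use h1_norm_sq[OF assms] in simp)+

lemma h1_norm_add_le:
  assumes "has_h1_deriv f g" "has_h1_deriv f' g'"
  shows "h1_norm (\<lambda>x. f x + f' x) \<le> 4 * (h1_norm f + h1_norm f')"
proof -
  note L = has_h1_deriv_L2[OF assms(1)] has_h1_deriv_L2[OF assms(2)]
  have "h1_norm (\<lambda>x. f x + f' x) \<le> l2_norm (\<lambda>x. f x + f' x) + l2_norm (\<lambda>x. g x + g' x)"
    by (rule h1_norm_le[OF has_h1_deriv_add[OF assms]])
  also have "\<dots> \<le> 2 * (l2_norm f + l2_norm f') + 2 * (l2_norm g + l2_norm g')"
    by (intro add_mono l2_norm_add_le L)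
  also have "\<dots> \<le> 4 * (h1_norm f + h1_norm f')"
    using l2_norm_le_h1_norm[OF assms(1)] l2_norm_le_h1_norm[OF assms(2)]
    unfolding distrib_left by linarith
  finally show ?thesis .
qed

lemma h1_norm_cmult:
  assumes "has_h1_deriv f g"
  shows "h1_norm (\<lambda>x. c * f x) = \<bar>c\<bar> * h1_norm f"
proof (rule power2_eq_imp_eq)
  show "(h1_norm (\<lambda>x. c * f x))\<^sup>2 = (\<bar>c\<bar> * h1_norm f)\<^sup>2"
    using h1_norm_sq[OF assms] h1_norm_sq[OF has_h1_deriv_cmult[OF assms, of c]]
    by (simp add: l2_norm_cmult power_mult_distrib algebra_simps)
qed auto

text \<open>Agreement on \<open>{0..1}\<close> makes \<open>has_h1_deriv f\<close> and
  \<open>has_h1_deriv f'\<close> the same predicate, so the choice inside the norm picks the same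
  derivative for both.\<close>

lemma h1_norm_cong:
  assumes "\<And>x. x \<in> {0..1} \<Longrightarrow> f x = f' x"
  shows "h1_norm f = h1_norm f'"
proof -
  have "has_h1_deriv f g = has_h1_deriv f' g" for g
  proof
    show "has_h1_deriv f g \<Longrightarrow> has_h1_deriv f' g"
      by (erule has_h1_deriv_cong) (rule assms, auto)
    show "has_h1_deriv f' g \<Longrightarrow> has_h1_deriv f g"
      by (erule has_h1_deriv_cong) (rule assms[symmetric], auto)
  qed
  then have "has_h1_deriv f = has_h1_deriv f'" by (rule ext)
  moreover have "l2_norm f = l2_norm f'" using assms by (rule l2_norm_cong)
  ultimately show ?thesis unfolding h1_norm_def by (simp only:)
qed

text \<open>Sobolev embedding in dimension one. By Cauchy--Schwarz \<open>f\<close> varies by at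
  most \<open>l2_norm g\<close>, hence \<open>(f x)^2 \<le> 2 * (f y)^2 + 2 * (l2_norm g)^2\<close>
  for every \<open>y\<close>; integrating over \<open>y\<close> gives the bound.\<close>

lemma sup_le_h1_norm:
  assumes f: "has_h1_deriv f g" and x: "x \<in> {0..1}"
  shows "\<bar>f x\<bar> \<le> 2 * h1_norm f"
proof -
  note L = has_h1_deriv_L2[OF f]
  have g: "sq_integrable 0 1 g" using L by (simp add: L2_iff)
  have osc: "(f y - f x)\<^sup>2 \<le> (l2_norm g)\<^sup>2" if xy: "x \<le> y" "x \<in> {0..1}" "y \<in> {0..1}" for x y
  proof -
    have gi: "g integrable_on {0..1}" using g by (simp add: sq_integrable_def)
    have gxy: "sq_integrable x y g" using sq_integrable_subinterval[OF g] xy by auto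
    have "integral {0..x} g + integral {x..y} g = integral {0..y} g"
      using xy by (intro Henstock_Kurzweil_Integration.integral_combine integrable_on_subinterval[OF gi]) auto
    moreover have "integral {0..z} g = f z - f 0" if "z \<in> {0..1}" for z
      using f that by (auto simp: has_h1_deriv_def)
    ultimately have "f y - f x = integral {x..y} g" using xy by auto
    then have "(f y - f x)\<^sup>2 \<le> (y - x) * integral {x..y} (\<lambda>x. (g x)\<^sup>2)"
      using sq_integral_le_integral_sq[OF gxy] xy by simp
    also have "\<dots> \<le> 1 * integral {0..1} (\<lambda>x. (g x)\<^sup>2)"
      using xy gxy g by (intro mult_mono integral_mono_interval integral_nonneg) (auto simp: sq_integrable_def)
    finally show ?thesis using L by (simp add: l2_norm_sq)
  qed
  have osc': "(f y - f x)\<^sup>2 \<le> (l2_norm g)\<^sup>2" if "y \<in> {0..1}" for y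
  proof (cases "x \<le> y")
    case True
    then show ?thesis using osc[OF True x that] by simp
  next
    case False
    then have "(f x - f y)\<^sup>2 \<le> (l2_norm g)\<^sup>2" using that x by (intro osc) simp_all
    then show ?thesis by (simp only: power2_commute)
  qed
  have pt: "(f x)\<^sup>2 \<le> 2 * (f y)\<^sup>2 + 2 * (l2_norm g)\<^sup>2" if "y \<in> {0..1}" for y
  proof -
    have "0 \<le> (f x - 2 * f y)\<^sup>2" by simp
    then have "(f x)\<^sup>2 \<le> 2 * (f y)\<^sup>2 + 2 * (f y - f x)\<^sup>2"
      by (simp add: power2_eq_square algebra_simps)
    with osc'[OF that] show ?thesis by linarith
  qed
  have fi: "(\<lambda>y. (f y)\<^sup>2) integrable_on {0..1}" using L by (simp add: L2_iff sq_integrable_def)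
  have "integral {0..1} (\<lambda>y::real. (f x)\<^sup>2) \<le> integral {0..1} (\<lambda>y. 2 * (f y)\<^sup>2 + 2 * (l2_norm g)\<^sup>2)"
    by (intro integral_le pt integrable_add integrable_const_ivl) (use fi in auto)
  also have "\<dots> = 2 * (l2_norm f)\<^sup>2 + 2 * (l2_norm g)\<^sup>2"
    using fi by (subst Henstock_Kurzweil_Integration.integral_add) (auto simp: l2_norm_sq[OF L(1)])
  also have "\<dots> \<le> (2 * h1_norm f)\<^sup>2" using h1_norm_sq[OF f] by simp
  finally have "\<bar>f x\<bar>\<^sup>2 \<le> (2 * h1_norm f)\<^sup>2" by simp
  then show ?thesis by (rule power2_le_imp_le) simp
qed

lemma norm_H4_le: "norm_H4 (f, g, h) \<le> h1_norm f + l2_norm g + h1_norm h"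
proof -
  have "sqrt ((h1_norm f)\<^sup>2 + (l2_norm g)\<^sup>2 + (h1_norm h)\<^sup>2) \<le> h1_norm f + l2_norm g + h1_norm h"
    by (rule real_le_lsqrt) (auto simp: power2_eq_square algebra_simps intro!: add_nonneg_nonneg)
  then show ?thesis by (simp add: norm_H4_def)
qed

lemma norm_H3_le: "norm_H3 (f, g) \<le> h1_norm f + l2_norm g"
  unfolding norm_H3_def by (auto intro: sqrt_sum_squares_le_sum)

lemma le_norm_H4:
  "h1_norm f \<le> norm_H4 (f, g, h)" "l2_norm g \<le> norm_H4 (f, g, h)" "h1_norm h \<le> norm_H4 (f, g, h)"
  unfolding norm_H4_def by (auto intro!: real_le_rsqrt)

lemma norm_H4_nonneg [simp]: "0 \<le> norm_H4 X"
  unfolding norm_H4_def by (auto split: prod.split)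

lemma norm_H3_nonneg [simp]: "0 \<le> norm_H3 X"
  unfolding norm_H3_def by (auto split: prod.split)

section \<open>Translations of locally \<open>H1\<close> functions\<close>

text \<open>Local \<open>H1\<close> on the whole line with a fixed representative of the derivative.
  Travelling waves are windows of one such function, and translation, reflection and gluing act
  directly on the pair.\<close>

definition locH1 :: "(real \<Rightarrow> real) \<Rightarrow> (real \<Rightarrow> real) \<Rightarrow> bool" where
  "locH1 a \<alpha> \<longleftrightarrow> (\<forall>m n. m \<le> n \<longrightarrow> (\<alpha> has_integral a n - a m) {m..n} \<and>
     (\<lambda>x. (\<alpha> x)\<^sup>2) integrable_on {m..n})"

lemma locH1D:
  assumes "locH1 a \<alpha>" "m \<le> n"
  shows "(\<alpha> has_integral a n - a m) {m..n}" "(\<lambda>x. (\<alpha> x)\<^sup>2) integrable_on {m..n}"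
  using assms unfolding locH1_def by blast+

lemma locH1_sq_integrable: "locH1 a \<alpha> \<Longrightarrow> sq_integrable m n \<alpha>"
proof (cases "m \<le> n")
  case True
  assume "locH1 a \<alpha>"
  from locH1D[OF this True] show ?thesis
    unfolding sq_integrable_def by (simp add: has_integral_integrable)
qed (simp add: sq_integrable_def integrable_on_empty)

lemma locH1_continuous:
  assumes "locH1 a \<alpha>"
  shows "continuous_on S a"
proof -
  have "isCont a x" for x
  proof -
    have "continuous_on {x - 1..x + 1} (\<lambda>y. a (x - 1) + integral {x - 1..y} \<alpha>)"
      using locH1_sq_integrable[OF assms, of "x - 1" "x + 1"]
      by (intro continuous_intros indefinite_integral_continuous_1) (simp add: sq_integrable_def)
    then have "continuous_on {x - 1..x + 1} a"
    proof (rule continuous_on_eq)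
      fix y assume "y \<in> {x - 1..x + 1}"
      then show "a (x - 1) + integral {x - 1..y} \<alpha> = a y"
        using integral_unique[OF locH1D(1)[OF assms, of "x - 1" y]] by simp
    qed
    then show ?thesis by (rule continuous_on_interior) simp
  qed
  then show ?thesis by (simp add: continuous_at_imp_continuous_on)
qed

lemma locH1_add:
  assumes "locH1 a \<alpha>" "locH1 b \<beta>"
  shows "locH1 (\<lambda>x. a x + b x) (\<lambda>x. \<alpha> x + \<beta> x)"
  unfolding locH1_def
proof (intro allI impI conjI)
  fix m n :: real assume mn: "m \<le> n"
  have "((\<lambda>x. \<alpha> x + \<beta> x) has_integral (a n - a m) + (b n - b m)) {m..n}"
    by (intro has_integral_add locH1D assms mn)
  then show "((\<lambda>x. \<alpha> x + \<beta> x) has_integral a n + b n - (a m + b m)) {m..n}"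
    by (simp add: algebra_simps)
  show "(\<lambda>x. (\<alpha> x + \<beta> x)\<^sup>2) integrable_on {m..n}"
    using sq_integrable_add[OF assms[THEN locH1_sq_integrable]] by (simp add: sq_integrable_def)
qed

lemma locH1_cmult:
  assumes "locH1 a \<alpha>"
  shows "locH1 (\<lambda>x. c * a x) (\<lambda>x. c * \<alpha> x)"
  unfolding locH1_def
proof (intro allI impI conjI)
  fix m n :: real assume mn: "m \<le> n"
  have "((\<lambda>x. c * \<alpha> x) has_integral c * (a n - a m)) {m..n}"
    by (intro has_integral_mult_right locH1D assms mn)
  then show "((\<lambda>x. c * \<alpha> x) has_integral c * a n - c * a m) {m..n}"
    by (simp add: algebra_simps)
  show "(\<lambda>x. (c * \<alpha> x)\<^sup>2) integrable_on {m..n}"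
    using sq_integrable_cmult[OF assms[THEN locH1_sq_integrable]] by (simp add: sq_integrable_def)
qed

lemma locH1_translate:
  assumes "locH1 a \<alpha>"
  shows "locH1 (\<lambda>x. a (s + x)) (\<lambda>x. \<alpha> (s + x))"
  unfolding locH1_def
proof (intro allI impI conjI)
  fix m n :: real assume mn: "m \<le> n"
  have "(\<alpha> has_integral a (n + s) - a (m + s)) {m + s..n + s}"
    using mn by (intro locH1D assms) auto
  then show "((\<lambda>x. \<alpha> (s + x)) has_integral a (s + n) - a (s + m)) {m..n}"
    using has_integral_shift_Icc_real[of \<alpha> s _ m n] by (simp add: comp_def add.commute)
  show "(\<lambda>x. (\<alpha> (s + x))\<^sup>2) integrable_on {m..n}"
    using sq_integrable_translate[OF locH1_sq_integrable[OF assms]] by (simp add: sq_integrable_def)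
qed

lemma locH1_reflect:
  assumes "locH1 a \<alpha>"
  shows "locH1 (\<lambda>x. a (- x)) (\<lambda>x. - \<alpha> (- x))"
  unfolding locH1_def
proof (intro allI impI conjI)
  fix m n :: real assume mn: "m \<le> n"
  note d = locH1D[OF assms, of "- n" "- m"]
  have "((\<lambda>x. \<alpha> (- x)) has_integral a (- m) - a (- n)) {m..n}"
    using d(1) mn has_integral_reflect_real[of \<alpha> "a (- m) - a (- n)" "- m" "- n"] by simp
  from has_integral_neg[OF this]
  show "((\<lambda>x. - \<alpha> (- x)) has_integral a (- n) - a (- m)) {m..n}" by simp
  show "(\<lambda>x. (- \<alpha> (- x))\<^sup>2) integrable_on {m..n}"
    using d(2) mn Henstock_Kurzweil_Integration.integrable_reflect_real[of "\<lambda>x. (\<alpha> x)\<^sup>2" "- m" "- n"] by simp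
qed

text \<open>Derivatives are compared on the open interval only, since a glued function has an
  arbitrary derivative at a break point; the two endpoints form a negligible set.\<close>

lemma locH1_cong_interval:
  assumes "locH1 a \<alpha>" "m \<le> n" "b n = a n" "b m = a m" "\<And>x. x \<in> {m<..<n} \<Longrightarrow> \<beta> x = \<alpha> x"
  shows "(\<beta> has_integral b n - b m) {m..n} \<and> (\<lambda>x. (\<beta> x)\<^sup>2) integrable_on {m..n}"
proof
  have neg: "negligible {m, n}" by simp
  show "(\<beta> has_integral b n - b m) {m..n}"
    using locH1D(1)[OF assms(1,2)] has_integral_spike[OF neg _ locH1D(1)[OF assms(1,2)], of \<beta>] assms(3-5)
    by auto
  show "(\<lambda>x. (\<beta> x)\<^sup>2) integrable_on {m..n}"
    using assms(5) by (intro integrable_spike[OF locH1D(2)[OF assms(1,2)] neg]) auto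
qed

text \<open>Absolute continuity survives a kink: the pieces have to agree in value at
  \<open>c\<close>, while the derivative may jump. An interval across \<open>c\<close> is split
  there.\<close>

lemma locH1_glue:
  assumes a: "locH1 a \<alpha>" and b: "locH1 b \<beta>" and c: "a c = b c"
  shows "locH1 (\<lambda>x. if x < c then a x else b x) (\<lambda>x. if x < c then \<alpha> x else \<beta> x)"
    (is "locH1 ?a ?\<alpha>")
  unfolding locH1_def
proof (intro allI impI)
  fix m n :: real assume mn: "m \<le> n"
  let ?P = "\<lambda>m n. (?\<alpha> has_integral ?a n - ?a m) {m..n} \<and> (\<lambda>x. (?\<alpha> x)\<^sup>2) integrable_on {m..n}"
  have left: "?P m n" if "m \<le> n" "n \<le> c" for m n
  \<comment> \<open>If \<open>m = c\<close>, the interval is the single point \<open>c\<close>,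
    where the glued function takes its value from \<open>b\<close>.\<close>
  proof (cases "m = c")
    case True
    then show ?thesis using that by (intro locH1_cong_interval[OF b]) auto
  next
    case False
    then show ?thesis using that c by (intro locH1_cong_interval[OF a]) auto
  qed
  have right: "?P m n" if "m \<le> n" "c \<le> m" for m n
    using that c by (intro locH1_cong_interval[OF b]) auto
  consider "n \<le> c" | "c \<le> m" | "m < c" "c < n" by linarith
  then show "?P m n"
  proof cases
    case 3
    have "(?\<alpha> has_integral (?a c - ?a m) + (?a n - ?a c)) {m..n}"
      using 3 left[of m c] right[of c n] by (intro has_integral_combine[of m c n]) auto
    moreover have "(\<lambda>x. (?\<alpha> x)\<^sup>2) integrable_on {m..n}"
      using 3 left[of m c] right[of c n] by (intro Henstock_Kurzweil_Integration.integrable_combine[of m c n]) auto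
    ultimately show ?thesis by simp
  qed (use left right mn in auto)
qed

lemma locH1_window: "locH1 a \<alpha> \<Longrightarrow> has_h1_deriv (\<lambda>x. a (s + x)) (\<lambda>x. \<alpha> (s + x))"
  unfolding has_h1_deriv_def L2_iff
  using locH1_sq_integrable[OF locH1_translate] locH1D(1)[OF locH1_translate, of a \<alpha> 0 _ s]
  by auto

text \<open>Clamping the argument continues \<open>f\<close> by its boundary values, with derivative
  0 outside, so that initial data become functions on the line to which translation and gluing
  apply.\<close>

lemma locH1_extend:
  assumes f: "has_h1_deriv f g"
  shows "locH1 (\<lambda>x. f (max 0 (min 1 x))) (\<lambda>x. if x \<in> {0..1} then g x else 0)"
  unfolding locH1_def
proof (intro allI impI)
  fix m n :: real assume mn: "m \<le> n"
  have g: "sq_integrable 0 1 g" using f by (simp add: has_h1_deriv_def L2_iff)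
  then have gi: "g integrable_on {0..1}" by (simp add: sq_integrable_def)
  define p q where "p = max m 0" and "q = min n 1"
  have eq: "{0..1} \<inter> {m..n} = {p..q}" by (auto simp: p_def q_def)
  have i: "(g has_integral f (max 0 (min 1 n)) - f (max 0 (min 1 m))) {p..q}"
  proof (cases "p \<le> q")
    case True
    have "integral {0..p} g + integral {p..q} g = integral {0..q} g"
      using True p_def q_def
      by (intro Henstock_Kurzweil_Integration.integral_combine integrable_on_subinterval[OF gi]) auto
    moreover have "integral {0..z} g = f z - f 0" if "z \<in> {0..1}" for z
      using f that by (auto simp: has_h1_deriv_def)
    moreover have "p \<in> {0..1}" "q \<in> {0..1}" using True by (auto simp: p_def q_def)
    ultimately have "integral {p..q} g = f q - f p" by auto
    moreover have "max 0 (min 1 n) = q" "max 0 (min 1 m) = p" using True by (auto simp: p_def q_def)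
    moreover have "g integrable_on {p..q}"
      by (rule integrable_on_subinterval[OF gi]) (auto simp: p_def q_def)
    ultimately show ?thesis by (metis has_integral_integrable_integral)
  next
    \<comment> \<open>Here \<open>{m..n}\<close> misses the unit interval: both clamped endpoints
      coincide and the increment is 0.\<close>
    case False
    then have "max 0 (min 1 n) = max 0 (min 1 m)" using mn by (auto simp: p_def q_def)
    then show ?thesis using False by simp
  qed
  have "(\<lambda>x. (g x)\<^sup>2) integrable_on {p..q}"
    by (rule integrable_on_subinterval[of _ "{0..1}"]) (use g in \<open>auto simp: sq_integrable_def p_def q_def\<close>)
  then have "(\<lambda>x. if x \<in> {0..1} then (g x)\<^sup>2 else 0) integrable_on {m..n}"
    unfolding integrable_on_def has_integral_restrict_Int eq .
  moreover have "(\<lambda>x. (if x \<in> {0..1} then g x else 0)\<^sup>2) = (\<lambda>x. if x \<in> {0..1} then (g x)\<^sup>2 else 0)"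
    by auto
  ultimately show "((\<lambda>x. if x \<in> {0..1} then g x else 0) has_integral f (max 0 (min 1 n)) - f (max 0 (min 1 m))) {m..n} \<and>
    (\<lambda>x. (if x \<in> {0..1} then g x else 0)\<^sup>2) integrable_on {m..n}"
    using i has_integral_restrict_Int[of "{0..1}" g _ "{m..n}"] by (simp only: eq)
qed

lemma locH1_C1:
  assumes "\<And>x. (b has_real_derivative a x) (at x)" "continuous_on UNIV a"
  shows "locH1 b a"
  unfolding locH1_def
proof (intro allI impI conjI)
  fix m n :: real assume mn: "m \<le> n"
  show "(a has_integral b n - b m) {m..n}"
    using mn assms(1)
    by (intro fundamental_theorem_of_calculus)
       (auto simp: has_real_derivative_iff_has_vector_derivative[symmetric] intro: DERIV_subset)
  show "(\<lambda>x. (a x)\<^sup>2) integrable_on {m..n}"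
    by (intro integrable_continuous_real continuous_intros continuous_on_subset[OF assms(2)]) auto
qed

section \<open>Continuity and differentiability of translations in \<open>L2\<close>\<close>

lemma tendsto_at_zeroI:
  fixes f :: "real \<Rightarrow> real"
  assumes "\<And>e. 0 < e \<Longrightarrow> \<exists>d>0. \<forall>r. r \<noteq> s \<and> \<bar>r - s\<bar> < d \<longrightarrow> 0 \<le> f r \<and> f r \<le> e"
  shows "(f \<longlongrightarrow> 0) (at s)"
proof (rule LIM_I)
  fix e :: real assume "0 < e"
  then obtain d where d: "d > 0" "\<forall>r. r \<noteq> s \<and> \<bar>r - s\<bar> < d \<longrightarrow> 0 \<le> f r \<and> f r \<le> e / 2"
    using assms[of "e / 2"] by auto
  have "norm (f x - 0) < e" if "x \<noteq> s" "norm (x - s) < d" for x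
  proof -
    have "0 \<le> f x" "f x \<le> e / 2" using d(2) that by auto
    then show ?thesis using \<open>0 < e\<close> by simp
  qed
  then show "\<exists>d>0. \<forall>x. x \<noteq> s \<and> norm (x - s) < d \<longrightarrow> norm (f x - 0) < e"
    using d(1) by blast
qed

lemma approx_on_interval:
  assumes "sq_integrable m n f" "0 < e"
  obtains g d where "continuous_on UNIV g" "integral {m..n} (\<lambda>x. (f x - g x)\<^sup>2) \<le> e" "0 < d"
    "\<And>u v. u \<in> {m..n} \<Longrightarrow> v \<in> {m..n} \<Longrightarrow> \<bar>u - v\<bar> < d \<Longrightarrow> (g u - g v)\<^sup>2 \<le> e"
proof -
  obtain g where g: "continuous_on UNIV g" "integral {m..n} (\<lambda>x. (f x - g x)\<^sup>2) < e"
    using sq_integrable_approx[OF assms] by blast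
  have "uniformly_continuous_on {m..n} g"
    using g by (intro compact_uniformly_continuous continuous_on_subset[OF g(1)]) auto
  then obtain d where d: "d > 0" "\<forall>u\<in>{m..n}. \<forall>v\<in>{m..n}. dist v u < d \<longrightarrow> dist (g v) (g u) < sqrt e"
    unfolding uniformly_continuous_on_def using assms(2) by (meson real_sqrt_gt_zero)
  have "(g u - g v)\<^sup>2 \<le> e" if "u \<in> {m..n}" "v \<in> {m..n}" "\<bar>u - v\<bar> < d" for u v
  proof -
    have "\<bar>g u - g v\<bar> \<le> sqrt e" using d(2) that by (fastforce simp: dist_real_def)
    then have "\<bar>g u - g v\<bar>\<^sup>2 \<le> (sqrt e)\<^sup>2" by (intro power_mono) auto
    then show ?thesis using assms(2) by simp
  qed
  with that g d show ?thesis by (meson less_imp_le)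
qed

text \<open>For continuous functions this is uniform continuity. In general it passes through a
  continuous \<open>g\<close> close to \<open>\<alpha>\<close> on \<open>[s - 1, s + 2]\<close>,
  which contains every window \<open>[r, r + 1]\<close> with \<open>r\<close> at distance less than
  1 from \<open>s\<close>.\<close>

lemma l2_translation_continuous:
  assumes \<alpha>: "\<And>m n. sq_integrable m n \<alpha>"
  shows "((\<lambda>r. l2_norm (\<lambda>x. \<alpha> (r + x) - \<alpha> (s + x))) \<longlongrightarrow> 0) (at s)"
proof (rule tendsto_at_zeroI)
  fix e :: real assume e: "0 < e"
  \<comment> \<open>Each of the three terms below may contribute \<open>e^2 / 3\<close>, and
    \<open>integral_sq_sum3_le\<close> multiplies it by 3; hence the 9.\<close>
  define e' where "e' = e\<^sup>2 / 9"
  obtain g d where g: "continuous_on UNIV g"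
    and app: "integral {s - 1..s + 2} (\<lambda>x. (\<alpha> x - g x)\<^sup>2) \<le> e'" and d: "0 < d"
    and uc: "\<And>u v. u \<in> {s - 1..s + 2} \<Longrightarrow> v \<in> {s - 1..s + 2} \<Longrightarrow> \<bar>u - v\<bar> < d \<Longrightarrow> (g u - g v)\<^sup>2 \<le> e'"
    using approx_on_interval[OF \<alpha>, of e' "s - 1" "s + 2"] e by (auto simp: e'_def)
  have gs: "sq_integrable m n g" for m n
    by (intro sq_integrable_continuous continuous_on_subset[OF g]) auto
  have tr: "sq_integrable 0 1 (\<lambda>x. \<alpha> (r + x))" "sq_integrable 0 1 (\<lambda>x. g (r + x))" for r
    by (intro sq_integrable_translate \<alpha> gs)+
  have "l2_norm (\<lambda>x. \<alpha> (r + x) - \<alpha> (s + x)) \<le> e" if r: "\<bar>r - s\<bar> < min d 1" for r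
  proof (rule l2_norm_leI)
    show "(\<lambda>x. \<alpha> (r + x) - \<alpha> (s + x)) \<in> L2" by (simp add: L2_iff sq_integrable_diff tr)
    have diff: "(\<lambda>x. (\<alpha> x - g x)\<^sup>2) integrable_on {m..n}" for m n
      using sq_integrable_diff[OF \<alpha> gs] by (simp add: sq_integrable_def)
    have win: "integral {0..1} (\<lambda>x. (\<alpha> (q + x) - g (q + x))\<^sup>2) \<le> e'" if "\<bar>q - s\<bar> < 1" for q
    proof -
      have "integral {0..1} (\<lambda>x. (\<alpha> (q + x) - g (q + x))\<^sup>2) = integral {0 + q..1 + q} (\<lambda>x. (\<alpha> x - g x)\<^sup>2)"
        by (rule integral_translate)
      also have "\<dots> \<le> integral {s - 1..s + 2} (\<lambda>x. (\<alpha> x - g x)\<^sup>2)"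
        using that by (intro integral_mono_interval diff) auto
      finally show ?thesis using app by linarith
    qed
    have "integral {0..1} (\<lambda>x. ((\<alpha> (r + x) - g (r + x)) + (g (r + x) - g (s + x)) + (g (s + x) - \<alpha> (s + x)))\<^sup>2)
      \<le> 3 * integral {0..1} (\<lambda>x. (\<alpha> (r + x) - g (r + x))\<^sup>2) + 3 * integral {0..1} (\<lambda>x. (g (r + x) - g (s + x))\<^sup>2)
        + 3 * integral {0..1} (\<lambda>x. (g (s + x) - \<alpha> (s + x))\<^sup>2)"
      by (intro integral_sq_sum3_le sq_integrable_diff tr)
    also have "integral {0..1} (\<lambda>x. (g (s + x) - \<alpha> (s + x))\<^sup>2) = integral {0..1} (\<lambda>x. (\<alpha> (s + x) - g (s + x))\<^sup>2)"
      by (simp only: power2_commute)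
    also have "integral {0..1} (\<lambda>x. (g (r + x) - g (s + x))\<^sup>2) \<le> integral {0..1} (\<lambda>x::real. e')"
    proof (rule integral_le)
      show "(\<lambda>x. (g (r + x) - g (s + x))\<^sup>2) integrable_on {0..1}"
        using sq_integrable_diff[OF tr(2) tr(2)] by (simp add: sq_integrable_def)
    qed (use r in \<open>auto intro!: uc\<close>)
    finally show "integral {0..1} (\<lambda>x. (\<alpha> (r + x) - \<alpha> (s + x))\<^sup>2) \<le> e\<^sup>2"
      using win[of r] win[of s] r by (simp add: e'_def)
  qed (use e in auto)
  then show "\<exists>d>0. \<forall>r. r \<noteq> s \<and> \<bar>r - s\<bar> < d \<longrightarrow> 0 \<le> l2_norm (\<lambda>x. \<alpha> (r + x) - \<alpha> (s + x)) \<and>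
      l2_norm (\<lambda>x. \<alpha> (r + x) - \<alpha> (s + x)) \<le> e"
    using d by (intro exI[of _ "min d 1"]) auto
qed

text \<open>The bound comes from Cauchy--Schwarz on \<open>[p + x, p + x + h]\<close>; the resulting integral of increments
  of the monotone primitive of \<open>\<beta>\<^sup>2\<close> telescopes, so that no interchange of integrals is needed.\<close>

lemma integral_sq_increment_le:
  assumes \<beta>: "sq_integrable m n \<beta>" and p: "m \<le> p" "p + 1 + h \<le> n" and h: "0 \<le> h"
  shows "integral {0..1} (\<lambda>x. (integral {p + x..p + x + h} \<beta>)\<^sup>2) \<le> h\<^sup>2 * integral {m..n} (\<lambda>x. (\<beta> x)\<^sup>2)"
proof -
  define B where "B x = integral {m..x} (\<lambda>x. (\<beta> x)\<^sup>2)" for x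
  have \<beta>i: "\<beta> integrable_on {m..n}" "(\<lambda>x. (\<beta> x)\<^sup>2) integrable_on {m..n}"
    using \<beta> by (auto simp: sq_integrable_def)
  have Bc: "continuous_on {m..n} B"
    unfolding B_def by (rule indefinite_integral_continuous_1) (rule \<beta>i)
  have Bi: "B integrable_on {u..v}" if "m \<le> u" "v \<le> n" for u v
    using that by (intro integrable_continuous_real continuous_on_subset[OF Bc]) auto
  have Bdiff: "B v - B u = integral {u..v} (\<lambda>x. (\<beta> x)\<^sup>2)" if "m \<le> u" "u \<le> v" "v \<le> n" for u v
  proof -
    have "integral {m..u} (\<lambda>x. (\<beta> x)\<^sup>2) + integral {u..v} (\<lambda>x. (\<beta> x)\<^sup>2) = integral {m..v} (\<lambda>x. (\<beta> x)\<^sup>2)"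
      using that by (intro Henstock_Kurzweil_Integration.integral_combine integrable_on_subinterval[OF \<beta>i(2)]) auto
    then show ?thesis by (simp add: B_def)
  qed
  have B0: "0 \<le> B x" for x unfolding B_def by (cases "(\<lambda>x. (\<beta> x)\<^sup>2) integrable_on {m..x}")
      (auto intro: integral_nonneg simp: not_integrable_integral)
  have Bn: "B x \<le> B n" if "m \<le> x" "x \<le> n" for x
    using Bdiff[of x n] that integral_nonneg[OF integrable_on_subinterval[OF \<beta>i(2)], of x n]
    by (auto simp: order_trans)
  define I where "I x = integral {m..x} \<beta>" for x
  have Ic: "continuous_on {m..n} I"
    unfolding I_def by (rule indefinite_integral_continuous_1) (rule \<beta>i)
  have Idiff: "integral {p + x..p + x + h} \<beta> = I (p + x + h) - I (p + x)" if "x \<in> {0..1}" for x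
  proof -
    have "integral {m..p + x} \<beta> + integral {p + x..p + x + h} \<beta> = integral {m..p + x + h} \<beta>"
      using that p h by (intro Henstock_Kurzweil_Integration.integral_combine integrable_on_subinterval[OF \<beta>i(1)]) auto
    then show ?thesis by (simp add: I_def)
  qed
  have Ii: "(\<lambda>x. (I (p + x + h) - I (p + x))\<^sup>2) integrable_on {0..1}"
    using p h by (intro integrable_continuous_real continuous_intros continuous_on_compose2[OF Ic]) auto
  have "integral {0..1} (\<lambda>x. (integral {p + x..p + x + h} \<beta>)\<^sup>2) = integral {0..1} (\<lambda>x. (I (p + x + h) - I (p + x))\<^sup>2)"
    by (intro Henstock_Kurzweil_Integration.integral_cong) (simp add: Idiff)
  also have "\<dots> \<le> integral {0..1} (\<lambda>x. h * (B (p + h + x) - B (p + x)))"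
  proof (rule integral_le[OF Ii])
    show "(\<lambda>x. h * (B (p + h + x) - B (p + x))) integrable_on {0..1}"
      using p h by (intro integrable_continuous_real continuous_intros continuous_on_compose2[OF Bc]) auto
    fix x :: real assume x: "x \<in> {0..1}"
    have "sq_integrable (p + x) (p + x + h) \<beta>" using x p h by (intro sq_integrable_subinterval[OF \<beta>]) auto
    from sq_integral_le_integral_sq[OF this] have "(integral {p + x..p + x + h} \<beta>)\<^sup>2 \<le> h * integral {p + x..p + x + h} (\<lambda>x. (\<beta> x)\<^sup>2)"
      using h by simp
    also have "integral {p + x..p + x + h} (\<lambda>x. (\<beta> x)\<^sup>2) = B (p + h + x) - B (p + x)"
      using x p h by (subst Bdiff) (auto simp: algebra_simps)
    finally show "(I (p + x + h) - I (p + x))\<^sup>2 \<le> h * (B (p + h + x) - B (p + x))"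
      by (simp add: Idiff[OF x])
  qed
  also have "\<dots> = h * (integral {0..1} (\<lambda>x. B (p + h + x)) - integral {0..1} (\<lambda>x. B (p + x)))"
  proof -
    have "(\<lambda>x. B (p + h + x)) integrable_on {0..1}" "(\<lambda>x. B (p + x)) integrable_on {0..1}"
      using p h by (intro integrable_continuous_real continuous_intros continuous_on_compose2[OF Bc]; auto)+
    then show ?thesis by (simp add: Henstock_Kurzweil_Integration.integral_diff)
  qed
  also have "\<dots> = h * (integral {p + h..p + h + 1} B - integral {p..p + 1} B)"
    using integral_translate[of 0 1 B "p + h"] integral_translate[of 0 1 B p] by (simp add: add_ac)
  \<comment> \<open>Cutting \<open>{p..p + h + 1}\<close> once at \<open>p + h\<close> and once at
    \<open>p + 1\<close> leaves two intervals of length \<open>h\<close>, on which \<open>B\<close>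
    lies between 0 and \<open>B n\<close>.\<close>
  also have "integral {p + h..p + h + 1} B - integral {p..p + 1} B = integral {p + 1..p + h + 1} B - integral {p..p + h} B"
  proof -
    have "integral {p..p + h} B + integral {p + h..p + h + 1} B = integral {p..p + h + 1} B"
      "integral {p..p + 1} B + integral {p + 1..p + h + 1} B = integral {p..p + h + 1} B"
      using p h by (intro Henstock_Kurzweil_Integration.integral_combine Bi; simp)+
    then show ?thesis by linarith
  qed
  also have "h * (integral {p + 1..p + h + 1} B - integral {p..p + h} B) \<le> h * (h * B n)"
  proof -
    have "integral {p + 1..p + h + 1} B \<le> integral {p + 1..p + h + 1} (\<lambda>x. B n)"
      using p h by (intro integral_le Bi Bn) auto
    moreover have "0 \<le> integral {p..p + h} B" using p h by (intro integral_nonneg Bi B0) auto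
    ultimately show ?thesis using h by (intro mult_left_mono) auto
  qed
  finally show ?thesis by (simp add: B_def power2_eq_square)
qed

text \<open>Up to sign, the remainder is split through a continuous \<open>g\<close> near
  \<open>\<alpha>\<close>: the integral of \<open>\<alpha> - g\<close> over the step
  (\<open>?F1\<close>), the deviation of the integral of \<open>g\<close> from \<open>h * g\<close>
  (\<open>?F2\<close>), and \<open>h * (g - \<alpha>)\<close> (\<open>?F3\<close>). Each has squared
  norm at most \<open>h^2 * e'\<close>; for \<open>?F1\<close> this is
  \<open>integral_sq_increment_le\<close>, for \<open>?F2\<close> uniform continuity.\<close>

lemma l2_translation_derivative:
  assumes a: "locH1 a \<alpha>"
  shows "((\<lambda>r. l2_norm (\<lambda>x. a (r + x) - a (s + x) - (r - s) * \<alpha> (s + x)) / \<bar>r - s\<bar>) \<longlongrightarrow> 0) (at s)"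
proof (rule tendsto_at_zeroI)
  fix e :: real assume e: "0 < e"
  note \<alpha> = locH1_sq_integrable[OF a]
  define e' where "e' = e\<^sup>2 / 9"
  obtain g d where g: "continuous_on UNIV g"
    and app: "integral {s - 1..s + 2} (\<lambda>x. (\<alpha> x - g x)\<^sup>2) \<le> e'" and d: "0 < d"
    and uc: "\<And>u v. u \<in> {s - 1..s + 2} \<Longrightarrow> v \<in> {s - 1..s + 2} \<Longrightarrow> \<bar>u - v\<bar> < d \<Longrightarrow> (g u - g v)\<^sup>2 \<le> e'"
    using approx_on_interval[OF \<alpha>, of e' "s - 1" "s + 2"] e by (auto simp: e'_def)
  have gs: "sq_integrable m n g" for m n
    by (intro sq_integrable_continuous continuous_on_subset[OF g]) auto
  have \<beta>: "sq_integrable m n (\<lambda>x. \<alpha> x - g x)" for m n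
    by (intro sq_integrable_diff \<alpha> gs)
  have ac: "continuous_on S a" for S by (rule locH1_continuous[OF a])
  have "l2_norm (\<lambda>x. a (r + x) - a (s + x) - (r - s) * \<alpha> (s + x)) \<le> \<bar>r - s\<bar> * e"
    if r: "\<bar>r - s\<bar> < min d 1" for r
  proof (rule l2_norm_leI)
    \<comment> \<open>Starting from the smaller of \<open>r\<close> and \<open>s\<close> treats both
      signs of \<open>r - s\<close> at once; the sign disappears in the square, see
      \<open>D\<close>.\<close>
    define p where "p = min r s"
    define h where "h = \<bar>r - s\<bar>"
    have ph: "0 \<le> h" "s - 1 \<le> p" "p + 1 + h \<le> s + 2" "h < d" using r by (auto simp: p_def h_def)
    let ?F1 = "\<lambda>x. integral {p + x..p + x + h} (\<lambda>y. \<alpha> y - g y)"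
    let ?F2 = "\<lambda>x. integral {p + x..p + x + h} g - h * g (s + x)"
    let ?F3 = "\<lambda>x. h * (g (s + x) - \<alpha> (s + x))"
    have sw: "sq_integrable 0 1 (\<lambda>x. \<alpha> (s + x))" "sq_integrable 0 1 (\<lambda>x. g (s + x))"
      by (intro sq_integrable_translate \<alpha> gs)+
    define A where "A x = integral {s - 1..x} g" for x
    have Ac: "continuous_on {s - 1..s + 2} A"
      unfolding A_def using gs by (intro indefinite_integral_continuous_1) (auto simp: sq_integrable_def)
    have gint: "integral {p + x..p + x + h} g = A (p + x + h) - A (p + x)" if "x \<in> {0..1}" for x
    proof -
      have "integral {s - 1..p + x} g + integral {p + x..p + x + h} g = integral {s - 1..p + x + h} g"
        using that ph gs by (intro Henstock_Kurzweil_Integration.integral_combine) (auto simp: sq_integrable_def)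
      then show ?thesis by (simp add: A_def)
    qed
    have F2': "?F2 x = A (p + x + h) - A (p + x) - h * g (s + x)" if "x \<in> {0..1}" for x
      using gint[OF that] by simp
    have "continuous_on {0..1} (\<lambda>x. A (p + x + h) - A (p + x) - h * g (s + x))"
      using ph by (intro continuous_intros continuous_on_compose2[OF Ac] continuous_on_compose2[OF g]) auto
    then have F2: "sq_integrable 0 1 ?F2"
      by (subst sq_integrable_cong[OF F2']) (auto intro: sq_integrable_continuous)
    have inc: "a (p + x + h) - a (p + x) = ?F1 x + integral {p + x..p + x + h} g" if "x \<in> {0..1}" for x
    proof -
      have "((\<lambda>y. (\<alpha> y - g y) + g y) has_integral (?F1 x + integral {p + x..p + x + h} g)) {p + x..p + x + h}"
        using \<beta> gs by (intro has_integral_add integrable_integral) (auto simp: sq_integrable_def)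
      then have "(\<alpha> has_integral (?F1 x + integral {p + x..p + x + h} g)) {p + x..p + x + h}" by simp
      with locH1D(1)[OF a, of "p + x" "p + x + h"] ph(1) show ?thesis
        by (metis has_integral_unique le_add_same_cancel1)
    qed
    \<comment> \<open>Expressed by the continuous functions \<open>a\<close> and \<open>A\<close>,
      \<open>?F1\<close> is continuous on \<open>{0..1}\<close> and therefore square
      integrable.\<close>
    have F1': "?F1 x = a (p + x + h) - a (p + x) - (A (p + x + h) - A (p + x))" if "x \<in> {0..1}" for x
      using inc[OF that] gint[OF that] by simp
    have "continuous_on {0..1} (\<lambda>x. a (p + x + h) - a (p + x) - (A (p + x + h) - A (p + x)))"
      using ph by (intro continuous_intros continuous_on_compose2[OF Ac] continuous_on_compose2[OF ac[of UNIV]]) auto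
    then have F1: "sq_integrable 0 1 ?F1"
      by (subst sq_integrable_cong[OF F1']) (auto intro: sq_integrable_continuous)
    have F3: "sq_integrable 0 1 ?F3" by (intro sq_integrable_cmult sq_integrable_diff sw)
    have D: "(a (r + x) - a (s + x) - (r - s) * \<alpha> (s + x))\<^sup>2 = (?F1 x + ?F2 x + ?F3 x)\<^sup>2" if "x \<in> {0..1}" for x
    proof (cases "s \<le> r")
      case True
      then have "p = s" "p + h = r" by (auto simp: p_def h_def)
      then have "a (r + x) - a (s + x) - (r - s) * \<alpha> (s + x) = a (p + x + h) - a (p + x) - h * \<alpha> (s + x)"
        by (auto simp: algebra_simps)
      also have "\<dots> = ?F1 x + ?F2 x + ?F3 x" unfolding inc[OF that] by (simp add: algebra_simps)
      finally show ?thesis by simp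
    next
      case False
      then have "p = r" "p + h = s" by (auto simp: p_def h_def)
      then have "a (r + x) - a (s + x) - (r - s) * \<alpha> (s + x) = - (a (p + x + h) - a (p + x) - h * \<alpha> (s + x))"
        by (auto simp: algebra_simps)
      also have "\<dots> = - (?F1 x + ?F2 x + ?F3 x)" unfolding inc[OF that] by (simp add: algebra_simps)
      finally show ?thesis by (simp only: power2_minus)
    qed
    have "integral {0..1} (\<lambda>x. (a (r + x) - a (s + x) - (r - s) * \<alpha> (s + x))\<^sup>2)
      = integral {0..1} (\<lambda>x. (?F1 x + ?F2 x + ?F3 x)\<^sup>2)"
      by (intro Henstock_Kurzweil_Integration.integral_cong D)
    also have "\<dots> \<le> 3 * integral {0..1} (\<lambda>x. (?F1 x)\<^sup>2) + 3 * integral {0..1} (\<lambda>x. (?F2 x)\<^sup>2) + 3 * integral {0..1} (\<lambda>x. (?F3 x)\<^sup>2)"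
      by (intro integral_sq_sum3_le F1 F2 F3)
    also have "integral {0..1} (\<lambda>x. (?F1 x)\<^sup>2) \<le> h\<^sup>2 * integral {s - 1..s + 2} (\<lambda>x. (\<alpha> x - g x)\<^sup>2)"
      by (rule integral_sq_increment_le[OF \<beta> ph(2,3,1)])
    also have "integral {0..1} (\<lambda>x. (?F2 x)\<^sup>2) \<le> integral {0..1} (\<lambda>x::real. h\<^sup>2 * e')"
    proof (rule integral_le)
      show "(\<lambda>x. (?F2 x)\<^sup>2) integrable_on {0..1}" using F2 by (simp add: sq_integrable_def)
      fix x :: real assume x: "x \<in> {0..1}"
      have "?F2 x = integral {p + x..p + x + h} (\<lambda>y. g y - g (s + x))"
        using gs ph by (subst Henstock_Kurzweil_Integration.integral_diff) (auto simp: sq_integrable_def)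
      also have "(\<dots>)\<^sup>2 \<le> (p + x + h - (p + x)) * integral {p + x..p + x + h} (\<lambda>y. (g y - g (s + x))\<^sup>2)"
        using ph by (intro sq_integral_le_integral_sq sq_integrable_diff gs sq_integrable_continuous) auto
      also have "\<dots> \<le> h * integral {p + x..p + x + h} (\<lambda>y. e')"
      proof -
        have "integral {p + x..p + x + h} (\<lambda>y. (g y - g (s + x))\<^sup>2) \<le> integral {p + x..p + x + h} (\<lambda>y. e')"
        proof (rule integral_le)
          show "(\<lambda>y. (g y - g (s + x))\<^sup>2) integrable_on {p + x..p + x + h}"
            by (intro integrable_continuous_real continuous_intros continuous_on_subset[OF g]) auto
          show "(g y - g (s + x))\<^sup>2 \<le> e'" if y: "y \<in> {p + x..p + x + h}" for y
          proof -
            have "\<bar>y - (s + x)\<bar> \<le> h" using y by (auto simp: p_def h_def)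
            then show ?thesis using x y r ph by (intro uc) (auto simp: p_def)
          qed
        qed auto
        then show ?thesis using ph(1) by (simp add: mult_left_mono)
      qed
      also have "\<dots> = h\<^sup>2 * e'" using ph by (simp add: power2_eq_square)
      finally show "(?F2 x)\<^sup>2 \<le> h\<^sup>2 * e'" .
    qed auto
    also have "integral {0..1} (\<lambda>x. (?F3 x)\<^sup>2) = h\<^sup>2 * integral {0..1} (\<lambda>x. (\<alpha> (s + x) - g (s + x))\<^sup>2)"
      unfolding power_mult_distrib power2_commute[of "g _"] by simp
    also have "integral {0..1} (\<lambda>x. (\<alpha> (s + x) - g (s + x))\<^sup>2) = integral {0 + s..1 + s} (\<lambda>x. (\<alpha> x - g x)\<^sup>2)"
      by (rule integral_translate)
    also have "\<dots> \<le> integral {s - 1..s + 2} (\<lambda>x. (\<alpha> x - g x)\<^sup>2)"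
      using \<beta> by (intro integral_mono_interval) (auto simp: sq_integrable_def)
    finally have "integral {0..1} (\<lambda>x. (a (r + x) - a (s + x) - (r - s) * \<alpha> (s + x))\<^sup>2)
      \<le> 3 * (h\<^sup>2 * integral {s - 1..s + 2} (\<lambda>x. (\<alpha> x - g x)\<^sup>2)) + 3 * (h\<^sup>2 * e')
        + 3 * (h\<^sup>2 * integral {s - 1..s + 2} (\<lambda>x. (\<alpha> x - g x)\<^sup>2))"
      by (simp add: mult_left_mono)
    also have "\<dots> \<le> 3 * (h\<^sup>2 * e') + 3 * (h\<^sup>2 * e') + 3 * (h\<^sup>2 * e')"
      using app by (intro add_mono mult_left_mono) auto
    also have "\<dots> = (\<bar>r - s\<bar> * e)\<^sup>2" by (simp add: h_def e'_def power_mult_distrib)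
    finally show "integral {0..1} (\<lambda>x. (a (r + x) - a (s + x) - (r - s) * \<alpha> (s + x))\<^sup>2) \<le> (\<bar>r - s\<bar> * e)\<^sup>2" .
    show "(\<lambda>x. a (r + x) - a (s + x) - (r - s) * \<alpha> (s + x)) \<in> L2"
      by (intro L2_diff L2_cmult has_h1_deriv_L2(1)[OF locH1_window[OF a]] has_h1_deriv_L2(2)[OF locH1_window[OF a]])
  qed (use e in auto)
  then show "\<exists>d>0. \<forall>r. r \<noteq> s \<and> \<bar>r - s\<bar> < d \<longrightarrow>
      0 \<le> l2_norm (\<lambda>x. a (r + x) - a (s + x) - (r - s) * \<alpha> (s + x)) / \<bar>r - s\<bar> \<and>
      l2_norm (\<lambda>x. a (r + x) - a (s + x) - (r - s) * \<alpha> (s + x)) / \<bar>r - s\<bar> \<le> e"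
    using d by (intro exI[of _ "min d 1"]) (auto simp: divide_le_eq mult.commute)
qed

section \<open>The d'Alembert solution\<close>

lemma locH1_diff:
  "locH1 a \<alpha> \<Longrightarrow> locH1 b \<beta> \<Longrightarrow> locH1 (\<lambda>x. a x - b x) (\<lambda>x. \<alpha> x - \<beta> x)"
  using locH1_add[OF _ locH1_cmult[where c = "-1"], of a \<alpha> b \<beta>] by simp

lemma has_h1_deriv_window_minus:
  "locH1 a \<alpha> \<Longrightarrow> has_h1_deriv (\<lambda>x. a (s - x)) (\<lambda>x. - \<alpha> (s - x))"
  using locH1_window[OF locH1_reflect, of a \<alpha> "- s"] by simp

lemma sq_integrable_reflect:
  assumes "sq_integrable (- n) (- m) f"
  shows "sq_integrable m n (\<lambda>x. f (- x))"
  using assms Henstock_Kurzweil_Integration.integrable_reflect_real[of f "- m" "- n"]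
    Henstock_Kurzweil_Integration.integrable_reflect_real[of "\<lambda>x. (f x)\<^sup>2" "- m" "- n"]
  by (simp add: sq_integrable_def)

lemma L2_window:
  assumes "\<And>m n. sq_integrable m n \<alpha>"
  shows "(\<lambda>x. \<alpha> (s + x)) \<in> L2" "(\<lambda>x. \<alpha> (s - x)) \<in> L2"
proof -
  show "(\<lambda>x. \<alpha> (s + x)) \<in> L2"
    unfolding L2_iff by (intro sq_integrable_translate assms)
  have r: "sq_integrable m n (\<lambda>x. \<alpha> (- x))" for m n
    by (intro sq_integrable_reflect assms)
  have "sq_integrable 0 1 (\<lambda>x. \<alpha> (- (- s + x)))"
    using sq_integrable_translate[OF r, where s = "- s"] .
  then show "(\<lambda>x. \<alpha> (s - x)) \<in> L2" unfolding L2_iff by simp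
qed

lemma tendsto_at_uminus:
  fixes f :: "real \<Rightarrow> real"
  assumes "(f \<longlongrightarrow> l) (at (- s))"
  shows "((\<lambda>r. f (- r)) \<longlongrightarrow> l) (at s)"
  using assms filtermap_at_minus[of s] by (metis filterlim_filtermap)

lemma l2_window_continuous:
  assumes \<alpha>: "\<And>m n. sq_integrable m n \<alpha>"
  shows "((\<lambda>r. l2_norm (\<lambda>x. \<alpha> (r + x) - \<alpha> (s + x))) \<longlongrightarrow> 0) (at s)"
    and "((\<lambda>r. l2_norm (\<lambda>x. \<alpha> (r - x) - \<alpha> (s - x))) \<longlongrightarrow> 0) (at s)"
proof -
  show "((\<lambda>r. l2_norm (\<lambda>x. \<alpha> (r + x) - \<alpha> (s + x))) \<longlongrightarrow> 0) (at s)"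
    by (rule l2_translation_continuous[OF \<alpha>])
  have r: "sq_integrable m n (\<lambda>x. \<alpha> (- x))" for m n
    by (intro sq_integrable_reflect \<alpha>)
  show "((\<lambda>r. l2_norm (\<lambda>x. \<alpha> (r - x) - \<alpha> (s - x))) \<longlongrightarrow> 0) (at s)"
    using tendsto_at_uminus[OF l2_translation_continuous[OF r, of "- s"]] by simp
qed

text \<open>The backward window is the forward window of the reflected function at time
  \<open>- r\<close>; the sign of the reflected derivative and that of \<open>- r - (- s)\<close>
  cancel.\<close>

lemma l2_window_derivative:
  assumes a: "locH1 a \<alpha>"
  shows "((\<lambda>r. l2_norm (\<lambda>x. a (r + x) - a (s + x) - (r - s) * \<alpha> (s + x)) / \<bar>r - s\<bar>) \<longlongrightarrow> 0) (at s)"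
    and "((\<lambda>r. l2_norm (\<lambda>x. a (r - x) - a (s - x) - (r - s) * \<alpha> (s - x)) / \<bar>r - s\<bar>) \<longlongrightarrow> 0) (at s)"
proof -
  show "((\<lambda>r. l2_norm (\<lambda>x. a (r + x) - a (s + x) - (r - s) * \<alpha> (s + x)) / \<bar>r - s\<bar>) \<longlongrightarrow> 0) (at s)"
    by (rule l2_translation_derivative[OF a])
  have eq: "(- r - (- s)) * (- \<alpha> (s - x)) = (r - s) * \<alpha> (s - x)" "\<bar>- r - (- s)\<bar> = \<bar>r - s\<bar>" for r x
    by (auto simp: algebra_simps)
  have eq2: "- (- r + x) = r - x" for r x :: real by simp
  show "((\<lambda>r. l2_norm (\<lambda>x. a (r - x) - a (s - x) - (r - s) * \<alpha> (s - x)) / \<bar>r - s\<bar>) \<longlongrightarrow> 0) (at s)"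
    using tendsto_at_uminus[OF l2_translation_derivative[OF locH1_reflect[OF a], of "- s"]]
    unfolding eq2 eq .
qed

lemma tendsto_zero_le:
  fixes f g :: "real \<Rightarrow> real"
  assumes "(g \<longlongrightarrow> 0) F" "\<And>r. 0 \<le> f r" "\<And>r. f r \<le> g r"
  shows "(f \<longlongrightarrow> 0) F"
  by (rule Lim_null_comparison[OF _ assms(1)]) (use assms in auto)

lemma h1_window_continuous:
  assumes a: "locH1 a \<alpha>"
  shows "((\<lambda>r. h1_norm (\<lambda>x. a (r + x) - a (s + x))) \<longlongrightarrow> 0) (at s)"
    and "((\<lambda>r. h1_norm (\<lambda>x. a (r - x) - a (s - x))) \<longlongrightarrow> 0) (at s)"
proof -
  note \<alpha> = locH1_sq_integrable[OF a]
  have as: "sq_integrable m n a" for m n by (intro sq_integrable_continuous locH1_continuous[OF a])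
  show "((\<lambda>r. h1_norm (\<lambda>x. a (r + x) - a (s + x))) \<longlongrightarrow> 0) (at s)"
  proof (rule tendsto_zero_le)
    show "((\<lambda>r. l2_norm (\<lambda>x. a (r + x) - a (s + x)) + l2_norm (\<lambda>x. \<alpha> (r + x) - \<alpha> (s + x))) \<longlongrightarrow> 0) (at s)"
      using tendsto_add[OF l2_window_continuous(1)[OF as, of s] l2_window_continuous(1)[OF \<alpha>, of s]] by simp
    show "h1_norm (\<lambda>x. a (r + x) - a (s + x)) \<le> l2_norm (\<lambda>x. a (r + x) - a (s + x)) + l2_norm (\<lambda>x. \<alpha> (r + x) - \<alpha> (s + x))" for r
      by (intro h1_norm_le has_h1_deriv_diff locH1_window a)
  qed simp
  show "((\<lambda>r. h1_norm (\<lambda>x. a (r - x) - a (s - x))) \<longlongrightarrow> 0) (at s)"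
  proof (rule tendsto_zero_le)
    show "((\<lambda>r. l2_norm (\<lambda>x. a (r - x) - a (s - x)) + l2_norm (\<lambda>x. \<alpha> (r - x) - \<alpha> (s - x))) \<longlongrightarrow> 0) (at s)"
      using tendsto_add[OF l2_window_continuous(2)[OF as, of s] l2_window_continuous(2)[OF \<alpha>, of s]] by simp
    fix r
    have "h1_norm (\<lambda>x. a (r - x) - a (s - x)) \<le> l2_norm (\<lambda>x. a (r - x) - a (s - x)) + l2_norm (\<lambda>x. - \<alpha> (r - x) - - \<alpha> (s - x))"
      by (intro h1_norm_le has_h1_deriv_diff has_h1_deriv_window_minus a)
    also have "l2_norm (\<lambda>x. - \<alpha> (r - x) - - \<alpha> (s - x)) = l2_norm (\<lambda>x. \<alpha> (r - x) - \<alpha> (s - x))"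
      using l2_norm_cmult[of "-1" "\<lambda>x. \<alpha> (r - x) - \<alpha> (s - x)"] by simp
    finally show "h1_norm (\<lambda>x. a (r - x) - a (s - x)) \<le> l2_norm (\<lambda>x. a (r - x) - a (s - x)) + l2_norm (\<lambda>x. \<alpha> (r - x) - \<alpha> (s - x))" .
  qed simp
qed

text \<open>Differentiability of a translate in \<open>H1\<close> is differentiability in
  \<open>L2\<close> of the function and of its derivative, hence the chain \<open>b\<close>,
  \<open>a\<close>, \<open>\<alpha>\<close>.\<close>

lemma h1_window_derivative:
  assumes b: "locH1 b a" and a: "locH1 a \<alpha>"
  shows "((\<lambda>r. h1_norm (\<lambda>x. b (r + x) - b (s + x) - (r - s) * a (s + x)) / \<bar>r - s\<bar>) \<longlongrightarrow> 0) (at s)"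
    and "((\<lambda>r. h1_norm (\<lambda>x. b (r - x) - b (s - x) - (r - s) * a (s - x)) / \<bar>r - s\<bar>) \<longlongrightarrow> 0) (at s)"
proof -
  show "((\<lambda>r. h1_norm (\<lambda>x. b (r + x) - b (s + x) - (r - s) * a (s + x)) / \<bar>r - s\<bar>) \<longlongrightarrow> 0) (at s)"
  proof (rule tendsto_zero_le)
    show "((\<lambda>r. l2_norm (\<lambda>x. b (r + x) - b (s + x) - (r - s) * a (s + x)) / \<bar>r - s\<bar>
      + l2_norm (\<lambda>x. a (r + x) - a (s + x) - (r - s) * \<alpha> (s + x)) / \<bar>r - s\<bar>) \<longlongrightarrow> 0) (at s)"
      using tendsto_add[OF l2_window_derivative(1)[OF b, of s] l2_window_derivative(1)[OF a, of s]] by simp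
    show "h1_norm (\<lambda>x. b (r + x) - b (s + x) - (r - s) * a (s + x)) / \<bar>r - s\<bar> \<le>
      l2_norm (\<lambda>x. b (r + x) - b (s + x) - (r - s) * a (s + x)) / \<bar>r - s\<bar>
      + l2_norm (\<lambda>x. a (r + x) - a (s + x) - (r - s) * \<alpha> (s + x)) / \<bar>r - s\<bar>" for r
      unfolding add_divide_distrib[symmetric]
      by (intro divide_right_mono h1_norm_le has_h1_deriv_diff has_h1_deriv_cmult locH1_window a b) simp
  qed simp
  show "((\<lambda>r. h1_norm (\<lambda>x. b (r - x) - b (s - x) - (r - s) * a (s - x)) / \<bar>r - s\<bar>) \<longlongrightarrow> 0) (at s)"
  proof (rule tendsto_zero_le)
    show "((\<lambda>r. l2_norm (\<lambda>x. b (r - x) - b (s - x) - (r - s) * a (s - x)) / \<bar>r - s\<bar>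
      + l2_norm (\<lambda>x. a (r - x) - a (s - x) - (r - s) * \<alpha> (s - x)) / \<bar>r - s\<bar>) \<longlongrightarrow> 0) (at s)"
      using tendsto_add[OF l2_window_derivative(2)[OF b, of s] l2_window_derivative(2)[OF a, of s]] by simp
    fix r
    have "h1_norm (\<lambda>x. b (r - x) - b (s - x) - (r - s) * a (s - x)) \<le>
      l2_norm (\<lambda>x. b (r - x) - b (s - x) - (r - s) * a (s - x))
      + l2_norm (\<lambda>x. - a (r - x) - - a (s - x) - (r - s) * (- \<alpha> (s - x)))"
      by (intro h1_norm_le has_h1_deriv_diff has_h1_deriv_cmult has_h1_deriv_window_minus a b)
    also have "l2_norm (\<lambda>x. - a (r - x) - - a (s - x) - (r - s) * (- \<alpha> (s - x)))
        = l2_norm (\<lambda>x. a (r - x) - a (s - x) - (r - s) * \<alpha> (s - x))"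
      using l2_norm_cmult[of "-1" "\<lambda>x. a (r - x) - a (s - x) - (r - s) * \<alpha> (s - x)"]
      by (simp add: algebra_simps)
    finally show "h1_norm (\<lambda>x. b (r - x) - b (s - x) - (r - s) * a (s - x)) / \<bar>r - s\<bar> \<le>
      l2_norm (\<lambda>x. b (r - x) - b (s - x) - (r - s) * a (s - x)) / \<bar>r - s\<bar>
      + l2_norm (\<lambda>x. a (r - x) - a (s - x) - (r - s) * \<alpha> (s - x)) / \<bar>r - s\<bar>"
      unfolding add_divide_distrib[symmetric] by (rule divide_right_mono) simp
  qed simp
qed

section \<open>Continuation of the boundary data to all positive times\<close>

function geo_ext :: "real \<Rightarrow> (real \<Rightarrow> real) \<Rightarrow> real \<Rightarrow> real" where
  "geo_ext k f r = (if r < 2 then f r else k * geo_ext k f (r - 2))"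
  by pat_completeness auto
termination
  by (relation "Wellfounded.measure (\<lambda>(k, f, r). nat \<lfloor>r\<rfloor>)") (auto simp: floor_diff_numeral zero_less_nat_eq nat_less_eq_zless)

declare geo_ext.simps [simp del]

lemma geo_ext_less: "r < 2 \<Longrightarrow> geo_ext k f r = f r"
  by (subst geo_ext.simps) simp

lemma geo_ext_step: "0 \<le> r \<Longrightarrow> geo_ext k f (r + 2) = k * geo_ext k f r"
  by (subst geo_ext.simps) simp

text \<open>The condition \<open>f 2 = k * f 0\<close> is continuity at the joint. By induction
  \<open>geo_ext\<close> agrees below \<open>2 * n + 2\<close> with a function glued from finitely
  many pieces, and every bounded interval lies below such a number.\<close>

lemma locH1_geo_ext:
  assumes f: "locH1 f \<phi>" and f2: "f 2 = k * f 0"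
  shows "locH1 (geo_ext k f) (geo_ext k \<phi>)"
proof -
  have "\<exists>b \<beta>. locH1 b \<beta> \<and> (\<forall>r < 2 * real n + 2. b r = geo_ext k f r \<and> \<beta> r = geo_ext k \<phi> r)" for n
  proof (induction n)
    case 0
    then show ?case using f geo_ext_less by auto
  next
    case (Suc n)
    then obtain b \<beta> where b: "locH1 b \<beta>" and eq: "\<And>r. r < 2 * real n + 2 \<Longrightarrow> b r = geo_ext k f r \<and> \<beta> r = geo_ext k \<phi> r"
      by blast
    have "b 0 = f 0" using eq[of 0] by (simp add: geo_ext_less)
    then have "locH1 (\<lambda>r. if r < 2 then f r else k * b (- 2 + r)) (\<lambda>r. if r < 2 then \<phi> r else k * \<beta> (- 2 + r))"
      using f2 by (intro locH1_glue f locH1_cmult locH1_translate b) auto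
    moreover have "(if r < 2 then f r else k * b (- 2 + r)) = geo_ext k f r \<and>
        (if r < 2 then \<phi> r else k * \<beta> (- 2 + r)) = geo_ext k \<phi> r" if "r < 2 * real (Suc n) + 2" for r
      using that eq[of "- 2 + r"] geo_ext.simps[of k f r] geo_ext.simps[of k \<phi> r] by auto
    ultimately show ?case by blast
  qed
  note ex = this
  show ?thesis
    unfolding locH1_def
  proof (intro allI impI)
    fix m n :: real assume mn: "m \<le> n"
    obtain N where "n \<le> real N" using real_arch_simple by blast
    moreover obtain b \<beta> where b: "locH1 b \<beta>" "\<forall>r < 2 * real N + 2. b r = geo_ext k f r \<and> \<beta> r = geo_ext k \<phi> r"
      using ex by blast
    ultimately show "(geo_ext k \<phi> has_integral geo_ext k f n - geo_ext k f m) {m..n} \<and>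
      (\<lambda>x. (geo_ext k \<phi> x)\<^sup>2) integrable_on {m..n}"
      using mn by (intro locH1_cong_interval[OF b(1)]) auto
  qed
qed

text \<open>d'Alembert data: with \<open>a(s) = z(0,s)\<close> the wave component is \<open>z(x,s) = (a(s+x) + a(s-x))/2\<close> and
  the transport component is \<open>Y(x,s) = y(s-x)\<close>.  The initial state determines \<open>a\<close> on \<open>[-1,1]\<close> and \<open>y\<close> on
  \<open>[-1,0]\<close>; the boundary conditions then continue both to the right.\<close>

lemma dAlembert_data:
  assumes H4: "(z0, w0, Y0) \<in> H4 c2"
  obtains a \<alpha> y \<upsilon> where "locH1 a \<alpha>" "locH1 y \<upsilon>"
    "\<And>x. x \<in> {0..1} \<Longrightarrow> (a x + a (- x)) / 2 = z0 x"
    "l2_eq (\<lambda>x. (\<alpha> x + \<alpha> (- x)) / 2) w0"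
    "\<And>x. x \<in> {0..1} \<Longrightarrow> y (- x) = Y0 x"
    "\<And>s. 0 \<le> s \<Longrightarrow> a (s + 1) + a (s - 1) = - 2 * y (s - 1)"
    "\<And>s. 0 \<le> s \<Longrightarrow> y s = - c2 * a s"
    "\<And>s. 0 \<le> s \<Longrightarrow> a (s + 2) = (2 * c2 - 1) * a s"
    "\<And>s. 0 \<le> s \<Longrightarrow> \<alpha> (s + 2) = (2 * c2 - 1) * \<alpha> s"
proof -
  obtain z' where z': "has_h1_deriv z0 z'" using H4 by (auto simp: H4_def H1_def)
  obtain Y' where Y': "has_h1_deriv Y0 Y'" using H4 by (auto simp: H4_def H1_def)
  have w0: "w0 \<in> L2" and bc: "z0 1 = - Y0 1" "Y0 0 = - c2 * z0 0" using H4 by (auto simp: H4_def)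
  define W where "W x = integral {0..x} w0" for x
  have w0i: "w0 integrable_on {0..1}" using w0 by (simp add: L2_iff sq_integrable_def)
  have W': "has_h1_deriv W w0"
    unfolding has_h1_deriv_def
  proof (intro conjI ballI w0)
    fix x :: real assume "x \<in> {0..1}"
    then have "w0 integrable_on {0..x}" by (intro integrable_on_subinterval[OF w0i]) auto
    then show "(w0 has_integral W x - W 0) {0..x}" by (simp add: W_def integrable_integral)
  qed
  have W0: "W 0 = 0" by (simp add: W_def)
  define cl :: "real \<Rightarrow> real" where "cl x = max 0 (min 1 x)" for x
  define Z where "Z x = z0 (cl x)" for x
  define V where "V x = W (cl x)" for x
  define Y where "Y x = Y0 (cl x)" for x
  define Zd where "Zd x = (if x \<in> {0..1} then z' x else 0)" for x
  define Vd where "Vd x = (if x \<in> {0..1} then w0 x else 0)" for x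
  define Yd where "Yd x = (if x \<in> {0..1} then Y' x else 0)" for x
  have Z: "locH1 Z Zd" unfolding Z_def Zd_def cl_def by (rule locH1_extend[OF z'])
  have V: "locH1 V Vd" unfolding V_def Vd_def cl_def by (rule locH1_extend[OF W'])
  have Y: "locH1 Y Yd" unfolding Y_def Yd_def cl_def by (rule locH1_extend[OF Y'])
  have V0: "V 0 = 0" by (simp add: V_def W0 cl_def)
  have cl: "cl x = x" if "x \<in> {0..1}" for x using that by (simp add: cl_def)
  \<comment> \<open>d'Alembert's formula at time 0: \<open>z0 + W\<close> on \<open>[0, 1]\<close>,
    continued to \<open>[-1, 0]\<close> by the reflection of \<open>z0 - W\<close>. Half sums of the
    values then give \<open>z0\<close>, and half sums of the derivatives give
    \<open>w0\<close>.\<close>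
  define a0 where "a0 r = (if r < 0 then Z (- r) - V (- r) else Z r + V r)" for r
  define \<alpha>0 where "\<alpha>0 r = (if r < 0 then - Zd (- r) - - Vd (- r) else Zd r + Vd r)" for r
  have a0: "locH1 a0 \<alpha>0"
    unfolding a0_def \<alpha>0_def by (intro locH1_glue locH1_diff locH1_add locH1_reflect Z V) (simp add: V0)
  \<comment> \<open>Up to time 1 the transport component arriving at \<open>x = 1\<close> is still
    the initial \<open>Y0\<close>; with \<open>r = s + 1\<close> the condition there becomes
    \<open>a r = - a (r - 2) - 2 * Y0 (2 - r)\<close>. Continuity at 1 is the compatibility
    \<open>z0 1 = - Y0 1\<close>.\<close>
  define a1 where "a1 r = (if r < 1 then a0 r else - 1 * a0 (- 2 + r) - 2 * Y (- (- 2 + r)))" for r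
  define \<alpha>1 where "\<alpha>1 r = (if r < 1 then \<alpha>0 r else - 1 * \<alpha>0 (- 2 + r) - 2 * - Yd (- (- 2 + r)))" for r
  have a1: "locH1 a1 \<alpha>1"
    unfolding a1_def \<alpha>1_def
  proof (rule locH1_glue[OF a0])
    show "locH1 (\<lambda>r. - 1 * a0 (- 2 + r) - 2 * Y (- (- 2 + r))) (\<lambda>r. - 1 * \<alpha>0 (- 2 + r) - 2 * - Yd (- (- 2 + r)))"
      by (intro locH1_diff locH1_cmult locH1_translate[OF a0] locH1_translate[OF locH1_reflect[OF Y]])
    show "a0 1 = - 1 * a0 (- 2 + 1) - 2 * Y (- (- 2 + 1))"
      using bc by (simp add: a0_def Z_def Y_def cl_def)
  qed
  define \<kappa> where "\<kappa> = 2 * c2 - 1"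
  \<comment> \<open>Compatibility for the continuation: by \<open>Y0 0 = - c2 * z0 0\<close> the
    value is \<open>- z0 0 + 2 * c2 * z0 0\<close>.\<close>
  have "a1 2 = \<kappa> * a1 0"
    using bc V0 by (simp add: a1_def a0_def Z_def Y_def cl_def \<kappa>_def algebra_simps)
  with a1 have a: "locH1 (geo_ext \<kappa> a1) (geo_ext \<kappa> \<alpha>1)" by (rule locH1_geo_ext)
  define y where "y r = (if r < 0 then Y (- r) else - c2 * geo_ext \<kappa> a1 r)" for r
  define \<upsilon> where "\<upsilon> r = (if r < 0 then - Yd (- r) else - c2 * geo_ext \<kappa> \<alpha>1 r)" for r
  have y: "locH1 y \<upsilon>"
    unfolding y_def \<upsilon>_def
    using bc V0 by (intro locH1_glue locH1_reflect Y locH1_cmult a) (simp add: geo_ext_less a1_def a0_def Z_def Y_def cl_def)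
  have ae: "geo_ext \<kappa> a1 r = a0 r" "geo_ext \<kappa> \<alpha>1 r = \<alpha>0 r" if "r < 1" for r
    using that by (auto simp: geo_ext_less a1_def \<alpha>1_def)
  have a1at1: "geo_ext \<kappa> a1 1 = Z 1 + V 1"
    using bc by (simp add: geo_ext_less a1_def a0_def Z_def Y_def cl_def)
  have pa: "geo_ext \<kappa> a1 x = Z x + V x" if "x \<in> {0..1}" for x
    using that a1at1 ae(1)[of x] by (cases "x = 1") (auto simp: a0_def)
  have ma: "geo_ext \<kappa> a1 (- x) = Z x - V x" if "x \<in> {0..1}" for x
    using that ae(1)[of "- x"] V0 by (auto simp: a0_def)
  show thesis
  proof (rule that[OF a y])
    show "(geo_ext \<kappa> a1 x + geo_ext \<kappa> a1 (- x)) / 2 = z0 x" if "x \<in> {0..1}" for x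
      using pa[OF that] ma[OF that] that by (simp add: Z_def cl)
    show "y (- x) = Y0 x" if "x \<in> {0..1}" for x
      using that pa[of 0] bc V0 by (auto simp: y_def Y_def cl Z_def)
    \<comment> \<open>Only almost everywhere: the glued derivatives take arbitrary values at the
      break points 0 and 1.\<close>
    show "l2_eq (\<lambda>x. (geo_ext \<kappa> \<alpha>1 x + geo_ext \<kappa> \<alpha>1 (- x)) / 2) w0"
    proof -
      have "negligible {0, 1::real}" by simp
      then have "{0, 1::real} \<in> null_sets lebesgue" using negligible_iff_null_sets by blast
      then have off: "AE x in lebesgue. x \<notin> {0, 1::real}" by (rule AE_not_in)
      have eq: "(geo_ext \<kappa> \<alpha>1 x + geo_ext \<kappa> \<alpha>1 (- x)) / 2 = w0 x" if "x \<notin> {0, 1}" "x \<in> {0..1}" for x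
        using that ae(2)[of x] ae(2)[of "- x"] by (auto simp: \<alpha>0_def Vd_def)
      from off have "AE x in lebesgue. x \<in> {0..1} \<longrightarrow> (geo_ext \<kappa> \<alpha>1 x + geo_ext \<kappa> \<alpha>1 (- x)) / 2 = w0 x"
        by (rule eventually_mono) (use eq in blast)
      then show ?thesis unfolding l2_eq_def by (simp add: AE_restrict_space_iff)
    qed
    show "geo_ext \<kappa> a1 (s + 1) + geo_ext \<kappa> a1 (s - 1) = - 2 * y (s - 1)" if "0 \<le> s" for s
    \<comment> \<open>Before time 1 the condition is the definition of \<open>a1\<close>; afterwards
      \<open>y = - c2 * a\<close>, and it is equivalent to the recursion with factor
      \<open>\<kappa>\<close>.\<close>
    proof (cases "s < 1")
      case True
      then show ?thesis using that by (simp add: geo_ext_less a1_def y_def algebra_simps)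
    next
      case False
      then have "geo_ext \<kappa> a1 ((s - 1) + 2) = \<kappa> * geo_ext \<kappa> a1 (s - 1)"
        by (intro geo_ext_step) simp
      then show ?thesis using False by (simp add: y_def \<kappa>_def algebra_simps)
    qed
    show "y s = - c2 * geo_ext \<kappa> a1 s" if "0 \<le> s" for s using that by (simp add: y_def)
    show "geo_ext \<kappa> a1 (s + 2) = (2 * c2 - 1) * geo_ext \<kappa> a1 s" if "0 \<le> s" for s
      using geo_ext_step[OF that] by (simp add: \<kappa>_def)
    show "geo_ext \<kappa> \<alpha>1 (s + 2) = (2 * c2 - 1) * geo_ext \<kappa> \<alpha>1 s" if "0 \<le> s" for s
      using geo_ext_step[OF that] by (simp add: \<kappa>_def)
  qed
qed

section \<open>The explicit mild solution\<close>

definition dAlembert_state ::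
  "(real \<Rightarrow> real) \<Rightarrow> (real \<Rightarrow> real) \<Rightarrow> (real \<Rightarrow> real) \<Rightarrow> real \<Rightarrow> state4" where
  "dAlembert_state a \<alpha> y s =
     (\<lambda>x. (a (s + x) + a (s - x)) / 2, \<lambda>x. (\<alpha> (s + x) + \<alpha> (s - x)) / 2, \<lambda>x. y (s - x))"

lemma h1_norm_avg_le:
  assumes "has_h1_deriv f g" "has_h1_deriv f' g'"
  shows "h1_norm (\<lambda>x. (f x + f' x) / 2) \<le> 2 * (h1_norm f + h1_norm f')"
proof -
  have "h1_norm (\<lambda>x. 1 / 2 * (f x + f' x)) = 1 / 2 * h1_norm (\<lambda>x. f x + f' x)"
    using h1_norm_cmult[OF has_h1_deriv_add[OF assms], of "1 / 2"] by simp
  also have "\<dots> \<le> 1 / 2 * (4 * (h1_norm f + h1_norm f'))"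
    by (intro mult_left_mono h1_norm_add_le[OF assms]) simp
  finally show ?thesis by simp
qed

lemma l2_norm_avg_le:
  assumes "f \<in> L2" "f' \<in> L2"
  shows "l2_norm (\<lambda>x. (f x + f' x) / 2) \<le> l2_norm f + l2_norm f'"
proof -
  have "l2_norm (\<lambda>x. 1 / 2 * (f x + f' x)) = 1 / 2 * l2_norm (\<lambda>x. f x + f' x)"
    unfolding l2_norm_cmult by simp
  also have "\<dots> \<le> 1 / 2 * (2 * (l2_norm f + l2_norm f'))"
    by (intro mult_left_mono l2_norm_add_le assms) simp
  finally show ?thesis by simp
qed

lemma has_h1_deriv_avg:
  "has_h1_deriv f g \<Longrightarrow> has_h1_deriv f' g' \<Longrightarrow> has_h1_deriv (\<lambda>x. (f x + f' x) / 2) (\<lambda>x. (g x + g' x) / 2)"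
  using has_h1_deriv_cmult[OF has_h1_deriv_add, of f g f' g' "1 / 2"] by simp

text \<open>The time primitive demanded by \<open>mild_solution\<close> is again of d'Alembert form:
  with antiderivatives \<open>b\<close> of \<open>a\<close> and \<open>c\<close> of
  \<open>y\<close>, it consists of windows of \<open>b\<close>, \<open>a\<close> and
  \<open>c\<close> minus their values at time 0. What remains is calculus of windows and the
  boundary conditions for \<open>b\<close> and \<open>c\<close>.\<close>

lemma dAlembert_mild_solution:
  assumes a: "locH1 a \<alpha>" and y: "locH1 y \<upsilon>"
    and z0: "\<And>x. x \<in> {0..1} \<Longrightarrow> (a x + a (- x)) / 2 = z0 x"
    and w0: "l2_eq (\<lambda>x. (\<alpha> x + \<alpha> (- x)) / 2) w0"
    and Y0: "\<And>x. x \<in> {0..1} \<Longrightarrow> y (- x) = Y0 x"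
    and bc1: "\<And>s. 0 \<le> s \<Longrightarrow> a (s + 1) + a (s - 1) = - 2 * y (s - 1)"
    and bc0: "\<And>s. 0 \<le> s \<Longrightarrow> y s = - c2 * a s"
  shows "mild_solution c2 T (z0, w0, Y0) (dAlembert_state a \<alpha> y)"
proof -
  let ?\<Phi> = "dAlembert_state a \<alpha> y"
  note \<alpha> = locH1_sq_integrable[OF a]
  have prim: "\<exists>b. locH1 b f \<and> (\<forall>x. (b has_real_derivative f x) (at x))" if "locH1 f f'" for f f'
  proof -
    have c: "continuous_on UNIV f" by (rule locH1_continuous[OF that])
    then have "isCont f x" for x by (simp add: continuous_on_eq_continuous_at)
    then obtain b where "\<forall>x. (b has_vector_derivative f x) (at x)"
      using einterval_antiderivative[of "- \<infinity>" \<infinity> f] by auto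
    then have "\<forall>x. (b has_real_derivative f x) (at x)"
      by (simp add: has_real_derivative_iff_has_vector_derivative)
    then show ?thesis using locH1_C1[OF _ c] by blast
  qed
  obtain b where b: "locH1 b a" and b': "\<And>x. (b has_real_derivative a x) (at x)" using prim[OF a] by blast
  obtain c where c: "locH1 c y" and c': "\<And>x. (c has_real_derivative y x) (at x)" using prim[OF y] by blast
  define \<Psi> where "\<Psi> s = (\<lambda>x. ((b (s + x) - b (0 + x)) + (b (s - x) - b (0 - x))) / 2,
     \<lambda>x. ((a (s + x) - a (0 + x)) + (a (s - x) - a (0 - x))) / 2, \<lambda>x. c (s - x) - c (0 - x))" for s
  have H4: "?\<Phi> s \<in> H4 c2" if "0 \<le> s" for s
    using bc1[OF that] bc0[OF that]
      has_h1_deriv_H1[OF has_h1_deriv_avg[OF locH1_window[OF a] has_h1_deriv_window_minus[OF a]], of s s]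
      has_h1_deriv_H1[OF has_h1_deriv_window_minus[OF y], of s]
      L2_cmult[OF L2_add[OF L2_window[OF \<alpha>]], of "1 / 2" s s]
    by (simp add: dAlembert_state_def H4_def)
  have cont: "((\<lambda>r. norm_H4 (?\<Phi> r - ?\<Phi> s)) \<longlongrightarrow> 0) (at s)" for s
  proof (rule tendsto_zero_le)
    have t: "((\<lambda>r. 2 * (h1_norm (\<lambda>x. a (r + x) - a (s + x)) + h1_norm (\<lambda>x. a (r - x) - a (s - x)))
      + (l2_norm (\<lambda>x. \<alpha> (r + x) - \<alpha> (s + x)) + l2_norm (\<lambda>x. \<alpha> (r - x) - \<alpha> (s - x)))
      + h1_norm (\<lambda>x. y (r - x) - y (s - x))) \<longlongrightarrow> 2 * (0 + 0) + (0 + 0) + 0) (at s)"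
      by (intro tendsto_intros h1_window_continuous[OF a] l2_window_continuous[OF \<alpha>] h1_window_continuous[OF y])
    then show "((\<lambda>r. 2 * (h1_norm (\<lambda>x. a (r + x) - a (s + x)) + h1_norm (\<lambda>x. a (r - x) - a (s - x)))
      + (l2_norm (\<lambda>x. \<alpha> (r + x) - \<alpha> (s + x)) + l2_norm (\<lambda>x. \<alpha> (r - x) - \<alpha> (s - x)))
      + h1_norm (\<lambda>x. y (r - x) - y (s - x))) \<longlongrightarrow> 0) (at s)" by simp
    fix r
    have eq: "?\<Phi> r - ?\<Phi> s = (\<lambda>x. ((a (r + x) - a (s + x)) + (a (r - x) - a (s - x))) / 2,
       \<lambda>x. ((\<alpha> (r + x) - \<alpha> (s + x)) + (\<alpha> (r - x) - \<alpha> (s - x))) / 2, \<lambda>x. y (r - x) - y (s - x))"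
      by (auto simp: dAlembert_state_def fun_eq_iff field_simps)
    have d1: "has_h1_deriv (\<lambda>x. a (r + x) - a (s + x)) (\<lambda>x. \<alpha> (r + x) - \<alpha> (s + x))"
      by (rule has_h1_deriv_diff[OF locH1_window[OF a] locH1_window[OF a]])
    have d2: "has_h1_deriv (\<lambda>x. a (r - x) - a (s - x)) (\<lambda>x. - \<alpha> (r - x) - - \<alpha> (s - x))"
      by (rule has_h1_deriv_diff[OF has_h1_deriv_window_minus[OF a] has_h1_deriv_window_minus[OF a]])
    show "norm_H4 (?\<Phi> r - ?\<Phi> s) \<le> 2 * (h1_norm (\<lambda>x. a (r + x) - a (s + x)) + h1_norm (\<lambda>x. a (r - x) - a (s - x)))
      + (l2_norm (\<lambda>x. \<alpha> (r + x) - \<alpha> (s + x)) + l2_norm (\<lambda>x. \<alpha> (r - x) - \<alpha> (s - x)))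
      + h1_norm (\<lambda>x. y (r - x) - y (s - x))"
      unfolding eq
      by (intro order_trans[OF norm_H4_le] add_mono h1_norm_avg_le l2_norm_avg_le L2_diff L2_window \<alpha>
          order_refl) (rule d1, rule d2)
  qed simp
  have deriv: "((\<lambda>r. norm_H4 (\<Psi> r - \<Psi> s - scale4 (r - s) (?\<Phi> s)) / \<bar>r - s\<bar>) \<longlongrightarrow> 0) (at s)" for s
  proof (rule tendsto_zero_le)
    let ?g = "\<lambda>r. 2 * (h1_norm (\<lambda>x. b (r + x) - b (s + x) - (r - s) * a (s + x)) / \<bar>r - s\<bar>
        + h1_norm (\<lambda>x. b (r - x) - b (s - x) - (r - s) * a (s - x)) / \<bar>r - s\<bar>)
      + (l2_norm (\<lambda>x. a (r + x) - a (s + x) - (r - s) * \<alpha> (s + x)) / \<bar>r - s\<bar>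
        + l2_norm (\<lambda>x. a (r - x) - a (s - x) - (r - s) * \<alpha> (s - x)) / \<bar>r - s\<bar>)
      + h1_norm (\<lambda>x. c (r - x) - c (s - x) - (r - s) * y (s - x)) / \<bar>r - s\<bar>"
    have "(?g \<longlongrightarrow> 2 * (0 + 0) + (0 + 0) + 0) (at s)"
      by (intro tendsto_add tendsto_mult_left h1_window_derivative[OF b a] l2_window_derivative[OF a] h1_window_derivative[OF c y])
    then show "(?g \<longlongrightarrow> 0) (at s)" by simp
    fix r
    have eq: "\<Psi> r - \<Psi> s - scale4 (r - s) (?\<Phi> s) =
      (\<lambda>x. ((b (r + x) - b (s + x) - (r - s) * a (s + x)) + (b (r - x) - b (s - x) - (r - s) * a (s - x))) / 2,
       \<lambda>x. ((a (r + x) - a (s + x) - (r - s) * \<alpha> (s + x)) + (a (r - x) - a (s - x) - (r - s) * \<alpha> (s - x))) / 2,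
       \<lambda>x. c (r - x) - c (s - x) - (r - s) * y (s - x))"
      by (auto simp: dAlembert_state_def \<Psi>_def scale4_def fun_eq_iff field_simps)
    have as: "sq_integrable m n a" for m n by (rule locH1_sq_integrable[OF b])
    have e1: "has_h1_deriv (\<lambda>x. b (r + x) - b (s + x) - (r - s) * a (s + x)) (\<lambda>x. a (r + x) - a (s + x) - (r - s) * \<alpha> (s + x))"
      by (intro has_h1_deriv_diff has_h1_deriv_cmult locH1_window a b)
    have e2: "has_h1_deriv (\<lambda>x. b (r - x) - b (s - x) - (r - s) * a (s - x)) (\<lambda>x. - a (r - x) - - a (s - x) - (r - s) * - \<alpha> (s - x))"
      by (intro has_h1_deriv_diff has_h1_deriv_cmult has_h1_deriv_window_minus a b)
    have "norm_H4 (\<Psi> r - \<Psi> s - scale4 (r - s) (?\<Phi> s)) \<le>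
      2 * (h1_norm (\<lambda>x. b (r + x) - b (s + x) - (r - s) * a (s + x)) + h1_norm (\<lambda>x. b (r - x) - b (s - x) - (r - s) * a (s - x)))
      + (l2_norm (\<lambda>x. a (r + x) - a (s + x) - (r - s) * \<alpha> (s + x)) + l2_norm (\<lambda>x. a (r - x) - a (s - x) - (r - s) * \<alpha> (s - x)))
      + h1_norm (\<lambda>x. c (r - x) - c (s - x) - (r - s) * y (s - x))"
      unfolding eq
      by (intro order_trans[OF norm_H4_le] add_mono h1_norm_avg_le l2_norm_avg_le L2_diff L2_cmult L2_window \<alpha>
          as order_refl) (rule e1, rule e2)
    then have "norm_H4 (\<Psi> r - \<Psi> s - scale4 (r - s) (?\<Phi> s)) / \<bar>r - s\<bar> \<le>
      (2 * (h1_norm (\<lambda>x. b (r + x) - b (s + x) - (r - s) * a (s + x)) + h1_norm (\<lambda>x. b (r - x) - b (s - x) - (r - s) * a (s - x)))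
      + (l2_norm (\<lambda>x. a (r + x) - a (s + x) - (r - s) * \<alpha> (s + x)) + l2_norm (\<lambda>x. a (r - x) - a (s - x) - (r - s) * \<alpha> (s - x)))
      + h1_norm (\<lambda>x. c (r - x) - c (s - x) - (r - s) * y (s - x))) / \<bar>r - s\<bar>"
      by (rule divide_right_mono) simp
    then show "norm_H4 (\<Psi> r - \<Psi> s - scale4 (r - s) (?\<Phi> s)) / \<bar>r - s\<bar> \<le> ?g r"
      by (simp add: add_divide_distrib)
  qed simp
  \<comment> \<open>Transfers the boundary conditions from \<open>a\<close> and \<open>y\<close> to
    their primitives: both sides agree at time 0 and have equal derivatives at nonnegative
    times.\<close>
  have prim0: "f s = g s" if "0 \<le> s" "f 0 = g 0"
    "\<And>x. (f has_real_derivative h x) (at x)" "\<And>x. (g has_real_derivative k x) (at x)" "\<And>x. 0 \<le> x \<Longrightarrow> h x = k x"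
    for f g h k :: "real \<Rightarrow> real" and s
  proof -
    have "((\<lambda>x. f x - g x) has_real_derivative 0) (at x within {0..})" if "x \<in> {0..}" for x
    proof -
      have "((\<lambda>x. f x - g x) has_real_derivative h x - k x) (at x within {0..})"
        using \<open>\<And>x. (f has_real_derivative h x) (at x)\<close> \<open>\<And>x. (g has_real_derivative k x) (at x)\<close>
        by (intro DERIV_diff) (auto intro: DERIV_subset)
      then show ?thesis using \<open>\<And>x. 0 \<le> x \<Longrightarrow> h x = k x\<close>[of x] that by simp
    qed
    then have "\<exists>C. \<forall>x\<in>{0..}. f x - g x = C"
      by (intro has_field_derivative_zero_constant) auto
    then obtain C where "\<And>x. 0 \<le> x \<Longrightarrow> f x - g x = C" by auto
    from this[of s] this[of 0] show ?thesis using that(1,2) by simp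
  qed
  have shift: "((\<lambda>s. f (s + k) :: real) has_real_derivative f' (x + k)) (at x)"
    if "\<And>x. (f has_real_derivative f' x) (at x)" for f f' k x
    using that[of "x + k"] by (simp add: DERIV_shift)
  have op: "system_operator c2 (\<Psi> s) (?\<Phi> s - ?\<Phi> 0)" if s: "0 \<le> s" for s
  proof -
    have p1: "((b (s + 1) - b 1) + (b (s - 1) - b (- 1))) / 2 = - (c (s - 1) - c (- 1))"
    proof (rule prim0[where f = "\<lambda>s. ((b (s + 1) - b 1) + (b (s - 1) - b (- 1))) / 2"
          and g = "\<lambda>s. - (c (s - 1) - c (- 1))" and h = "\<lambda>s. (a (s + 1) + a (s - 1)) / 2" and k = "\<lambda>s. - y (s - 1)", OF s])
      fix x
      show "((\<lambda>s. ((b (s + 1) - b 1) + (b (s - 1) - b (- 1))) / 2) has_real_derivative (a (x + 1) + a (x - 1)) / 2) (at x)"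
        by (auto intro!: derivative_eq_intros shift[OF b', of 1, simplified] shift[OF b', of "- 1", simplified])
      show "((\<lambda>s. - (c (s - 1) - c (- 1))) has_real_derivative - y (x - 1)) (at x)"
        by (auto intro!: derivative_eq_intros shift[OF c', of "- 1", simplified])
      show "0 \<le> x \<Longrightarrow> (a (x + 1) + a (x - 1)) / 2 = - y (x - 1)" using bc1[of x] by simp
    qed simp
    have p0: "c s - c 0 = - c2 * (b s - b 0)"
    proof (rule prim0[where f = "\<lambda>s. c s - c 0" and g = "\<lambda>s. - c2 * (b s - b 0)" and h = y and k = "\<lambda>s. - c2 * a s", OF s])
      fix x
      show "((\<lambda>s. c s - c 0) has_real_derivative y x) (at x)"
        by (auto intro!: derivative_eq_intros c')
      show "((\<lambda>s. - c2 * (b s - b 0)) has_real_derivative - c2 * a x) (at x)"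
        by (auto intro!: derivative_eq_intros b')
    qed (use bc0 in auto)
    \<comment> \<open>The \<open>x\<close>-derivative of a symmetric combination is antisymmetric
      and vanishes at \<open>x = 0\<close>; this supplies \<open>f' 0 = 0\<close> in
      \<open>system_operator\<close>.\<close>
    have d1: "has_h1_deriv (\<lambda>x. ((b (s + x) - b (0 + x)) + (b (s - x) - b (0 - x))) / 2)
       (\<lambda>x. ((a (s + x) - a (0 + x)) + (- a (s - x) - - a (0 - x))) / 2)"
      by (intro has_h1_deriv_avg has_h1_deriv_diff locH1_window has_h1_deriv_window_minus b)
    \<comment> \<open>Differentiating the antisymmetric combination restores the symmetric one. The
      factors \<open>- 1\<close> put it into the form of \<open>has_h1_deriv_cmult\<close>.\<close>
    have d2: "has_h1_deriv (\<lambda>x. ((a (s + x) - a (0 + x)) + (- 1 * a (s - x) - - 1 * a (0 - x))) / 2)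
       (\<lambda>x. ((\<alpha> (s + x) - \<alpha> (0 + x)) + (- 1 * - \<alpha> (s - x) - - 1 * - \<alpha> (0 - x))) / 2)"
      by (intro has_h1_deriv_avg has_h1_deriv_diff has_h1_deriv_cmult locH1_window has_h1_deriv_window_minus a)
    have d3: "has_h1_deriv (\<lambda>x. c (s - x) - c (0 - x)) (\<lambda>x. - y (s - x) - - y (0 - x))"
      by (intro has_h1_deriv_diff has_h1_deriv_window_minus c)
    have d4: "has_h1_deriv (\<lambda>x. ((a (s + x) - a (0 + x)) + (a (s - x) - a (0 - x))) / 2)
       (\<lambda>x. ((\<alpha> (s + x) - \<alpha> (0 + x)) + (- \<alpha> (s - x) - - \<alpha> (0 - x))) / 2)"
      by (intro has_h1_deriv_avg has_h1_deriv_diff locH1_window has_h1_deriv_window_minus a)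
    have d5: "has_h1_deriv (\<lambda>x. y (s - x) - y (0 - x)) (\<lambda>x. - \<upsilon> (s - x) - - \<upsilon> (0 - x))"
      by (intro has_h1_deriv_diff has_h1_deriv_window_minus y)
    have l: "(\<lambda>x. ((\<alpha> (s + x) - \<alpha> (0 + x)) + (\<alpha> (s - x) - \<alpha> (0 - x))) / 2) \<in> L2"
      using L2_cmult[OF L2_add[OF L2_diff[OF L2_window(1)[OF \<alpha>] L2_window(1)[OF \<alpha>]] L2_diff[OF L2_window(2)[OF \<alpha>] L2_window(2)[OF \<alpha>]]],
          of "1 / 2" s 0 s 0] by simp
    have \<Psi>H4: "\<Psi> s \<in> H4 c2"
      using p1 p0 has_h1_deriv_H1[OF d1] has_h1_deriv_L2(1)[OF d4] has_h1_deriv_H1[OF d3]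
      unfolding H4_def \<Psi>_def by simp
    have eq: "?\<Phi> s - ?\<Phi> 0 = (\<lambda>x. ((a (s + x) - a (0 + x)) + (a (s - x) - a (0 - x))) / 2,
       \<lambda>x. ((\<alpha> (s + x) - \<alpha> (0 + x)) + (\<alpha> (s - x) - \<alpha> (0 - x))) / 2, \<lambda>x. y (s - x) - y (0 - x))"
      by (auto simp: dAlembert_state_def fun_eq_iff field_simps)
    have \<Phi>H4: "?\<Phi> s - ?\<Phi> 0 \<in> H4 c2"
      unfolding eq H4_def
      using has_h1_deriv_H1[OF d4] l has_h1_deriv_H1[OF d5] bc1[OF s] bc1[of 0] bc0[OF s] bc0[of 0]
      by (simp add: field_simps)
    have d2': "has_h1_deriv (\<lambda>x. ((a (s + x) - a (0 + x)) + (- a (s - x) - - a (0 - x))) / 2)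
       (\<lambda>x. ((\<alpha> (s + x) - \<alpha> (0 + x)) + (\<alpha> (s - x) - \<alpha> (0 - x))) / 2)"
      using d2 by simp
    have d3': "has_h1_deriv (\<lambda>x. c (s - x) - c (0 - x)) (\<lambda>x. - (y (s - x) - y (0 - x)))"
      using d3 by simp
    have refl: "l2_eq k k" for k by (simp add: l2_eq_def)
    have "\<exists>f'. has_h1_deriv (\<lambda>x. ((b (s + x) - b (0 + x)) + (b (s - x) - b (0 - x))) / 2) f' \<and> f' 0 = 0 \<and>
       has_h1_deriv f' (\<lambda>x. ((\<alpha> (s + x) - \<alpha> (0 + x)) + (\<alpha> (s - x) - \<alpha> (0 - x))) / 2)"
      by (intro exI conjI, rule d1, simp, rule d2')
    with \<Psi>H4 \<Phi>H4 refl d3' show ?thesis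
      unfolding system_operator_def eq \<Psi>_def by (simp only: split_conv)
  qed
  show ?thesis
    unfolding mild_solution_def continuous_into_def
  proof (intro conjI exI[of _ \<Psi>] ballI)
    show "eq_H4 (?\<Phi> 0) (z0, w0, Y0)"
      using z0 w0 Y0 by (simp add: eq_H4_def dAlembert_state_def h1_eq_def)
    show "\<Psi> 0 = (\<lambda>x. 0, \<lambda>x. 0, \<lambda>x. 0)" by (simp add: \<Psi>_def)
    fix s assume "s \<in> {0..T}"
    then show "?\<Phi> s \<in> H4 c2" "system_operator c2 (\<Psi> s) (?\<Phi> s - ?\<Phi> 0)" using H4 op by auto
    show "((\<lambda>r. norm_H4 (?\<Phi> r - ?\<Phi> s)) \<longlongrightarrow> 0) (at s within {0..T})"
      "((\<lambda>r. norm_H4 (\<Psi> r - \<Psi> s - scale4 (r - s) (?\<Phi> s)) / \<bar>r - s\<bar>) \<longlongrightarrow> 0) (at s within {0..T})"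
      by (rule tendsto_within_subset[of _ _ _ UNIV], rule cont deriv, simp)+
  qed
qed

section \<open>Exponential decay of the explicit solution\<close>

lemma geometric_decay:
  fixes N :: "real \<Rightarrow> real"
  assumes "\<And>s. s \<in> {0..3} \<Longrightarrow> N s \<le> K" "0 \<le> K" "k \<le> exp (- 2 * \<mu>)" "0 \<le> \<mu>" "0 \<le> k"
    "\<And>s. 1 \<le> s \<Longrightarrow> N (s + 2) \<le> k * N s" "\<And>s. 0 \<le> N s" "0 \<le> s"
  shows "N s \<le> K * exp (3 * \<mu>) * exp (- \<mu> * s)"
proof -
  \<comment> \<open>The base interval reaches to 3: the recursion is available from
    \<open>s = 1\<close> on, where a backward window \<open>s - x\<close> has left the negative
    times, and one round trip of length 2 is added. This is also the origin of
    \<open>exp (3 * \<mu>)\<close>.\<close>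
  have "\<forall>s. 0 \<le> s \<and> s \<le> 2 * real n + 3 \<longrightarrow> N s \<le> K * exp (3 * \<mu>) * exp (- \<mu> * s)" for n
  proof (induction n)
    case 0
    show ?case
    proof (intro allI impI)
      fix s :: real assume s: "0 \<le> s \<and> s \<le> 2 * real 0 + 3"
      have "\<mu> * s \<le> \<mu> * 3" using s assms(4) by (intro mult_left_mono) auto
      then have "1 \<le> exp (3 * \<mu>) * exp (- \<mu> * s)" by (simp add: exp_add[symmetric])
      then have "K * 1 \<le> K * (exp (3 * \<mu>) * exp (- \<mu> * s))" using assms(2) by (rule mult_left_mono)
      moreover have "N s \<le> K" using s assms(1) by simp
      ultimately show "N s \<le> K * exp (3 * \<mu>) * exp (- \<mu> * s)" by (simp add: mult.assoc)
    qed
  next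
    case (Suc n)
    show ?case
    proof (intro allI impI)
      fix s :: real assume s: "0 \<le> s \<and> s \<le> 2 * real (Suc n) + 3"
      show "N s \<le> K * exp (3 * \<mu>) * exp (- \<mu> * s)"
      proof (cases "s \<le> 3")
        case True
        then show ?thesis using Suc s by auto
      next
        case False
        have "N ((s - 2) + 2) \<le> k * N (s - 2)" using False by (intro assms(6)) simp
        also have "\<dots> \<le> exp (- 2 * \<mu>) * N (s - 2)" using assms(3,7) by (intro mult_right_mono) auto
        also have "\<dots> \<le> exp (- 2 * \<mu>) * (K * exp (3 * \<mu>) * exp (- \<mu> * (s - 2)))"
          using False s Suc by (intro mult_left_mono) auto
        also have "\<dots> = K * exp (3 * \<mu>) * (exp (- 2 * \<mu>) * exp (- \<mu> * (s - 2)))" by simp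
        also have "exp (- 2 * \<mu>) * exp (- \<mu> * (s - 2)) = exp (- \<mu> * s)"
          by (simp add: exp_add[symmetric] algebra_simps)
        finally show ?thesis by simp
      qed
    qed
  qed
  moreover obtain n where "s \<le> real n" using real_arch_simple by blast
  ultimately show ?thesis using assms(8) by (smt (verit) of_nat_0_le_iff)
qed

lemma l2_window_bounded:
  assumes "\<And>m n. sq_integrable m n \<beta>"
  obtains K where "0 \<le> K" "\<And>s. s \<in> {0..3} \<Longrightarrow> l2_norm (\<lambda>x. \<beta> (s + x)) \<le> K"
    "\<And>s. s \<in> {0..3} \<Longrightarrow> l2_norm (\<lambda>x. \<beta> (s - x)) \<le> K"
proof -
  define J where "J = integral {- 1..4} (\<lambda>x. (\<beta> x)\<^sup>2)"
  have i: "(\<lambda>x. (\<beta> x)\<^sup>2) integrable_on {m..n}" for m n using assms by (simp add: sq_integrable_def)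
  have J: "0 \<le> J" unfolding J_def by (intro integral_nonneg i) simp
  have "l2_norm (\<lambda>x. \<beta> (s + x)) \<le> sqrt J" if "s \<in> {0..3}" for s
  proof (rule l2_norm_leI)
    have "integral {0..1} (\<lambda>x. (\<beta> (s + x))\<^sup>2) = integral {0 + s..1 + s} (\<lambda>x. (\<beta> x)\<^sup>2)"
      by (rule integral_translate)
    also have "\<dots> \<le> J" unfolding J_def using that by (intro integral_mono_interval i) auto
    finally show "integral {0..1} (\<lambda>x. (\<beta> (s + x))\<^sup>2) \<le> (sqrt J)\<^sup>2" using J by simp
  qed (use J L2_window[OF assms] in auto)
  moreover have "l2_norm (\<lambda>x. \<beta> (s - x)) \<le> sqrt J" if "s \<in> {0..3}" for s
  proof (rule l2_norm_leI)
    have "integral {0..1} (\<lambda>x. (\<beta> (s - x))\<^sup>2) = integral {- 1..0} (\<lambda>x. (\<beta> (s + x))\<^sup>2)"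
      using Henstock_Kurzweil_Integration.integral_reflect_real[of 0 "- 1" "\<lambda>x. (\<beta> (s + x))\<^sup>2"] by simp
    also have "\<dots> = integral {- 1 + s..0 + s} (\<lambda>x. (\<beta> x)\<^sup>2)"
      by (rule integral_translate)
    also have "\<dots> \<le> J" unfolding J_def using that by (intro integral_mono_interval i) auto
    finally show "integral {0..1} (\<lambda>x. (\<beta> (s - x))\<^sup>2) \<le> (sqrt J)\<^sup>2" using J by simp
  qed (use J L2_window[OF assms] in auto)
  ultimately show ?thesis using that[of "sqrt J"] J by simp
qed

text \<open>Window norms of \<open>a\<close> and of its derivative inherit a factor of modulus
  \<open>\<bar>\<kappa>\<bar>\<close> per two units of time. The pointwise bound concerns
  \<open>a s = z(0,s)\<close>, the perturbation in the input of the adaptive observer; it follows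
  from the Sobolev bound.\<close>

lemma dAlembert_decay:
  assumes a: "locH1 a \<alpha>" and \<mu>: "\<bar>\<kappa>\<bar> \<le> exp (- 2 * \<mu>)" "0 \<le> \<mu>"
    and ra: "\<And>s. 0 \<le> s \<Longrightarrow> a (s + 2) = \<kappa> * a s"
    and r\<alpha>: "\<And>s. 0 \<le> s \<Longrightarrow> \<alpha> (s + 2) = \<kappa> * \<alpha> s"
  obtains M where "0 \<le> M" "\<And>s. 0 \<le> s \<Longrightarrow> \<bar>a s\<bar> \<le> M * exp (- \<mu> * s)"
    "\<And>s. 0 \<le> s \<Longrightarrow> h1_norm (\<lambda>x. (a (s + x) + a (s - x)) / 2) \<le> M * exp (- \<mu> * s)"
    "\<And>s. 0 \<le> s \<Longrightarrow> l2_norm (\<lambda>x. (\<alpha> (s + x) + \<alpha> (s - x)) / 2) \<le> M * exp (- \<mu> * s)"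
proof -
  note \<alpha> = locH1_sq_integrable[OF a]
  have as: "sq_integrable m n a" for m n by (intro sq_integrable_continuous locH1_continuous[OF a])
  have win: "\<exists>K\<ge>0. \<forall>s\<ge>0. l2_norm (\<lambda>x. \<beta> (s + x)) \<le> K * exp (- \<mu> * s) \<and> l2_norm (\<lambda>x. \<beta> (s - x)) \<le> K * exp (- \<mu> * s)"
    if \<beta>: "\<And>m n. sq_integrable m n \<beta>" and r: "\<And>s. 0 \<le> s \<Longrightarrow> \<beta> (s + 2) = \<kappa> * \<beta> s" for \<beta>
  proof -
    obtain K where K: "0 \<le> K" "\<And>s. s \<in> {0..3} \<Longrightarrow> l2_norm (\<lambda>x. \<beta> (s + x)) \<le> K"
      "\<And>s. s \<in> {0..3} \<Longrightarrow> l2_norm (\<lambda>x. \<beta> (s - x)) \<le> K"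
      using l2_window_bounded[OF \<beta>] by blast
    have p: "l2_norm (\<lambda>x. \<beta> (s + x)) \<le> K * exp (3 * \<mu>) * exp (- \<mu> * s)" if "0 \<le> s" for s
    proof (rule geometric_decay[where N = "\<lambda>s. l2_norm (\<lambda>x. \<beta> (s + x))", OF K(2) K(1) \<mu>])
      fix s :: real assume "1 \<le> s"
      then have "l2_norm (\<lambda>x. \<beta> (s + 2 + x)) = l2_norm (\<lambda>x. \<kappa> * \<beta> (s + x))"
        using r by (intro l2_norm_cong) (auto simp: r[symmetric] algebra_simps)
      then show "l2_norm (\<lambda>x. \<beta> (s + 2 + x)) \<le> \<bar>\<kappa>\<bar> * l2_norm (\<lambda>x. \<beta> (s + x))"
        by (simp add: l2_norm_cmult)
    qed (use that in auto)
    have m: "l2_norm (\<lambda>x. \<beta> (s - x)) \<le> K * exp (3 * \<mu>) * exp (- \<mu> * s)" if "0 \<le> s" for s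
    proof (rule geometric_decay[where N = "\<lambda>s. l2_norm (\<lambda>x. \<beta> (s - x))", OF K(3) K(1) \<mu>])
      fix s :: real assume "1 \<le> s"
      then have "l2_norm (\<lambda>x. \<beta> (s + 2 - x)) = l2_norm (\<lambda>x. \<kappa> * \<beta> (s - x))"
        using r by (intro l2_norm_cong) (auto simp: r[symmetric] algebra_simps)
      then show "l2_norm (\<lambda>x. \<beta> (s + 2 - x)) \<le> \<bar>\<kappa>\<bar> * l2_norm (\<lambda>x. \<beta> (s - x))"
        by (simp add: l2_norm_cmult)
    qed (use that in auto)
    show ?thesis using p m K(1) by (intro exI[of _ "K * exp (3 * \<mu>)"]) auto
  qed
  obtain K1 where K1: "K1 \<ge> 0" "\<And>s. s \<ge> 0 \<Longrightarrow> l2_norm (\<lambda>x. a (s + x)) \<le> K1 * exp (- \<mu> * s)"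
      "\<And>s. s \<ge> 0 \<Longrightarrow> l2_norm (\<lambda>x. a (s - x)) \<le> K1 * exp (- \<mu> * s)"
    using win[OF as ra] by blast
  obtain K2 where K2: "K2 \<ge> 0" "\<And>s. s \<ge> 0 \<Longrightarrow> l2_norm (\<lambda>x. \<alpha> (s + x)) \<le> K2 * exp (- \<mu> * s)"
      "\<And>s. s \<ge> 0 \<Longrightarrow> l2_norm (\<lambda>x. \<alpha> (s - x)) \<le> K2 * exp (- \<mu> * s)"
    using win[OF \<alpha> r\<alpha>] by blast
  have hp: "h1_norm (\<lambda>x. a (s + x)) \<le> (K1 + K2) * exp (- \<mu> * s)" if "0 \<le> s" for s
    using h1_norm_le[OF locH1_window[OF a], of s] K1(2)[OF that] K2(2)[OF that] by (simp add: distrib_right)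
  have hm: "h1_norm (\<lambda>x. a (s - x)) \<le> (K1 + K2) * exp (- \<mu> * s)" if "0 \<le> s" for s
    using h1_norm_le[OF has_h1_deriv_window_minus[OF a], of s] K1(3)[OF that] K2(3)[OF that]
      l2_norm_cmult[of "-1" "\<lambda>x. \<alpha> (s - x)"] by (simp add: distrib_right)
  show ?thesis
  proof (rule that[of "4 * (K1 + K2)"])
    show "0 \<le> 4 * (K1 + K2)" using K1(1) K2(1) by simp
    fix s :: real assume s: "0 \<le> s"
    have pos: "0 \<le> (K1 + K2) * exp (- \<mu> * s)" using K1(1) K2(1) by simp
    have "\<bar>a s\<bar> \<le> 2 * h1_norm (\<lambda>x. a (s + x))"
      using sup_le_h1_norm[OF locH1_window[OF a], of 0 s] by simp
    then show "\<bar>a s\<bar> \<le> 4 * (K1 + K2) * exp (- \<mu> * s)" using hp[OF s] pos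
      unfolding mult.assoc by linarith
    have "h1_norm (\<lambda>x. (a (s + x) + a (s - x)) / 2) \<le> 2 * (h1_norm (\<lambda>x. a (s + x)) + h1_norm (\<lambda>x. a (s - x)))"
      by (rule h1_norm_avg_le[OF locH1_window[OF a] has_h1_deriv_window_minus[OF a]])
    also have "\<dots> \<le> 2 * ((K1 + K2) * exp (- \<mu> * s) + (K1 + K2) * exp (- \<mu> * s))"
      by (intro mult_left_mono add_mono hp hm s) simp
    finally show "h1_norm (\<lambda>x. (a (s + x) + a (s - x)) / 2) \<le> 4 * (K1 + K2) * exp (- \<mu> * s)"
      by (simp add: algebra_simps)
    have "l2_norm (\<lambda>x. (\<alpha> (s + x) + \<alpha> (s - x)) / 2) \<le> K2 * exp (- \<mu> * s) + K2 * exp (- \<mu> * s)"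
      using l2_norm_avg_le[OF L2_window[OF \<alpha>], of s s] K2(2)[OF s] K2(3)[OF s] by simp
    also have "\<dots> = 2 * K2 * exp (- \<mu> * s)" by simp
    also have "\<dots> \<le> 4 * (K1 + K2) * exp (- \<mu> * s)" using K1(1) K2(1) by (intro mult_right_mono) auto
    finally show "l2_norm (\<lambda>x. (\<alpha> (s + x) + \<alpha> (s - x)) / 2) \<le> 4 * (K1 + K2) * exp (- \<mu> * s)" .
  qed
qed

section \<open>Uniqueness of mild solutions\<close>

text \<open>Here \<open>u\<close> satisfies \<open>u_s = - c * u_x\<close>, with time difference
  quotients controlled uniformly in \<open>x\<close>. Along a line of slope \<open>c\<close> the
  increment splits into a time increment at the moved point and a space increment at time
  \<open>s\<close>. Uniformity handles the first, and continuity of \<open>v s\<close> makes the two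
  limits cancel.\<close>

lemma transport_characteristics:
  fixes u v :: "real \<Rightarrow> real \<Rightarrow> real"
  assumes v: "\<And>s. s \<in> {0..T} \<Longrightarrow> continuous_on {0..1} (v s)"
    and ux: "\<And>s x. s \<in> {0..T} \<Longrightarrow> x \<in> {0..1} \<Longrightarrow> (u s has_real_derivative v s x) (at x within {0..1})"
    and us: "\<And>s. s \<in> {0..T} \<Longrightarrow> (B s \<longlongrightarrow> 0) (at s within {0..T})"
    and uB: "\<And>s r x. s \<in> {0..T} \<Longrightarrow> r \<in> {0..T} \<Longrightarrow> r \<noteq> s \<Longrightarrow> x \<in> {0..1} \<Longrightarrow>
      \<bar>u r x - u s x - (r - s) * (- c * v s x)\<bar> \<le> B s r * \<bar>r - s\<bar>"
    and p: "0 \<le> p" "p \<le> q" "q \<le> T" and c: "\<bar>c\<bar> = 1"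
    and I: "\<And>s. s \<in> {p..q} \<Longrightarrow> x0 + c * s \<in> {0..1}"
  shows "u q (x0 + c * q) = u p (x0 + c * p)"
proof -
  define \<phi> where "\<phi> s = u s (x0 + c * s)" for s
  have c0: "c \<noteq> 0" using c by auto
  have "(\<phi> has_real_derivative 0) (at s within {p..q})" if s: "s \<in> {p..q}" for s
  proof -
    have sT: "s \<in> {0..T}" using s p by auto
    define x where "x = x0 + c * s"
    have x: "x \<in> {0..1}" using I[OF s] by (simp add: x_def)
    have lx: "((\<lambda>y. (u s y - u s x) / (y - x)) \<longlongrightarrow> v s x) (at x within {0..1})"
      using ux[OF sT x] by (simp add: has_field_derivative_iff)
    have lv: "(v s \<longlongrightarrow> v s x) (at x within {0..1})"
      using v[OF sT] x by (simp add: continuous_on_def)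
    have tr: "filterlim (\<lambda>r. x0 + c * r) (at x within {0..1}) (at s within {p..q})"
      unfolding filterlim_at
    proof (intro conjI)
      show "\<forall>\<^sub>F r in at s within {p..q}. x0 + c * r \<in> {0..1} \<and> x0 + c * r \<noteq> x"
        using I c0 by (auto simp: eventually_at_filter x_def)
      show "((\<lambda>r. x0 + c * r) \<longlongrightarrow> x) (at s within {p..q})"
        unfolding x_def by (intro tendsto_intros)
    qed
    have l1: "((\<lambda>r. c * ((u s (x0 + c * r) - u s x) / (x0 + c * r - x)) - c * v s (x0 + c * r)) \<longlongrightarrow> c * v s x - c * v s x) (at s within {p..q})"
      by (intro tendsto_intros filterlim_compose[OF lx tr] filterlim_compose[OF lv tr])
    have l2: "(B s \<longlongrightarrow> 0) (at s within {p..q})"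
      using us[OF sT] by (rule tendsto_within_subset) (use p in auto)
    have "((\<lambda>r. (\<phi> r - \<phi> s) / (r - s)) \<longlongrightarrow> 0) (at s within {p..q})"
    proof (rule Lim_null_comparison)
      show "((\<lambda>r. \<bar>c * ((u s (x0 + c * r) - u s x) / (x0 + c * r - x)) - c * v s (x0 + c * r)\<bar> + B s r) \<longlongrightarrow> 0) (at s within {p..q})"
        using tendsto_add[OF tendsto_rabs[OF l1] l2] by simp
      have "norm ((\<phi> r - \<phi> s) / (r - s)) \<le> \<bar>c * ((u s (x0 + c * r) - u s x) / (x0 + c * r - x)) - c * v s (x0 + c * r)\<bar> + B s r"
        if r: "r \<in> {p..q}" "r \<noteq> s" for r
      proof -
        let ?y = "x0 + c * r"
        have y: "?y \<in> {0..1}" by (rule I[OF r(1)])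
        have rT: "r \<in> {0..T}" using r p by auto
        have yx: "?y - x = c * (r - s)" by (simp add: x_def algebra_simps)
        have e: "c * ((u s ?y - u s x) / (?y - x)) = (u s ?y - u s x) / (r - s)"
          unfolding yx using r(2) c by (auto simp: field_simps)
        have "\<phi> r - \<phi> s = (u r ?y - u s ?y - (r - s) * (- c * v s ?y)) + ((u s ?y - u s x) - (r - s) * (c * v s ?y))"
          by (simp add: \<phi>_def x_def)
        then have "(\<phi> r - \<phi> s) / (r - s) = (u r ?y - u s ?y - (r - s) * (- c * v s ?y)) / (r - s) + ((u s ?y - u s x) / (r - s) - c * v s ?y)"
          using r(2) by (simp add: add_divide_distrib diff_divide_distrib)
        moreover have "\<bar>(u r ?y - u s ?y - (r - s) * (- c * v s ?y)) / (r - s)\<bar> \<le> B s r"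
          using uB[OF sT rT r(2) y] r(2) by (simp add: divide_le_eq)
        ultimately show ?thesis unfolding e real_norm_def by linarith
      qed
      then show "\<forall>\<^sub>F r in at s within {p..q}. norm ((\<phi> r - \<phi> s) / (r - s)) \<le>
          \<bar>c * ((u s (x0 + c * r) - u s x) / (x0 + c * r - x)) - c * v s (x0 + c * r)\<bar> + B s r"
        by (auto simp: eventually_at_filter)
    qed
    then show ?thesis by (simp add: has_field_derivative_iff)
  qed
  then obtain C where "\<And>s. s \<in> {p..q} \<Longrightarrow> \<phi> s = C"
    using has_field_derivative_zero_constant[of "{p..q}" \<phi>] by auto
  then show ?thesis using p unfolding \<phi>_def by (metis atLeastAtMost_iff order_refl)
qed

lemma has_real_derivative_transform:
  fixes f g :: "real \<Rightarrow> real"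
  assumes "x \<in> S" "\<And>x. x \<in> S \<Longrightarrow> g x = f x" "(f has_real_derivative f') (at x within S)"
  shows "(g has_real_derivative f') (at x within S)"
  using has_vector_derivative_transform[OF assms(1,2)] assms(3)
  by (simp add: has_real_derivative_iff_has_vector_derivative)

lemma H1_obtain: assumes "f \<in> H1" obtains g where "has_h1_deriv f g"
  using assms by (auto simp: H1_def)

lemma abs_integral_le_l2_norm:
  assumes "g \<in> L2" "x \<in> {0..1}"
  shows "\<bar>integral {0..x} g\<bar> \<le> l2_norm g"
proof (rule power2_le_imp_le)
  have g: "sq_integrable 0 1 g" using assms by (simp add: L2_iff)
  then have gx: "sq_integrable 0 x g" using assms by (auto intro: sq_integrable_subinterval)
  have "(integral {0..x} g)\<^sup>2 \<le> (x - 0) * integral {0..x} (\<lambda>x. (g x)\<^sup>2)"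
    using assms by (intro sq_integral_le_integral_sq gx) auto
  also have "\<dots> \<le> 1 * integral {0..1} (\<lambda>x. (g x)\<^sup>2)"
    using assms gx g by (intro mult_mono integral_mono_interval integral_nonneg) (auto simp: sq_integrable_def)
  finally show "\<bar>integral {0..x} g\<bar>\<^sup>2 \<le> (l2_norm g)\<^sup>2" using assms by (simp add: l2_norm_sq)
qed simp

text \<open>\<open>f + \<integral>g\<close>, \<open>f - \<integral>g\<close> and \<open>h\<close> are constant along
  their characteristics, so they are determined by boundary values at times at least one unit earlier.\<close>

lemma classical_solution_zero:
  assumes d: "\<And>s. s \<in> {0..T} \<Longrightarrow>
      ((\<lambda>r. norm_H4 (\<Psi> r - \<Psi> s - scale4 (r - s) (\<Phi> s)) / \<bar>r - s\<bar>) \<longlongrightarrow> 0) (at s within {0..T})"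
    and op: "\<And>s. s \<in> {0..T} \<Longrightarrow> system_operator c2 (\<Psi> s) (\<Phi> s)"
    and \<Psi>0: "\<Psi> 0 = (\<lambda>x. 0, \<lambda>x. 0, \<lambda>x. 0)" and s: "s \<in> {0..T}"
  shows "eq_H4 (\<Phi> s) (\<lambda>x. 0, \<lambda>x. 0, \<lambda>x. 0)"
proof -
  define f g h where "f s = fst (\<Psi> s)" and "g s = fst (snd (\<Psi> s))" and "h s = snd (snd (\<Psi> s))" for s
  define F G H where "F s = fst (\<Phi> s)" and "G s = fst (snd (\<Phi> s))" and "H s = snd (snd (\<Phi> s))" for s
  have \<Psi>: "\<Psi> s = (f s, g s, h s)" for s by (simp add: f_def g_def h_def)
  have \<Phi>: "\<Phi> s = (F s, G s, H s)" for s by (simp add: F_def G_def H_def)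
  have op': "(f s, g s, h s) \<in> H4 c2" "(F s, G s, H s) \<in> H4 c2" "l2_eq (F s) (g s)"
    "\<exists>f'. has_h1_deriv (f s) f' \<and> f' 0 = 0 \<and> has_h1_deriv f' (G s)" "has_h1_deriv (h s) (\<lambda>x. - H s x)"
    if "s \<in> {0..T}" for s
    using op[OF that] unfolding system_operator_def \<Psi> \<Phi> by auto
  obtain f' where f': "\<And>s. s \<in> {0..T} \<Longrightarrow> has_h1_deriv (f s) (f' s) \<and> f' s 0 = 0 \<and> has_h1_deriv (f' s) (G s)"
    using op'(4) by metis
  have memb: "f s \<in> H1" "g s \<in> L2" "h s \<in> H1" "f s 1 = - h s 1" "h s 0 = - c2 * f s 0"
    "F s \<in> H1" "G s \<in> L2" "H s \<in> H1" if "s \<in> {0..T}" for s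
    using op'(1,2)[OF that] by (auto simp: H4_def)
  have Fc: "continuous_on {0..1} (F s)" and Hc: "continuous_on {0..1} (H s)" if "s \<in> {0..T}" for s
    using memb(6,8)[OF that] has_h1_deriv_continuous by (auto elim!: H1_obtain)
  have f'c: "continuous_on {0..1} (f' s)" if "s \<in> {0..T}" for s
    using f'[OF that] has_h1_deriv_continuous by blast
  \<comment> \<open>The primitive replaces \<open>g\<close>, known only up to null sets, by a
    differentiable function: its \<open>x\<close>-derivative is \<open>F\<close>, because
    \<open>g = F\<close> almost everywhere, and its time derivative is \<open>f'\<close>.\<close>
  define J where "J s x = integral {0..x} (g s)" for s x
  have gi: "g s integrable_on {0..x}" if "s \<in> {0..T}" "x \<in> {0..1}" for s x
    using memb(2)[OF that(1)] that(2) by (auto simp: L2_iff sq_integrable_def intro: integrable_on_subinterval)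
  have JF: "J s x = integral {0..x} (F s)" if "s \<in> {0..T}" "x \<in> {0..1}" for s x
  proof -
    have "F s \<in> L2" using L2_continuous[OF Fc[OF that(1)]] .
    have "AE x in lebesgue. x \<in> {0..1} \<longrightarrow> F s x = g s x"
      using op'(3)[OF that(1)] by (simp add: l2_eq_def AE_restrict_space_iff)
    then have neg: "negligible {y. \<not> (y \<in> {0..1} \<longrightarrow> F s y = g s y)}"
      by (simp add: completion.AE_iff_null_sets negligible_iff_null_sets)
    show ?thesis unfolding J_def
      by (rule integral_spike[OF neg]) (use that in auto)
  qed
  have dx: "(K has_real_derivative k x) (at x within {0..1})"
    if "has_h1_deriv K k" "continuous_on {0..1} k" "x \<in> {0..1}" for K k :: "real \<Rightarrow> real" and x
  proof -
    have "((\<lambda>u. K 0 + integral {0..u} k) has_real_derivative 0 + k x) (at x within {0..1})"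
      using integral_has_vector_derivative[OF that(2,3)]
      by (intro DERIV_add) (auto simp: has_real_derivative_iff_has_vector_derivative)
    then have "((\<lambda>u. K 0 + integral {0..u} k) has_real_derivative k x) (at x within {0..1})" by simp
    then show ?thesis
    proof (rule has_real_derivative_transform[OF that(3), rotated])
      fix y assume "y \<in> {0..1::real}"
      then show "K y = K 0 + integral {0..y} k"
        using that(1) integral_unique[of k "K y - K 0" "{0..y}"] by (auto simp: has_h1_deriv_def)
    qed
  qed
  have Jx: "(J s has_real_derivative F s x) (at x within {0..1})" if "s \<in> {0..T}" "x \<in> {0..1}" for s x
  proof -
    have "((\<lambda>u. integral {0..u} (F s)) has_real_derivative F s x) (at x within {0..1})"
      using integral_has_vector_derivative[OF Fc that(2)] that
      by (auto simp: has_real_derivative_iff_has_vector_derivative)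
    then show ?thesis by (rule has_real_derivative_transform[OF that(2), rotated]) (use JF that in auto)
  qed
  define Q where "Q s r = norm_H4 (\<Psi> r - \<Psi> s - scale4 (r - s) (\<Phi> s)) / \<bar>r - s\<bar>" for s r
  have Ql: "((\<lambda>r. 3 * Q s r) \<longlongrightarrow> 0) (at s within {0..T})" if "s \<in> {0..T}" for s
    using tendsto_mult_left[OF d[OF that], of 3] by (simp add: Q_def)
  \<comment> \<open>Norm convergence becomes uniform in \<open>x\<close>: by the Sobolev bound for
    \<open>f\<close> and \<open>h\<close>, by Cauchy--Schwarz for \<open>J\<close>. The Neumann
    condition \<open>f' s 0 = 0\<close> enters through the integral of \<open>G s\<close>, which is
    exactly \<open>f' s x\<close>.\<close>
  have bounds: "\<bar>f r x - f s x - (r - s) * F s x\<bar> \<le> 2 * Q s r * \<bar>r - s\<bar> \<and>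
      \<bar>h r x - h s x - (r - s) * H s x\<bar> \<le> 2 * Q s r * \<bar>r - s\<bar> \<and>
      \<bar>J r x - J s x - (r - s) * f' s x\<bar> \<le> Q s r * \<bar>r - s\<bar>"
    if s: "s \<in> {0..T}" and r: "r \<in> {0..T}" "r \<noteq> s" and x: "x \<in> {0..1}" for s r x
  proof -
    have eq: "\<Psi> r - \<Psi> s - scale4 (r - s) (\<Phi> s) = (\<lambda>x. f r x - f s x - (r - s) * F s x,
        \<lambda>x. g r x - g s x - (r - s) * G s x, \<lambda>x. h r x - h s x - (r - s) * H s x)"
      by (simp add: \<Psi> \<Phi> scale4_def fun_eq_iff)
    have n: "norm_H4 (\<lambda>x. f r x - f s x - (r - s) * F s x,
        \<lambda>x. g r x - g s x - (r - s) * G s x, \<lambda>x. h r x - h s x - (r - s) * H s x) = Q s r * \<bar>r - s\<bar>"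
      using r(2) by (simp add: Q_def eq)
    obtain Fd Hd where Fd: "has_h1_deriv (F s) Fd" and Hd: "has_h1_deriv (H s) Hd"
      using memb[OF s] by (auto elim!: H1_obtain)
    have "\<bar>f r x - f s x - (r - s) * F s x\<bar> \<le> 2 * h1_norm (\<lambda>x. f r x - f s x - (r - s) * F s x)"
      using f'[OF s] f'[OF r(1)]
      by (intro sup_le_h1_norm[OF has_h1_deriv_diff[OF has_h1_deriv_diff has_h1_deriv_cmult[OF Fd]] x]) auto
    then have 1: "\<bar>f r x - f s x - (r - s) * F s x\<bar> \<le> 2 * Q s r * \<bar>r - s\<bar>"
      using le_norm_H4(1)[of "\<lambda>x. f r x - f s x - (r - s) * F s x" "\<lambda>x. g r x - g s x - (r - s) * G s x" "\<lambda>x. h r x - h s x - (r - s) * H s x"] n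
      by simp
    have "\<bar>h r x - h s x - (r - s) * H s x\<bar> \<le> 2 * h1_norm (\<lambda>x. h r x - h s x - (r - s) * H s x)"
      using op'(5)[OF s] op'(5)[OF r(1)]
      by (intro sup_le_h1_norm[OF has_h1_deriv_diff[OF has_h1_deriv_diff has_h1_deriv_cmult[OF Hd]] x]) auto
    then have 2: "\<bar>h r x - h s x - (r - s) * H s x\<bar> \<le> 2 * Q s r * \<bar>r - s\<bar>"
      using le_norm_H4(3)[where f = "\<lambda>x. f r x - f s x - (r - s) * F s x" and g = "\<lambda>x. g r x - g s x - (r - s) * G s x" and h = "\<lambda>x. h r x - h s x - (r - s) * H s x"] n
      by simp
    have L: "(\<lambda>x. g r x - g s x - (r - s) * G s x) \<in> L2"
      using memb[OF s] memb[OF r(1)] by (intro L2_diff L2_cmult) auto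
    have "(G s has_integral f' s x - f' s 0) {0..x}"
      using f'[OF s] x by (auto simp: has_h1_deriv_def)
    then have Gi: "(G s has_integral f' s x) {0..x}" using f'[OF s] by simp
    have "((\<lambda>x. g r x - g s x - (r - s) * G s x) has_integral J r x - J s x - (r - s) * f' s x) {0..x}"
      unfolding J_def using s r x by (intro has_integral_diff has_integral_mult_right Gi integrable_integral gi) auto
    then have "integral {0..x} (\<lambda>x. g r x - g s x - (r - s) * G s x) = J r x - J s x - (r - s) * f' s x"
      by (rule integral_unique)
    then have 3: "\<bar>J r x - J s x - (r - s) * f' s x\<bar> \<le> Q s r * \<bar>r - s\<bar>"
      using abs_integral_le_l2_norm[OF L x] n
       le_norm_H4(2)[where f = "\<lambda>x. f r x - f s x - (r - s) * F s x" and g = "\<lambda>x. g r x - g s x - (r - s) * G s x" and h = "\<lambda>x. h r x - h s x - (r - s) * H s x"]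
      by simp
    show ?thesis using 1 2 3 by blast
  qed
  have Qpos: "0 \<le> Q s r * \<bar>r - s\<bar>" for s r by (simp add: Q_def)
  \<comment> \<open>The Riemann invariants: from \<open>f_s = J_x = F\<close> and
    \<open>J_s = f_x = f'\<close> the sum moves to the left and the difference to the right.\<close>
  define P where "P s x = f s x + J s x" for s x
  define R where "R s x = f s x - J s x" for s x
  have charP: "P q (x0 - q) = P p (x0 - p)" if "0 \<le> p" "p \<le> q" "q \<le> T" "\<And>s. s \<in> {p..q} \<Longrightarrow> x0 - s \<in> {0..1}" for p q x0
  proof -
    have "P q (x0 + (- 1) * q) = P p (x0 + (- 1) * p)"
    proof (rule transport_characteristics[where u = P and c = "- 1" and v = "\<lambda>s x. f' s x + F s x" and B = "\<lambda>s r. 3 * Q s r" and T = T])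
      fix s r x assume a: "s \<in> {0..T}" "r \<in> {0..T}" "r \<noteq> s" "x \<in> {0..1::real}"
      have "P r x - P s x - (r - s) * (- (- 1) * (f' s x + F s x)) = (f r x - f s x - (r - s) * F s x) + (J r x - J s x - (r - s) * f' s x)"
        by (simp add: P_def algebra_simps)
      then show "\<bar>P r x - P s x - (r - s) * (- (- 1) * (f' s x + F s x))\<bar> \<le> 3 * Q s r * \<bar>r - s\<bar>"
        using bounds[OF a] by linarith
    next
      fix s x assume a: "s \<in> {0..T}" "x \<in> {0..1::real}"
      show "(P s has_real_derivative f' s x + F s x) (at x within {0..1})"
        unfolding P_def using a f'[OF a(1)] by (intro DERIV_add Jx dx f'c) auto
    qed (use that Ql in \<open>auto intro!: continuous_intros Fc f'c\<close>)
    then show ?thesis by simp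
  qed
  have charR: "R q (x0 + q) = R p (x0 + p)" if "0 \<le> p" "p \<le> q" "q \<le> T" "\<And>s. s \<in> {p..q} \<Longrightarrow> x0 + s \<in> {0..1}" for p q x0
  proof -
    have "R q (x0 + 1 * q) = R p (x0 + 1 * p)"
    proof (rule transport_characteristics[where u = R and c = 1 and v = "\<lambda>s x. f' s x - F s x" and B = "\<lambda>s r. 3 * Q s r" and T = T])
      fix s r x assume a: "s \<in> {0..T}" "r \<in> {0..T}" "r \<noteq> s" "x \<in> {0..1::real}"
      have "R r x - R s x - (r - s) * (- 1 * (f' s x - F s x)) = (f r x - f s x - (r - s) * F s x) - (J r x - J s x - (r - s) * f' s x)"
        by (simp add: R_def algebra_simps)
      then show "\<bar>R r x - R s x - (r - s) * (- 1 * (f' s x - F s x))\<bar> \<le> 3 * Q s r * \<bar>r - s\<bar>"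
        using bounds[OF a] by linarith
    next
      fix s x assume a: "s \<in> {0..T}" "x \<in> {0..1::real}"
      show "(R s has_real_derivative f' s x - F s x) (at x within {0..1})"
        unfolding R_def using a f'[OF a(1)] by (intro DERIV_diff Jx dx f'c) auto
    qed (use that Ql in \<open>auto intro!: continuous_intros Fc f'c\<close>)
    then show ?thesis by simp
  qed
  have charh: "h q (x0 + q) = h p (x0 + p)" if "0 \<le> p" "p \<le> q" "q \<le> T" "\<And>s. s \<in> {p..q} \<Longrightarrow> x0 + s \<in> {0..1}" for p q x0
  proof -
    have "h q (x0 + 1 * q) = h p (x0 + 1 * p)"
    proof (rule transport_characteristics[where u = h and c = 1 and v = "\<lambda>s x. - H s x" and B = "\<lambda>s r. 3 * Q s r" and T = T])
      fix s r x assume a: "s \<in> {0..T}" "r \<in> {0..T}" "r \<noteq> s" "x \<in> {0..1::real}"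
      have "h r x - h s x - (r - s) * (- 1 * (- H s x)) = h r x - h s x - (r - s) * H s x" by simp
      then show "\<bar>h r x - h s x - (r - s) * (- 1 * (- H s x))\<bar> \<le> 3 * Q s r * \<bar>r - s\<bar>"
        using bounds[OF a] Qpos[of s r] by linarith
    next
      fix s x assume a: "s \<in> {0..T}" "x \<in> {0..1::real}"
      show "(h s has_real_derivative - H s x) (at x within {0..1})"
        using a op'(5)[OF a(1)] by (intro dx) (auto intro!: continuous_intros Hc)
    qed (use that Ql in \<open>auto intro!: continuous_intros Hc\<close>)
    then show ?thesis by simp
  qed
  have init: "P 0 x = 0" "R 0 x = 0" "h 0 x = 0" for x
    using \<Psi>0 by (simp_all add: P_def R_def J_def f_def g_def h_def)
  have J0: "J s 0 = 0" for s by (simp add: J_def)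
  \<comment> \<open>Backwards along its characteristic a point meets time 0 or, at time
    \<open>s - x\<close>, the end \<open>x = 0\<close>. There \<open>J\<close> vanishes and
    \<open>h = - c2 * f\<close>, so \<open>f\<close> at that end decides both \<open>R\<close> and
    \<open>h\<close>.\<close>
  have inflow: "R s x = 0 \<and> h s x = 0"
    if "s \<in> {0..T}" "x \<in> {0..1}" "\<And>r. 0 \<le> r \<Longrightarrow> r \<le> s - x \<Longrightarrow> f r 0 = 0" for s x
  proof (cases "s \<le> x")
    case True
    have "R s ((x - s) + s) = R 0 ((x - s) + 0)" "h s ((x - s) + s) = h 0 ((x - s) + 0)"
      using that True by (intro charR charh; simp)+
    then show ?thesis by (simp add: init)
  next
    case False
    have "R s ((x - s) + s) = R (s - x) ((x - s) + (s - x))" "h s ((x - s) + s) = h (s - x) ((x - s) + (s - x))"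
      using that False by (intro charR charh; simp)+
    moreover have "f (s - x) 0 = 0" using that False by simp
    moreover have "h (s - x) 0 = - c2 * f (s - x) 0" using that False by (intro memb) auto
    ultimately show ?thesis by (simp add: R_def J0)
  qed
  \<comment> \<open>Waves moving left enter at \<open>x = 1\<close>, where
    \<open>P = 2 * f - R\<close>.\<close>
  have Pzero: "P s x = 0"
    if s: "s \<in> {0..T}" and x: "x \<in> {0..1}" and z: "\<And>r. 0 \<le> r \<Longrightarrow> r \<le> s \<Longrightarrow> f r 1 = 0 \<and> R r 1 = 0" for s x
  proof (cases "s \<le> 1 - x")
    case True
    have "P s ((x + s) - s) = P 0 ((x + s) - 0)" using s x True by (intro charP) auto
    then show ?thesis by (simp add: init)
  next
    case False
    have "P s ((x + s) - s) = P (s - (1 - x)) ((x + s) - (s - (1 - x)))"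
      using s x False by (intro charP) auto
    then have "P s x = P (s - (1 - x)) 1" by simp
    moreover have "P (s - (1 - x)) 1 = 2 * f (s - (1 - x)) 1 - R (s - (1 - x)) 1" by (simp add: P_def R_def)
    ultimately show ?thesis using z[of "s - (1 - x)"] x False by simp
  qed
  \<comment> \<open>A right-moving signal takes one unit of time to reach \<open>x = 1\<close>, so
    vanishing of \<open>f\<close> at \<open>x = 0\<close> up to time \<open>n\<close> extends to
    time \<open>n + 1\<close>.\<close>
  have "\<forall>s. s \<in> {0..T} \<and> s \<le> real n \<longrightarrow> f s 0 = 0" for n
  proof (induction n)
    case 0
    show ?case using \<Psi>0 by (auto simp: f_def)
  next
    case (Suc n)
    show ?case
    proof (intro allI impI)
      fix s assume s: "s \<in> {0..T} \<and> s \<le> real (Suc n)"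
      have "f r 1 = 0 \<and> R r 1 = 0" if r: "0 \<le> r" "r \<le> s" for r
      proof -
        have rT: "r \<in> {0..T}" using r s by auto
        have "R r 1 = 0 \<and> h r 1 = 0" using Suc r s by (intro inflow rT) auto
        then show ?thesis using memb(4)[OF rT] by simp
      qed
      then have "P s 0 = 0" using s by (intro Pzero) auto
      then show "f s 0 = 0" by (simp add: P_def J0)
    qed
  qed
  then have f0: "f s 0 = 0" if "s \<in> {0..T}" for s using that real_arch_simple by blast
  have Rh: "R s x = 0" "h s x = 0" if "s \<in> {0..T}" "x \<in> {0..1}" for s x
    using inflow[OF that] f0 that by auto
  have PR: "P s x = 0" if "s \<in> {0..T}" "x \<in> {0..1}" for s x
  proof (rule Pzero[OF that])
    fix r assume r: "0 \<le> r" "r \<le> s"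
    then have "r \<in> {0..T}" using that by auto
    then show "f r 1 = 0 \<and> R r 1 = 0" using Rh[of r 1] memb(4)[of r] by simp
  qed
  have fz: "f s x = 0" and Jz: "J s x = 0" if "s \<in> {0..T}" "x \<in> {0..1}" for s x
    using Rh(1)[OF that] PR[OF that] by (auto simp: P_def R_def)
  \<comment> \<open>\<open>F\<close>, \<open>- H\<close> and \<open>f'\<close> are
    \<open>x\<close>-derivatives of the vanishing functions \<open>J\<close>, \<open>h\<close> and
    \<open>f\<close>; uniqueness of derivatives relative to \<open>{0..1}\<close> carries zero over
    to them.\<close>
  have uniq: "k x = 0" if z: "\<And>x. x \<in> {0..1} \<Longrightarrow> K x = 0"
    and K: "\<And>x. x \<in> {0..1} \<Longrightarrow> (K has_real_derivative k x) (at x within {0..1})" and x: "x \<in> {0..1}"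
  for K k :: "real \<Rightarrow> real" and x
  proof -
    have "((\<lambda>x. 0) has_real_derivative k x) (at x within {0..1})"
      by (rule has_real_derivative_transform[OF x _ K[OF x]]) (simp add: z)
    moreover have "((\<lambda>x. 0) has_real_derivative 0) (at x within {0..1})" by simp
    moreover have "at x within {0..1::real} \<noteq> bot" using x by (simp add: trivial_limit_within islimpt_Icc)
    ultimately show ?thesis
      unfolding has_field_derivative_iff using tendsto_unique by blast
  qed
  have "F s x = 0" if "x \<in> {0..1}" for x
    by (rule uniq[where K = "J s", OF Jz[OF s] Jx[OF s] that])
  moreover have "H s x = 0" if "x \<in> {0..1}" for x
  proof -
    have "- H s x = 0"
      by (rule uniq[where K = "h s", OF Rh(2)[OF s] dx[OF op'(5)[OF s]] that]) (auto intro!: continuous_intros Hc s)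
    then show ?thesis by simp
  qed
  moreover have "l2_eq (G s) (\<lambda>x. 0)"
  proof (rule l2_eq_zeroI)
    have f'z: "f' s x = 0" if "x \<in> {0..1}" for x
      using f'[OF s] f'c[OF s] by (intro uniq[where K = "f s", OF fz[OF s] dx that]) auto
    show "(G s has_integral 0) {0..x}" if "x \<in> {0..1}" for x
    proof -
      have "(G s has_integral f' s x - f' s 0) {0..x}"
        using f'[OF s] that by (auto simp: has_h1_deriv_def)
      then show ?thesis using f'z[OF that] f'z[of 0] by simp
    qed
  qed
  ultimately show ?thesis by (simp add: \<Phi> eq_H4_def h1_eq_def)
qed

section \<open>Differences of mild solutions\<close>

lemma H1_diff: "f \<in> H1 \<Longrightarrow> g \<in> H1 \<Longrightarrow> (\<lambda>x. f x - g x) \<in> H1"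
  and H1_add: "f \<in> H1 \<Longrightarrow> g \<in> H1 \<Longrightarrow> (\<lambda>x. f x + g x) \<in> H1"
  and H1_cmult: "f \<in> H1 \<Longrightarrow> (\<lambda>x. c * f x) \<in> H1"
  using has_h1_deriv_diff has_h1_deriv_add has_h1_deriv_cmult unfolding H1_def by blast+

lemma norm_H4_add_le:
  assumes "f \<in> H1" "g \<in> L2" "h \<in> H1" "f' \<in> H1" "g' \<in> L2" "h' \<in> H1"
  shows "norm_H4 (\<lambda>x. f x + f' x, \<lambda>x. g x + g' x, \<lambda>x. h x + h' x)
    \<le> 10 * (norm_H4 (f, g, h) + norm_H4 (f', g', h'))"
proof -
  have "h1_norm (\<lambda>x. f x + f' x) \<le> 4 * (h1_norm f + h1_norm f')"
    using assms(1,4) by (elim H1_obtain) (rule h1_norm_add_le)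
  moreover have "l2_norm (\<lambda>x. g x + g' x) \<le> 2 * (l2_norm g + l2_norm g')"
    using assms by (intro l2_norm_add_le)
  moreover have "h1_norm (\<lambda>x. h x + h' x) \<le> 4 * (h1_norm h + h1_norm h')"
    using assms(3,6) by (elim H1_obtain) (rule h1_norm_add_le)
  ultimately have "norm_H4 (\<lambda>x. f x + f' x, \<lambda>x. g x + g' x, \<lambda>x. h x + h' x) \<le>
      4 * (h1_norm f + h1_norm f') + 2 * (l2_norm g + l2_norm g') + 4 * (h1_norm h + h1_norm h')"
    by (intro order_trans[OF norm_H4_le] add_mono)
  also have "\<dots> \<le> 4 * (norm_H4 (f, g, h) + norm_H4 (f', g', h')) + 2 * (norm_H4 (f, g, h) + norm_H4 (f', g', h'))
      + 4 * (norm_H4 (f, g, h) + norm_H4 (f', g', h'))"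
    by (intro add_mono mult_left_mono le_norm_H4) auto
  finally show ?thesis by simp
qed

lemma h1_norm_zero: "(\<And>x. x \<in> {0..1} \<Longrightarrow> f x = 0) \<Longrightarrow> h1_norm f = 0"
proof -
  assume z: "\<And>x. x \<in> {0..1} \<Longrightarrow> f x = 0"
  have "has_h1_deriv (\<lambda>x. 0) (\<lambda>x. 0)"
    by (auto simp: has_h1_deriv_def intro!: L2_continuous)
  from h1_norm_cmult[OF this, of 0] have "h1_norm (\<lambda>x. 0) = 0" by simp
  then show ?thesis using h1_norm_cong[of f "\<lambda>x. 0"] z by simp
qed

lemma norm_H4_zero:
  assumes "eq_H4 (f, g, h) (f', g', h')" "g \<in> L2" "g' \<in> L2"
  shows "norm_H4 (\<lambda>x. f x - f' x, \<lambda>x. g x - g' x, \<lambda>x. h x - h' x) = 0"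
proof -
  have z: "l2_eq (\<lambda>x. g x - g' x) (\<lambda>x. 0)" using assms(1) by (simp add: eq_H4_def l2_eq_def)
  have "l2_norm (\<lambda>x. g x - g' x) = l2_norm (\<lambda>x. 0)"
    by (rule l2_norm_cong_AE[OF L2_diff[OF assms(2,3)] L2_continuous z]) simp
  also have "l2_norm (\<lambda>x. 0) = 0" by (simp add: l2_norm_def)
  finally have "l2_norm (\<lambda>x. g x - g' x) = 0" .
  moreover have "h1_norm (\<lambda>x. f x - f' x) = 0" "h1_norm (\<lambda>x. h x - h' x) = 0"
    using assms(1) by (auto intro!: h1_norm_zero simp: eq_H4_def h1_eq_def)
  ultimately show ?thesis by (simp add: norm_H4_def)
qed

lemma system_operator_diff:
  assumes "system_operator c2 X X'" "system_operator c2 Y Y'"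
  shows "system_operator c2 (X - Y) (X' - Y')"
proof -
  obtain f g h F G H where X: "X = (f, g, h)" "X' = (F, G, H)" by (metis prod_cases3)
  obtain u v w U V W where Y: "Y = (u, v, w)" "Y' = (U, V, W)" by (metis prod_cases3)
  obtain f' where f': "has_h1_deriv f f'" "f' 0 = 0" "has_h1_deriv f' G"
    using assms(1) unfolding X system_operator_def by auto
  obtain u' where u': "has_h1_deriv u u'" "u' 0 = 0" "has_h1_deriv u' V"
    using assms(2) unfolding Y system_operator_def by auto
  have e: "X - Y = (\<lambda>x. f x - u x, \<lambda>x. g x - v x, \<lambda>x. h x - w x)"
    "X' - Y' = (\<lambda>x. F x - U x, \<lambda>x. G x - V x, \<lambda>x. H x - W x)"
    by (auto simp: X Y fun_eq_iff)
  have "X - Y \<in> H4 c2" "X' - Y' \<in> H4 c2"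
    unfolding e using assms unfolding X Y system_operator_def H4_def
    by (auto intro!: H1_diff L2_diff simp: algebra_simps)
  moreover have "l2_eq (\<lambda>x. F x - U x) (\<lambda>x. g x - v x)"
    using assms unfolding X Y system_operator_def l2_eq_def by auto
  moreover have "\<exists>k. has_h1_deriv (\<lambda>x. f x - u x) k \<and> k 0 = 0 \<and> has_h1_deriv k (\<lambda>x. G x - V x)"
    using f' u' by (intro exI[of _ "\<lambda>x. f' x - u' x"]) (auto intro: has_h1_deriv_diff)
  moreover have "has_h1_deriv (\<lambda>x. h x - w x) (\<lambda>x. - (H x - W x))"
    using has_h1_deriv_diff[of h "\<lambda>x. - H x" w "\<lambda>x. - W x"] assms
    unfolding X Y system_operator_def by auto
  ultimately show ?thesis unfolding e system_operator_def by (simp only: split_conv)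
qed

text \<open>Mild solutions may fail to be differentiable in time, but their primitives are classical
  solutions up to the initial values. The difference of the primitives starts at zero, so
  \<open>classical_solution_zero\<close> makes its time derivative vanish.\<close>

lemma mild_solution_unique:
  assumes "mild_solution c2 T \<Phi>0 \<Phi>" "mild_solution c2 T \<Phi>0 \<Phi>'" and s: "s \<in> {0..T}"
  shows "eq_H4 (\<Phi> s) (\<Phi>' s)"
proof -
  obtain \<Psi> where \<Psi>: "\<Psi> 0 = (\<lambda>x. 0, \<lambda>x. 0, \<lambda>x. 0)"
    "\<And>s. s \<in> {0..T} \<Longrightarrow> ((\<lambda>r. norm_H4 (\<Psi> r - \<Psi> s - scale4 (r - s) (\<Phi> s)) / \<bar>r - s\<bar>) \<longlongrightarrow> 0) (at s within {0..T})"
    "\<And>s. s \<in> {0..T} \<Longrightarrow> system_operator c2 (\<Psi> s) (\<Phi> s - \<Phi> 0)"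
    using assms(1) unfolding mild_solution_def by blast
  obtain \<Psi>' where \<Psi>': "\<Psi>' 0 = (\<lambda>x. 0, \<lambda>x. 0, \<lambda>x. 0)"
    "\<And>s. s \<in> {0..T} \<Longrightarrow> ((\<lambda>r. norm_H4 (\<Psi>' r - \<Psi>' s - scale4 (r - s) (\<Phi>' s)) / \<bar>r - s\<bar>) \<longlongrightarrow> 0) (at s within {0..T})"
    "\<And>s. s \<in> {0..T} \<Longrightarrow> system_operator c2 (\<Psi>' s) (\<Phi>' s - \<Phi>' 0)"
    using assms(2) unfolding mild_solution_def by blast
  have \<Phi>in: "\<Phi> s \<in> H4 c2" "\<Phi>' s \<in> H4 c2" if "s \<in> {0..T}" for s
    using assms(1,2) that unfolding mild_solution_def continuous_into_def by auto
  have T: "0 \<in> {0..T}" using s by auto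
  obtain z w Y where e0: "\<Phi>0 = (z, w, Y)" by (metis prod_cases3)
  obtain F0 G0 H0 where \<Phi>0: "\<Phi> 0 = (F0, G0, H0)" by (metis prod_cases3)
  obtain F0' G0' H0' where \<Phi>0': "\<Phi>' 0 = (F0', G0', H0')" by (metis prod_cases3)
  have L0: "F0 \<in> H1" "F0' \<in> H1" "G0 \<in> L2" "G0' \<in> L2" "H0 \<in> H1" "H0' \<in> H1"
    using \<Phi>in[OF T] by (auto simp: \<Phi>0 \<Phi>0' H4_def)
  have eq0: "eq_H4 (F0, G0, H0) (F0', G0', H0')"
  proof -
    have "eq_H4 (F0, G0, H0) (z, w, Y)" "eq_H4 (F0', G0', H0') (z, w, Y)"
      using assms(1,2) unfolding mild_solution_def \<Phi>0 \<Phi>0' e0 by auto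
    then show ?thesis unfolding eq_H4_def h1_eq_def l2_eq_def by auto
  qed
  \<comment> \<open>The initial values are subtracted because \<open>system_operator\<close> sees
    \<open>\<Phi> s - \<Phi> 0\<close>, while the primitive has derivative \<open>\<Phi> s\<close>.
    The discrepancy \<open>\<Phi> 0 - \<Phi>' 0\<close> has norm 0 but may be nonzero as a triple of
    functions.\<close>
  let ?Z = "\<lambda>s. (\<Phi> s - \<Phi> 0) - (\<Phi>' s - \<Phi>' 0)"
  have "eq_H4 (?Z s) (\<lambda>x. 0, \<lambda>x. 0, \<lambda>x. 0)"
  proof (rule classical_solution_zero[where \<Psi> = "\<lambda>s. \<Psi> s - \<Psi>' s" and \<Phi> = ?Z, OF _ _ _ s])
    show "\<Psi> 0 - \<Psi>' 0 = (\<lambda>x. 0, \<lambda>x. 0, \<lambda>x. 0)" by (simp add: \<Psi> \<Psi>' fun_eq_iff)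
    fix s assume s: "s \<in> {0..T}"
    show "system_operator c2 (\<Psi> s - \<Psi>' s) (?Z s)"
      by (intro system_operator_diff \<Psi> \<Psi>' s)
    show "((\<lambda>r. norm_H4 ((\<Psi> r - \<Psi>' r) - (\<Psi> s - \<Psi>' s) - scale4 (r - s) (?Z s)) / \<bar>r - s\<bar>) \<longlongrightarrow> 0) (at s within {0..T})"
    proof (rule Lim_null_comparison)
      \<comment> \<open>The factor 100 is two applications of \<open>norm_H4_add_le\<close>; the
        term with the initial values has norm 0.\<close>
      let ?g = "\<lambda>r. 100 * (norm_H4 (\<Psi> r - \<Psi> s - scale4 (r - s) (\<Phi> s)) / \<bar>r - s\<bar>) + 100 * (norm_H4 (\<Psi>' r - \<Psi>' s - scale4 (r - s) (\<Phi>' s)) / \<bar>r - s\<bar>)"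
      have "(?g \<longlongrightarrow> 100 * 0 + 100 * 0) (at s within {0..T})"
        by (intro tendsto_add tendsto_mult_left \<Psi> \<Psi>' s)
      then show "(?g \<longlongrightarrow> 0) (at s within {0..T})" by simp
      have le: "norm_H4 ((\<Psi> r - \<Psi>' r) - (\<Psi> s - \<Psi>' s) - scale4 (r - s) (?Z s)) \<le>
         100 * norm_H4 (\<Psi> r - \<Psi> s - scale4 (r - s) (\<Phi> s)) + 100 * norm_H4 (\<Psi>' r - \<Psi>' s - scale4 (r - s) (\<Phi>' s))"
        if r: "r \<in> {0..T}" for r
      proof -
        have in4: "\<Psi> r \<in> H4 c2" "\<Psi> s \<in> H4 c2" "\<Psi>' r \<in> H4 c2" "\<Psi>' s \<in> H4 c2"
          using \<Psi>(3)[OF r] \<Psi>(3)[OF s] \<Psi>'(3)[OF r] \<Psi>'(3)[OF s]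
          by (auto simp: system_operator_def split: prod.splits)
        have split: "\<exists>f g h. X = (f, g, h) \<and> f \<in> H1 \<and> g \<in> L2 \<and> h \<in> H1"
          if "A \<in> H4 c2" "B \<in> H4 c2" "C \<in> H4 c2" "X = A - B - scale4 (r - s) C" for A B C X
        proof -
          obtain a1 a2 a3 where A: "A = (a1, a2, a3)" by (metis prod_cases3)
          obtain b1 b2 b3 where B: "B = (b1, b2, b3)" by (metis prod_cases3)
          obtain k1 k2 k3 where C: "C = (k1, k2, k3)" by (metis prod_cases3)
          have "X = (\<lambda>x. a1 x - b1 x - (r - s) * k1 x, \<lambda>x. a2 x - b2 x - (r - s) * k2 x, \<lambda>x. a3 x - b3 x - (r - s) * k3 x)"
            by (simp add: that A B C scale4_def fun_eq_iff)
          moreover have "(\<lambda>x. a1 x - b1 x - (r - s) * k1 x) \<in> H1" "(\<lambda>x. a3 x - b3 x - (r - s) * k3 x) \<in> H1"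
             "(\<lambda>x. a2 x - b2 x - (r - s) * k2 x) \<in> L2"
            using that(1-3) by (auto simp: A B C H4_def intro!: H1_diff H1_cmult L2_diff L2_cmult)
          ultimately show ?thesis by blast
        qed
        obtain p1 p2 p3 where P: "\<Psi> r - \<Psi> s - scale4 (r - s) (\<Phi> s) = (p1, p2, p3)" "p1 \<in> H1" "p2 \<in> L2" "p3 \<in> H1"
          using split[OF in4(1,2) \<Phi>in(1)[OF s] refl] by blast
        obtain q1 q2 q3 where Q: "\<Psi>' r - \<Psi>' s - scale4 (r - s) (\<Phi>' s) = (q1, q2, q3)" "q1 \<in> H1" "q2 \<in> L2" "q3 \<in> H1"
          using split[OF in4(3,4) \<Phi>in(2)[OF s] refl] by blast
        have p: "p1 x = fst (\<Psi> r) x - fst (\<Psi> s) x - (r - s) * fst (\<Phi> s) x"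
          "p2 x = fst (snd (\<Psi> r)) x - fst (snd (\<Psi> s)) x - (r - s) * fst (snd (\<Phi> s)) x"
          "p3 x = snd (snd (\<Psi> r)) x - snd (snd (\<Psi> s)) x - (r - s) * snd (snd (\<Phi> s)) x" for x
          using P(1) by (auto simp: prod_eq_iff fun_eq_iff scale4_def split_beta)
        have q: "q1 x = fst (\<Psi>' r) x - fst (\<Psi>' s) x - (r - s) * fst (\<Phi>' s) x"
          "q2 x = fst (snd (\<Psi>' r)) x - fst (snd (\<Psi>' s)) x - (r - s) * fst (snd (\<Phi>' s)) x"
          "q3 x = snd (snd (\<Psi>' r)) x - snd (snd (\<Psi>' s)) x - (r - s) * snd (snd (\<Phi>' s)) x" for x
          using Q(1) by (auto simp: prod_eq_iff fun_eq_iff scale4_def split_beta)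
        have eq: "(\<Psi> r - \<Psi>' r) - (\<Psi> s - \<Psi>' s) - scale4 (r - s) (?Z s) =
          (\<lambda>x. (p1 x + - 1 * q1 x) + (r - s) * (F0 x - F0' x),
            \<lambda>x. (p2 x + - 1 * q2 x) + (r - s) * (G0 x - G0' x), \<lambda>x. (p3 x + - 1 * q3 x) + (r - s) * (H0 x - H0' x))"
          by (simp add: prod_eq_iff fun_eq_iff scale4_def split_beta p q \<Phi>0 \<Phi>0' algebra_simps)
        have scale: "norm_H4 (\<lambda>x. c * f x, \<lambda>x. c * g x, \<lambda>x. c * h x) = \<bar>c\<bar> * norm_H4 (f, g, h)"
          if "f \<in> H1" "h \<in> H1" for c f g h
        proof -
          have "h1_norm (\<lambda>x. c * f x) = \<bar>c\<bar> * h1_norm f" "h1_norm (\<lambda>x. c * h x) = \<bar>c\<bar> * h1_norm h"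
            by (rule H1_obtain[OF that(1)], erule h1_norm_cmult, rule H1_obtain[OF that(2)], erule h1_norm_cmult)
          then show ?thesis
            by (simp add: norm_H4_def l2_norm_cmult power_mult_distrib distrib_left[symmetric] real_sqrt_mult)
        qed
        have "norm_H4 (\<lambda>x. (p1 x + - 1 * q1 x) + (r - s) * (F0 x - F0' x),
            \<lambda>x. (p2 x + - 1 * q2 x) + (r - s) * (G0 x - G0' x), \<lambda>x. (p3 x + - 1 * q3 x) + (r - s) * (H0 x - H0' x))
          \<le> 10 * (norm_H4 (\<lambda>x. p1 x + - 1 * q1 x, \<lambda>x. p2 x + - 1 * q2 x, \<lambda>x. p3 x + - 1 * q3 x)
            + norm_H4 (\<lambda>x. (r - s) * (F0 x - F0' x), \<lambda>x. (r - s) * (G0 x - G0' x), \<lambda>x. (r - s) * (H0 x - H0' x)))"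
          using P Q L0 by (intro norm_H4_add_le H1_add L2_add H1_cmult L2_cmult H1_diff L2_diff) auto
        also have "norm_H4 (\<lambda>x. (r - s) * (F0 x - F0' x), \<lambda>x. (r - s) * (G0 x - G0' x), \<lambda>x. (r - s) * (H0 x - H0' x)) = 0"
          using norm_H4_zero[OF eq0 L0(3,4)] L0 scale[of "\<lambda>x. F0 x - F0' x" "\<lambda>x. H0 x - H0' x" "r - s" "\<lambda>x. G0 x - G0' x"]
          by (simp add: H1_diff)
        also have "norm_H4 (\<lambda>x. p1 x + - 1 * q1 x, \<lambda>x. p2 x + - 1 * q2 x, \<lambda>x. p3 x + - 1 * q3 x)
          \<le> 10 * (norm_H4 (p1, p2, p3) + norm_H4 (\<lambda>x. - 1 * q1 x, \<lambda>x. - 1 * q2 x, \<lambda>x. - 1 * q3 x))"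
          using P Q by (intro norm_H4_add_le H1_cmult L2_cmult) auto
        also have "norm_H4 (\<lambda>x. - 1 * q1 x, \<lambda>x. - 1 * q2 x, \<lambda>x. - 1 * q3 x) = norm_H4 (q1, q2, q3)"
          using scale[OF Q(2,4), of "- 1" q2] by simp
        finally show ?thesis unfolding eq P(1) Q(1) by simp
      qed
      have "norm (norm_H4 ((\<Psi> r - \<Psi>' r) - (\<Psi> s - \<Psi>' s) - scale4 (r - s) (?Z s)) / \<bar>r - s\<bar>) \<le> ?g r" if r: "r \<in> {0..T}" for r
        using divide_right_mono[OF le[OF r], of "\<bar>r - s\<bar>"] by (simp add: add_divide_distrib)
      then show "\<forall>\<^sub>F r in at s within {0..T}. norm (norm_H4 ((\<Psi> r - \<Psi>' r) - (\<Psi> s - \<Psi>' s) - scale4 (r - s) (?Z s)) / \<bar>r - s\<bar>) \<le> ?g r"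
        by (simp add: eventually_at_filter)
    qed
  qed
  moreover obtain F G H where "\<Phi> s = (F, G, H)" by (metis prod_cases3)
  moreover obtain F' G' H' where "\<Phi>' s = (F', G', H')" by (metis prod_cases3)
  ultimately show ?thesis
    using eq0 by (auto simp: \<Phi>0 \<Phi>0' eq_H4_def h1_eq_def l2_eq_def)
qed

section \<open>The adaptive observer\<close>

lemma nonincreasing_on_Icc:
  fixes V :: "real \<Rightarrow> real"
  assumes "\<And>s. s \<in> {0..T} \<Longrightarrow> (V has_real_derivative V' s) (at s within {0..T})"
    "\<And>s. s \<in> {0..T} \<Longrightarrow> V' s \<le> 0" "s \<in> {0..T}"
  shows "V s \<le> V 0"
proof (rule DERIV_nonpos_imp_decreasing_open[of 0 s V])
  show "0 \<le> s" using assms(3) by simp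
  have "continuous_on {0..T} V"
    using assms(1) by (intro DERIV_continuous_on)
  then show "continuous_on {0..s} V" by (rule continuous_on_subset) (use assms(3) in auto)
  fix x assume x: "0 < x" "x < s"
  then have "(V has_real_derivative V' x) (at x)"
    using assms(1)[of x] assms(3) at_within_Icc_at[of 0 x T] by auto
  then show "\<exists>y. (V has_real_derivative y) (at x) \<and> y \<le> 0" using assms(2)[of x] assms(3) x by auto
qed

text \<open>Picard iteration in the weight \<open>exp (- (2 * L + 1) * s)\<close>, for which the integral operator is a
  contraction on the whole interval.\<close>

lemma lipschitz_ode_exists:
  fixes f :: "real \<Rightarrow> 'a::euclidean_space \<Rightarrow> 'a"
  assumes cont: "\<And>X. continuous_on {0..T} X \<Longrightarrow> continuous_on {0..T} (\<lambda>s. f s (X s))"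
    and lip: "\<And>s x y. s \<in> {0..T} \<Longrightarrow> norm (f s x - f s y) \<le> L * norm (x - y)"
    and L: "0 \<le> L" and T: "0 \<le> T"
  obtains X where "X 0 = x0" "\<And>s. s \<in> {0..T} \<Longrightarrow> (X has_vector_derivative f s (X s)) (at s within {0..T})"
proof -
  \<comment> \<open>Makes the contraction factor \<open>L / l\<close> at most \<open>1 / 2\<close>,
    with \<open>l\<close> positive also for \<open>L = 0\<close>.\<close>
  define l where "l = 2 * L + 1"
  have l: "0 < l" "2 * L \<le> l" using L by (auto simp: l_def)
  \<comment> \<open>Clamping turns functions on \<open>{0..T}\<close> into bounded continuous
    functions on the line, the complete space in which the fixed point is taken.\<close>
  define c where "c s = max 0 (min T s)" for s
  have c: "c s \<in> {0..T}" for s using T by (auto simp: c_def)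
  have cid: "c s = s" if "s \<in> {0..T}" for s using that by (auto simp: c_def)
  have cc: "continuous_on UNIV c" unfolding c_def by (intro continuous_intros)
  \<comment> \<open>\<open>Z\<close> represents \<open>exp (- l * s)\<close> times the solution, so
    the uniform norm of \<open>Z\<close> is the weighted norm of the solution.\<close>
  define J :: "(real \<Rightarrow>\<^sub>C 'a) \<Rightarrow> real \<Rightarrow> 'a" where
    "J Z u = exp (- l * u) *\<^sub>R (x0 + integral {0..u} (\<lambda>r. f r (exp (l * r) *\<^sub>R apply_bcontfun Z r)))" for Z u
  have fc: "continuous_on {0..T} (\<lambda>r. f r (exp (l * r) *\<^sub>R apply_bcontfun Z r))" for Z
    by (intro cont continuous_intros) auto
  have Jc: "continuous_on {0..T} (J Z)" for Z
    unfolding J_def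
    by (intro continuous_intros indefinite_integral_continuous_1 integrable_continuous_real fc)
  have mem: "(\<lambda>s. J Z (c s)) \<in> bcontfun" for Z
  proof -
    have "continuous_on UNIV (\<lambda>s. J Z (c s))"
      by (rule continuous_on_compose2[OF Jc cc]) (use c in auto)
    moreover have "bounded (J Z ` {0..T})"
      by (intro compact_imp_bounded compact_continuous_image Jc) auto
    then have "bounded (range (\<lambda>s. J Z (c s)))" by (rule bounded_subset) (use c in auto)
    ultimately show ?thesis by (simp add: bcontfun_def)
  qed
  define G where "G Z = Bcontfun (\<lambda>s. J Z (c s))" for Z
  have G: "apply_bcontfun (G Z) s = J Z (c s)" for Z s
    unfolding G_def using mem by (simp add: Bcontfun_inverse)
  have "dist (G Z) (G Z') \<le> 1 / 2 * dist Z Z'" for Z Z'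
  proof (rule dist_bound)
    fix s
    define u where "u = c s"
    have u: "0 \<le> u" "u \<le> T" using c[of s] by (auto simp: u_def)
    have i: "(\<lambda>r. f r (exp (l * r) *\<^sub>R apply_bcontfun Z r)) integrable_on {0..u}" for Z
      using u by (intro integrable_continuous_real continuous_on_subset[OF fc]) auto
    have ei: "((\<lambda>r. L * dist Z Z' * exp (l * r)) has_integral L * dist Z Z' * exp (l * u) / l - L * dist Z Z' * exp (l * 0) / l) {0..u}"
      using l u
      by (intro fundamental_theorem_of_calculus)
         (auto intro!: derivative_eq_intros simp: has_real_derivative_iff_has_vector_derivative[symmetric])
    have "dist (J Z u) (J Z' u) = exp (- l * u) * norm (integral {0..u} (\<lambda>r. f r (exp (l * r) *\<^sub>R apply_bcontfun Z r) - f r (exp (l * r) *\<^sub>R apply_bcontfun Z' r)))"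
      unfolding J_def dist_norm by (simp add: Henstock_Kurzweil_Integration.integral_diff[OF i i] scaleR_diff_right[symmetric])
    also have "norm (integral {0..u} (\<lambda>r. f r (exp (l * r) *\<^sub>R apply_bcontfun Z r) - f r (exp (l * r) *\<^sub>R apply_bcontfun Z' r)))
      \<le> integral {0..u} (\<lambda>r. L * dist Z Z' * exp (l * r))"
    proof (rule Henstock_Kurzweil_Integration.integral_norm_bound_integral)
      show "(\<lambda>r. L * dist Z Z' * exp (l * r)) integrable_on {0..u}" using ei by (rule has_integral_integrable)
      fix r assume r: "r \<in> {0..u}"
      have "norm (f r (exp (l * r) *\<^sub>R apply_bcontfun Z r) - f r (exp (l * r) *\<^sub>R apply_bcontfun Z' r))
        \<le> L * norm (exp (l * r) *\<^sub>R apply_bcontfun Z r - exp (l * r) *\<^sub>R apply_bcontfun Z' r)"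
        using r u by (intro lip) auto
      also have "\<dots> = L * (exp (l * r) * dist (apply_bcontfun Z r) (apply_bcontfun Z' r))"
        by (simp add: dist_norm scaleR_diff_right[symmetric])
      also have "\<dots> \<le> L * (exp (l * r) * dist Z Z')"
        using L by (intro mult_left_mono dist_bounded) auto
      finally show "norm (f r (exp (l * r) *\<^sub>R apply_bcontfun Z r) - f r (exp (l * r) *\<^sub>R apply_bcontfun Z' r)) \<le> L * dist Z Z' * exp (l * r)"
        by (simp add: mult_ac)
    qed (use i in \<open>auto intro: integrable_diff\<close>)
    also have "\<dots> = L * dist Z Z' * exp (l * u) / l - L * dist Z Z' * exp (l * 0) / l"
      using ei by (rule integral_unique)
    also have "\<dots> \<le> L * dist Z Z' * exp (l * u) / l" using l L by simp
    finally have "dist (J Z u) (J Z' u) \<le> exp (- l * u) * (L * dist Z Z' * exp (l * u) / l)" by simp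
    also have "\<dots> = (L / l) * dist Z Z'" by (simp add: exp_minus field_simps)
    also have "\<dots> \<le> 1 / 2 * dist Z Z'" using l by (intro mult_right_mono) (auto simp: field_simps)
    finally show "dist (apply_bcontfun (G Z) s) (apply_bcontfun (G Z') s) \<le> 1 / 2 * dist Z Z'"
      unfolding G u_def .
  qed
  then obtain Z where Z: "G Z = Z" using banach_fix_type[of "1 / 2" G] by auto
  define X where "X s = exp (l * s) *\<^sub>R apply_bcontfun Z s" for s
  have X: "X s = x0 + integral {0..s} (\<lambda>r. f r (X r))" if "s \<in> {0..T}" for s
  proof -
    have "apply_bcontfun Z s = J Z s" using G[of Z s] cid[OF that] Z by simp
    then show ?thesis by (simp add: X_def J_def exp_minus)
  qed
  show ?thesis
  proof (rule that[of X])
    show "X 0 = x0" using X[of 0] T by simp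
    fix s assume s: "s \<in> {0..T}"
    have "continuous_on {0..T} (\<lambda>r. f r (X r))" using fc[of Z] unfolding X_def .
    from integral_has_vector_derivative[OF this s]
    have "((\<lambda>u. x0 + integral {0..u} (\<lambda>r. f r (X r))) has_vector_derivative 0 + f s (X s)) (at s within {0..T})"
      by (intro has_vector_derivative_add) auto
    then show "(X has_vector_derivative f s (X s)) (at s within {0..T})"
      using has_vector_derivative_transform[OF s X] by simp
  qed
qed

section \<open>Solvability of the adaptive observer\<close>

lemma linear_ode2_exists:
  fixes a11 a12 a21 a22 b1 b2 :: "real \<Rightarrow> real"
  assumes c: "continuous_on {0..T} a11" "continuous_on {0..T} a12" "continuous_on {0..T} a21"
    "continuous_on {0..T} a22" "continuous_on {0..T} b1" "continuous_on {0..T} b2" and T: "0 \<le> T"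
  obtains u v where "u 0 = u0" "v 0 = v0"
    "\<And>s. s \<in> {0..T} \<Longrightarrow> (u has_real_derivative a11 s * u s + a12 s * v s + b1 s) (at s within {0..T})"
    "\<And>s. s \<in> {0..T} \<Longrightarrow> (v has_real_derivative a21 s * u s + a22 s * v s + b2 s) (at s within {0..T})"
proof -
  define f where "f s X = (a11 s * fst X + a12 s * snd X + b1 s, a21 s * fst X + a22 s * snd X + b2 s)"
    for s and X :: "real \<times> real"
  have "\<exists>K. \<forall>s\<in>{0..T}. \<bar>g s\<bar> \<le> K" if "continuous_on {0..T} g" for g :: "real \<Rightarrow> real"
  proof -
    have "bounded (g ` {0..T})" using that by (intro compact_imp_bounded compact_continuous_image) auto
    then show ?thesis unfolding bounded_iff by auto
  qed
  then obtain K11 K12 K21 K22 where K: "\<And>s. s \<in> {0..T} \<Longrightarrow> \<bar>a11 s\<bar> \<le> K11" "\<And>s. s \<in> {0..T} \<Longrightarrow> \<bar>a12 s\<bar> \<le> K12"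
    "\<And>s. s \<in> {0..T} \<Longrightarrow> \<bar>a21 s\<bar> \<le> K21" "\<And>s. s \<in> {0..T} \<Longrightarrow> \<bar>a22 s\<bar> \<le> K22"
    using c(1-4) by metis
  define L where "L = K11 + K12 + K21 + K22"
  have T0: "0 \<in> {0..T}" using T by simp
  have L: "0 \<le> L" using K[OF T0] unfolding L_def by linarith
  obtain X where X: "X 0 = (u0, v0)" "\<And>s. s \<in> {0..T} \<Longrightarrow> (X has_vector_derivative f s (X s)) (at s within {0..T})"
  proof (rule lipschitz_ode_exists[of T f L "(u0, v0)"])
    fix X :: "real \<Rightarrow> real \<times> real" assume "continuous_on {0..T} X"
    then show "continuous_on {0..T} (\<lambda>s. f s (X s))"
      unfolding f_def using c by (intro continuous_intros)
  next
    fix s and x y :: "real \<times> real" assume s: "s \<in> {0..T}"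
    have n: "\<bar>fst (x - y)\<bar> \<le> norm (x - y)" "\<bar>snd (x - y)\<bar> \<le> norm (x - y)"
      using norm_fst_le[of "fst (x - y)" "snd (x - y)"] norm_snd_le[of "snd (x - y)" "fst (x - y)"]
      by (simp_all only: prod.collapse real_norm_def)
    have "f s x - f s y = (a11 s * fst (x - y) + a12 s * snd (x - y), a21 s * fst (x - y) + a22 s * snd (x - y))"
      by (simp add: f_def algebra_simps)
    then have "norm (f s x - f s y) \<le> \<bar>a11 s * fst (x - y) + a12 s * snd (x - y)\<bar> + \<bar>a21 s * fst (x - y) + a22 s * snd (x - y)\<bar>"
      using norm_Pair_le[of "a11 s * fst (x - y) + a12 s * snd (x - y)" "a21 s * fst (x - y) + a22 s * snd (x - y)"] by simp
    also have "\<dots> \<le> (\<bar>a11 s\<bar> * \<bar>fst (x - y)\<bar> + \<bar>a12 s\<bar> * \<bar>snd (x - y)\<bar>) + (\<bar>a21 s\<bar> * \<bar>fst (x - y)\<bar> + \<bar>a22 s\<bar> * \<bar>snd (x - y)\<bar>)"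
      unfolding abs_mult[symmetric] by (intro add_mono abs_triangle_ineq)
    also have "\<dots> \<le> (K11 * norm (x - y) + K12 * norm (x - y)) + (K21 * norm (x - y) + K22 * norm (x - y))"
      using K[OF s] n by (intro add_mono mult_mono) (auto intro: order_trans[OF abs_ge_zero])
    finally show "norm (f s x - f s y) \<le> L * norm (x - y)" by (simp add: L_def algebra_simps)
  qed (use L T that in auto)
  show ?thesis
  proof (rule that[of "\<lambda>s. fst (X s)" "\<lambda>s. snd (X s)"])
    fix s assume s: "s \<in> {0..T}"
    show "((\<lambda>s. fst (X s)) has_real_derivative a11 s * fst (X s) + a12 s * snd (X s) + b1 s) (at s within {0..T})"
      using bounded_linear.has_vector_derivative[OF bounded_linear_fst X(2)[OF s]]
      by (simp add: f_def has_real_derivative_iff_has_vector_derivative)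
    show "((\<lambda>s. snd (X s)) has_real_derivative a21 s * fst (X s) + a22 s * snd (X s) + b2 s) (at s within {0..T})"
      using bounded_linear.has_vector_derivative[OF bounded_linear_snd X(2)[OF s]]
      by (simp add: f_def has_real_derivative_iff_has_vector_derivative)
  qed (use X in auto)
qed

text \<open>The observer is a cascade: \<open>\<xi>\<close> and \<open>\<phi>\<close> are driven by
  \<open>y\<close> alone, and once \<open>\<xi>\<close> is known the product of
  \<open>\<theta>h\<close> and \<open>\<xi>\<close> is linear, so \<open>chi\<close> and
  \<open>\<theta>h\<close> solve a linear system with continuous coefficients.\<close>

lemma adaptive_observer_exists:
  assumes y: "continuous_on {0..T} y" and T: "0 \<le> T"
  obtains \<xi> chi \<phi> \<theta>h where "adaptive_observer \<iota> k0 k1 T y \<xi> chi \<phi> \<theta>h"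
    "\<xi> 0 = \<xi>0" "chi 0 = chi0" "\<phi> 0 = \<phi>0" "\<theta>h 0 = \<theta>h0"
proof -
  obtain \<xi> \<phi> where 1: "\<xi> 0 = \<xi>0" "\<phi> 0 = \<phi>0"
    "\<And>s. s \<in> {0..T} \<Longrightarrow> (\<xi> has_real_derivative - \<iota> * \<xi> s + 0 * \<phi> s + - y s) (at s within {0..T})"
    "\<And>s. s \<in> {0..T} \<Longrightarrow> (\<phi> has_real_derivative 0 * \<xi> s + - \<iota> * \<phi> s + - (\<iota>\<^sup>2 * y s)) (at s within {0..T})"
    by (rule linear_ode2_exists[of T "\<lambda>_. - \<iota>" "\<lambda>_. 0" "\<lambda>_. 0" "\<lambda>_. - \<iota>" "\<lambda>s. - y s" "\<lambda>s. - (\<iota>\<^sup>2 * y s)" \<xi>0 \<phi>0])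
       (use y T in \<open>auto intro!: continuous_intros\<close>)
  have c: "continuous_on {0..T} \<xi>" "continuous_on {0..T} \<phi>"
    by (rule DERIV_continuous_on, erule 1)+
  obtain chi \<theta>h where 2: "chi 0 = chi0" "\<theta>h 0 = \<theta>h0"
    "\<And>s. s \<in> {0..T} \<Longrightarrow> (chi has_real_derivative - k0 * chi s + \<xi> s * \<theta>h s + (\<phi> s + \<iota> * y s + k0 * y s)) (at s within {0..T})"
    "\<And>s. s \<in> {0..T} \<Longrightarrow> (\<theta>h has_real_derivative - (k1 * \<xi> s) * chi s + 0 * \<theta>h s + k1 * \<xi> s * y s) (at s within {0..T})"
    by (rule linear_ode2_exists[of T "\<lambda>_. - k0" \<xi> "\<lambda>s. - (k1 * \<xi> s)" "\<lambda>_. 0" "\<lambda>s. \<phi> s + \<iota> * y s + k0 * y s" "\<lambda>s. k1 * \<xi> s * y s" chi0 \<theta>h0])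
       (use y T c in \<open>auto intro!: continuous_intros\<close>)
  show ?thesis
  proof (rule that[of \<xi> chi \<phi> \<theta>h])
    show "adaptive_observer \<iota> k0 k1 T y \<xi> chi \<phi> \<theta>h"
      unfolding adaptive_observer_def
    proof (intro ballI conjI)
      fix s assume s: "s \<in> {0..T}"
      show "(\<xi> has_real_derivative - \<iota> * \<xi> s - y s) (at s within {0..T})" using 1(3)[OF s] by simp
      show "(\<phi> has_real_derivative - \<iota> * \<phi> s - \<iota>\<^sup>2 * y s) (at s within {0..T})" using 1(4)[OF s] by simp
      show "(chi has_real_derivative \<phi> s + \<iota> * y s + \<theta>h s * \<xi> s + k0 * (y s - chi s)) (at s within {0..T})"
        using 2(3)[OF s] by (simp add: algebra_simps)
      show "(\<theta>h has_real_derivative k1 * \<xi> s * (y s - chi s)) (at s within {0..T})"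
        using 2(4)[OF s] by (simp add: algebra_simps)
    qed
  qed (use 1 2 in auto)
qed

text \<open>Follows the same cascade with energies. In
  \<open>k1 * (chi - chi')^2 + (\<theta>h - \<theta>h')^2\<close> the weight \<open>k1\<close>
  cancels the mixed terms, so this energy is nonincreasing.\<close>

lemma adaptive_observer_unique:
  assumes "adaptive_observer \<iota> k0 k1 T y \<xi> chi \<phi> \<theta>h" "adaptive_observer \<iota> k0 k1 T y' \<xi>' chi' \<phi>' \<theta>h'"
    and yy: "\<And>s. s \<in> {0..T} \<Longrightarrow> y s = y' s"
    and i: "\<xi> 0 = \<xi>' 0" "chi 0 = chi' 0" "\<phi> 0 = \<phi>' 0" "\<theta>h 0 = \<theta>h' 0"
    and k: "0 \<le> \<iota>" "0 \<le> k0" "0 < k1" and s: "s \<in> {0..T}"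
  shows "\<xi> s = \<xi>' s" "chi s = chi' s" "\<phi> s = \<phi>' s" "\<theta>h s = \<theta>h' s"
proof -
  note o1 = assms(1)[unfolded adaptive_observer_def, rule_format]
  note o2 = assms(2)[unfolded adaptive_observer_def, rule_format]
  have \<xi>: "\<xi> s = \<xi>' s" if s: "s \<in> {0..T}" for s
  proof -
    have "(\<xi> s - \<xi>' s)\<^sup>2 \<le> (\<xi> 0 - \<xi>' 0)\<^sup>2"
    proof (rule nonincreasing_on_Icc[where V = "\<lambda>s. (\<xi> s - \<xi>' s)\<^sup>2" and V' = "\<lambda>s. - 2 * \<iota> * (\<xi> s - \<xi>' s)\<^sup>2", OF _ _ s])
      fix r assume r: "r \<in> {0..T}"
      show "((\<lambda>s. (\<xi> s - \<xi>' s)\<^sup>2) has_real_derivative - 2 * \<iota> * (\<xi> r - \<xi>' r)\<^sup>2) (at r within {0..T})"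
        using o1[OF r] o2[OF r] yy[OF r]
        by (auto intro!: derivative_eq_intros simp: power2_eq_square algebra_simps)
    qed (use k in auto)
    then show ?thesis using i by simp
  qed
  have \<phi>: "\<phi> s = \<phi>' s" if s: "s \<in> {0..T}" for s
  proof -
    have "(\<phi> s - \<phi>' s)\<^sup>2 \<le> (\<phi> 0 - \<phi>' 0)\<^sup>2"
    proof (rule nonincreasing_on_Icc[where V = "\<lambda>s. (\<phi> s - \<phi>' s)\<^sup>2" and V' = "\<lambda>s. - 2 * \<iota> * (\<phi> s - \<phi>' s)\<^sup>2", OF _ _ s])
      fix r assume r: "r \<in> {0..T}"
      show "((\<lambda>s. (\<phi> s - \<phi>' s)\<^sup>2) has_real_derivative - 2 * \<iota> * (\<phi> r - \<phi>' r)\<^sup>2) (at r within {0..T})"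
        using o1[OF r] o2[OF r] yy[OF r]
        by (auto intro!: derivative_eq_intros simp: power2_eq_square algebra_simps)
    qed (use k in auto)
    then show ?thesis using i by simp
  qed
  have "k1 * (chi s - chi' s)\<^sup>2 + (\<theta>h s - \<theta>h' s)\<^sup>2 \<le> k1 * (chi 0 - chi' 0)\<^sup>2 + (\<theta>h 0 - \<theta>h' 0)\<^sup>2"
  proof (rule nonincreasing_on_Icc[where V = "\<lambda>s. k1 * (chi s - chi' s)\<^sup>2 + (\<theta>h s - \<theta>h' s)\<^sup>2"
        and V' = "\<lambda>s. - 2 * k0 * k1 * (chi s - chi' s)\<^sup>2", OF _ _ s])
    fix r assume r: "r \<in> {0..T}"
    show "((\<lambda>s. k1 * (chi s - chi' s)\<^sup>2 + (\<theta>h s - \<theta>h' s)\<^sup>2) has_real_derivative - 2 * k0 * k1 * (chi r - chi' r)\<^sup>2) (at r within {0..T})"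
      using o1[OF r] o2[OF r] yy[OF r] \<xi>[OF r] \<phi>[OF r]
      by (auto intro!: derivative_eq_intros simp: power2_eq_square algebra_simps)
  qed (use k in auto)
  then have "k1 * (chi s - chi' s)\<^sup>2 + (\<theta>h s - \<theta>h' s)\<^sup>2 \<le> 0" using i by simp
  moreover have "0 \<le> k1 * (chi s - chi' s)\<^sup>2" "0 \<le> (\<theta>h s - \<theta>h' s)\<^sup>2" using k by auto
  ultimately have "k1 * (chi s - chi' s)\<^sup>2 = 0" "(\<theta>h s - \<theta>h' s)\<^sup>2 = 0" by linarith+
  then show "chi s = chi' s" "\<theta>h s = \<theta>h' s" using k by auto
  show "\<xi> s = \<xi>' s" "\<phi> s = \<phi>' s" using \<xi> \<phi> s by auto
qed

section \<open>Decay under exponentially small perturbations\<close>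

lemma linear_decay:
  fixes u g :: "real \<Rightarrow> real"
  assumes u: "\<And>s. s \<in> {0..T} \<Longrightarrow> (u has_real_derivative - \<iota> * u s + g s) (at s within {0..T})"
    and g: "\<And>s. s \<in> {0..T} \<Longrightarrow> \<bar>g s\<bar> \<le> C * exp (- \<mu> * s)"
    and \<mu>: "\<mu> < \<iota>" and C: "0 \<le> C" and s: "s \<in> {0..T}"
  shows "\<bar>u s\<bar> \<le> (\<bar>u 0\<bar> + C / (\<iota> - \<mu>)) * exp (- \<mu> * s)"
proof -
  define D where "D = C / (\<iota> - \<mu>)"
  have D: "0 \<le> D" "D * (\<iota> - \<mu>) = C" using \<mu> C by (auto simp: D_def)
  have key: "e * u s \<le> (\<bar>u 0\<bar> + D) * exp (- \<mu> * s)" if e: "\<bar>e\<bar> = 1" for e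
  proof -
    \<comment> \<open>Variation of constants as monotonicity:
      \<open>D * exp ((\<iota> - \<mu>) * s)\<close> is a primitive of the bound on the forcing
      times \<open>exp (\<iota> * s)\<close>, and \<open>e\<close> stands for either sign.\<close>
    have "e * u s * exp (\<iota> * s) - D * exp ((\<iota> - \<mu>) * s) \<le> e * u 0 * exp (\<iota> * 0) - D * exp ((\<iota> - \<mu>) * 0)"
    proof (rule nonincreasing_on_Icc[where V = "\<lambda>s. e * u s * exp (\<iota> * s) - D * exp ((\<iota> - \<mu>) * s)"
          and V' = "\<lambda>s. exp (\<iota> * s) * (e * g s - C * exp (- \<mu> * s))", OF _ _ s])
      fix r assume r: "r \<in> {0..T}"
      have ex: "exp (\<iota> * r) * exp (- \<mu> * r) = exp ((\<iota> - \<mu>) * r)"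
        by (simp add: exp_add[symmetric] algebra_simps)
      have "((\<lambda>s. e * u s * exp (\<iota> * s) - D * exp ((\<iota> - \<mu>) * s)) has_real_derivative
          exp (\<iota> * r) * (e * g r) - D * (\<iota> - \<mu>) * exp ((\<iota> - \<mu>) * r)) (at r within {0..T})"
        using u[OF r] by (auto intro!: derivative_eq_intros simp: algebra_simps)
      then show "((\<lambda>s. e * u s * exp (\<iota> * s) - D * exp ((\<iota> - \<mu>) * s)) has_real_derivative
          exp (\<iota> * r) * (e * g r - C * exp (- \<mu> * r))) (at r within {0..T})"
        unfolding D(2) ex[symmetric] by (simp add: algebra_simps)
      have "e * g r \<le> \<bar>g r\<bar>" using e abs_ge_self[of "e * g r"] by (simp add: abs_mult)
      then show "exp (\<iota> * r) * (e * g r - C * exp (- \<mu> * r)) \<le> 0"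
        using g[OF r] by (intro mult_nonneg_nonpos) auto
    qed
    then have "e * u s * exp (\<iota> * s) \<le> e * u 0 - D + D * exp ((\<iota> - \<mu>) * s)" by simp
    also have "e * u 0 \<le> \<bar>u 0\<bar>" using e abs_ge_self[of "e * u 0"] by (simp add: abs_mult)
    also have "\<bar>u 0\<bar> - D + D * exp ((\<iota> - \<mu>) * s) \<le> \<bar>u 0\<bar> * 1 + D * exp ((\<iota> - \<mu>) * s)" using D by simp
    also have "\<dots> \<le> \<bar>u 0\<bar> * exp ((\<iota> - \<mu>) * s) + D * exp ((\<iota> - \<mu>) * s)"
      using s \<mu> by (intro add_right_mono mult_left_mono) auto
    finally have "e * u s * exp (\<iota> * s) \<le> (\<bar>u 0\<bar> + D) * exp ((\<iota> - \<mu>) * s)" by (simp add: distrib_right)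
    then have "e * u s * exp (\<iota> * s) * exp (- \<iota> * s) \<le> (\<bar>u 0\<bar> + D) * exp ((\<iota> - \<mu>) * s) * exp (- \<iota> * s)"
      by (rule mult_right_mono) simp
    then show ?thesis by (simp add: mult.assoc exp_add[symmetric] algebra_simps)
  qed
  show ?thesis using key[of 1] key[of "- 1"] unfolding D_def by auto
qed

text \<open>The weight \<open>exp ((C / \<mu>) exp (- \<mu> s))\<close> absorbs the decaying coefficient.\<close>

lemma perturbed_decay:
  fixes V :: "real \<Rightarrow> real"
  assumes V: "\<And>s. s \<in> {0..T} \<Longrightarrow> (V has_real_derivative V' s) (at s within {0..T})"
    and V': "\<And>s. s \<in> {0..T} \<Longrightarrow> V' s \<le> - c * V s + C * exp (- \<mu> * s) * (V s + 1)"
    and pos: "\<And>s. s \<in> {0..T} \<Longrightarrow> 0 \<le> V s" and \<mu>: "0 < \<mu>" and C: "0 \<le> C"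
    and \<mu>': "\<mu>' \<le> c" "\<mu>' \<le> \<mu> / 2" and s: "s \<in> {0..T}"
  shows "V s \<le> (V 0 + 2 * C / \<mu>) * exp (C / \<mu>) * exp (- \<mu>' * s)"
proof -
  \<comment> \<open>Adding \<open>N * exp (- \<mu> * s)\<close> to \<open>V\<close> absorbs the
    inhomogeneous term. This takes \<open>N * (\<mu> - \<mu>') \<ge> C\<close>, and
    \<open>\<mu>' \<le> \<mu> / 2\<close> explains the factor 2.\<close>
  define N where "N = 2 * C / \<mu>"
  define D where "D = C / \<mu>"
  have N: "0 \<le> N" "N * (\<mu> / 2) = C" and D: "0 \<le> D" "D * \<mu> = C" using \<mu> C by (auto simp: N_def D_def)
  let ?\<delta> = "\<lambda>s. exp (- \<mu> * s)"
  let ?U = "\<lambda>s. (V s + N * ?\<delta> s) * exp (D * ?\<delta> s + \<mu>' * s)"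
  let ?U' = "\<lambda>s. (V' s - N * \<mu> * ?\<delta> s + (V s + N * ?\<delta> s) * (\<mu>' - C * ?\<delta> s)) * exp (D * ?\<delta> s + \<mu>' * s)"
  have "?U s \<le> ?U 0"
  proof (rule nonincreasing_on_Icc[where V = ?U and V' = ?U', OF _ _ s])
    fix r assume r: "r \<in> {0..T}"
    show "(?U has_real_derivative ?U' r) (at r within {0..T})"
      unfolding D(2)[symmetric]
      using V[OF r] by (auto intro!: derivative_eq_intros simp: algebra_simps)
    have "N * (\<mu> / 2) \<le> N * (\<mu> - \<mu>')" using N(1) \<mu>' by (intro mult_left_mono) auto
    then have a: "(C - N * (\<mu> - \<mu>')) * ?\<delta> r \<le> 0" using N(2) by (intro mult_nonpos_nonneg) auto
    have b: "(\<mu>' - c) * V r \<le> 0" using \<mu>' pos[OF r] by (intro mult_nonpos_nonneg) auto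
    have d: "0 \<le> N * C * (?\<delta> r * ?\<delta> r)" using N(1) C by simp
    have "V' r - N * \<mu> * ?\<delta> r + (V r + N * ?\<delta> r) * (\<mu>' - C * ?\<delta> r)
      \<le> - c * V r + C * ?\<delta> r * (V r + 1) - N * \<mu> * ?\<delta> r + (V r + N * ?\<delta> r) * (\<mu>' - C * ?\<delta> r)"
      using V'[OF r] by simp
    also have "\<dots> = (\<mu>' - c) * V r + (C - N * (\<mu> - \<mu>')) * ?\<delta> r - N * C * (?\<delta> r * ?\<delta> r)"
      by (simp add: algebra_simps)
    also have "\<dots> \<le> 0" using a b d by linarith
    finally show "?U' r \<le> 0" by (intro mult_nonpos_nonneg) auto
  qed
  then have U: "(V s + N * ?\<delta> s) * exp (D * ?\<delta> s + \<mu>' * s) \<le> (V 0 + N) * exp D" by simp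
  have "V s * exp (\<mu>' * s) \<le> (V s + N * ?\<delta> s) * exp (D * ?\<delta> s + \<mu>' * s)"
    using pos[OF s] N D by (intro mult_mono) auto
  then have "V s * exp (\<mu>' * s) \<le> (V 0 + N) * exp D" using U by linarith
  then have "V s * exp (\<mu>' * s) * exp (- \<mu>' * s) \<le> (V 0 + N) * exp D * exp (- \<mu>' * s)"
    by (rule mult_right_mono) simp
  then show ?thesis by (simp add: N_def D_def mult.assoc exp_add[symmetric])
qed

text \<open>Rate of \<open>V = K (k1 x\<^sup>2 + p\<^sup>2) - \<sigma> x p - (\<sigma> \<rho> / (2 \<omega>)) p\<^sup>2\<close> along \<open>x' = - k0 x + \<sigma> p + u\<close>,
  \<open>p' = - k1 \<sigma> x + v\<close>, \<open>\<sigma>' = \<omega> \<rho>\<close>, \<open>\<rho>' = - \<omega> \<sigma>\<close>.  The cross term produces \<open>- \<sigma>\<^sup>2 p\<^sup>2\<close>, and the last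
  term averages it over a period to \<open>- (R / 2) p\<^sup>2\<close>.\<close>

lemma lyapunov_rate:
  fixes x p u v \<sigma> \<rho> k0 k1 \<omega> K S R B E Q \<epsilon> :: real
  assumes pos: "0 < k0" "0 < k1" "0 < \<omega>" "0 \<le> K" "0 < R" "0 \<le> E" "0 \<le> \<epsilon>"
    and R: "\<sigma>\<^sup>2 + \<rho>\<^sup>2 = R" and S: "\<bar>\<sigma>\<bar> \<le> S" "\<bar>\<sigma> * \<rho>\<bar> \<le> R"
    and B: "\<bar>- \<omega> * \<rho> + k0 * \<sigma> + k1 * \<sigma>\<^sup>2 * \<rho> / \<omega>\<bar> \<le> B"
    and K: "k1 * R + B\<^sup>2 / R + R / 4 \<le> 2 * K * k0 * k1"
    and u: "\<bar>u\<bar> \<le> E * \<epsilon> * (\<bar>p\<bar> + 1)" and v: "\<bar>v\<bar> \<le> E * \<epsilon> * (\<bar>x\<bar> + 1)"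
    and Q: "Q = 2 * K * k1 + 2 * K + S + R / \<omega>"
  shows "2 * K * (k1 * x * (- k0 * x + \<sigma> * p + u) + p * (- k1 * \<sigma> * x + v))
      - (\<omega> * \<rho> * x * p + \<sigma> * (- k0 * x + \<sigma> * p + u) * p + \<sigma> * x * (- k1 * \<sigma> * x + v))
      - ((\<rho>\<^sup>2 - \<sigma>\<^sup>2) / 2 * p\<^sup>2 + \<sigma> * \<rho> / \<omega> * p * (- k1 * \<sigma> * x + v))
    \<le> - (R / 4) * (x\<^sup>2 + p\<^sup>2) + 4 * (Q * E) * \<epsilon> * (x\<^sup>2 + p\<^sup>2 + 1)" (is "?L \<le> _")
proof -
  \<comment> \<open>Collects the coefficients of \<open>x * p\<close>: the motion of
    \<open>\<sigma>\<close>, the damping \<open>k0\<close>, and the coupling of \<open>p\<close> to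
    \<open>x\<close> in the averaging term.\<close>
  define b where "b = - \<omega> * \<rho> + k0 * \<sigma> + k1 * \<sigma>\<^sup>2 * \<rho> / \<omega>"
  have L: "?L = (- 2 * K * k0 * k1 + k1 * \<sigma>\<^sup>2) * x\<^sup>2 + x * p * b - ((\<sigma>\<^sup>2 + \<rho>\<^sup>2) / 2) * p\<^sup>2
     + ((2 * K * k1 * x - \<sigma> * p) * u + (2 * K * p - \<sigma> * x - \<sigma> * \<rho> / \<omega> * p) * v)"
    using pos(3) unfolding b_def by (simp add: power2_eq_square field_simps)
  have "x * p * b \<le> \<bar>x\<bar> * \<bar>p\<bar> * B"
  proof -
    have "x * p * b \<le> \<bar>x * p * b\<bar>" by simp
    also have "\<dots> = \<bar>x\<bar> * \<bar>p\<bar> * \<bar>b\<bar>" by (simp add: abs_mult)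
    also have "\<dots> \<le> \<bar>x\<bar> * \<bar>p\<bar> * B" using B unfolding b_def by (intro mult_left_mono) auto
    finally show ?thesis .
  qed
  \<comment> \<open>Young's inequality with weight \<open>R / 4\<close> on \<open>p^2\<close>: of
    the available \<open>- (R / 2) * p^2\<close> one half survives.\<close>
  moreover have "\<bar>x\<bar> * \<bar>p\<bar> * B \<le> R / 4 * p\<^sup>2 + B\<^sup>2 / R * x\<^sup>2"
  proof -
    have "0 \<le> (R / 2 * \<bar>p\<bar> - B * \<bar>x\<bar>)\<^sup>2 / R" using pos by simp
    also have "\<dots> = R / 4 * p\<^sup>2 + B\<^sup>2 / R * x\<^sup>2 - \<bar>x\<bar> * \<bar>p\<bar> * B"
      using pos by (simp add: power2_diff power_mult_distrib power2_eq_square field_simps)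
    finally show ?thesis by simp
  qed
  moreover have "(- 2 * K * k0 * k1 + k1 * \<sigma>\<^sup>2) * x\<^sup>2 \<le> (- (B\<^sup>2 / R) - R / 4) * x\<^sup>2"
  proof (rule mult_right_mono)
    have "k1 * \<sigma>\<^sup>2 \<le> k1 * R" using R pos by (intro mult_left_mono) (auto simp: R[symmetric])
    then show "- 2 * K * k0 * k1 + k1 * \<sigma>\<^sup>2 \<le> - (B\<^sup>2 / R) - R / 4" using K by simp
  qed simp
  ultimately have main: "(- 2 * K * k0 * k1 + k1 * \<sigma>\<^sup>2) * x\<^sup>2 + x * p * b - ((\<sigma>\<^sup>2 + \<rho>\<^sup>2) / 2) * p\<^sup>2
      \<le> - (R / 4) * (x\<^sup>2 + p\<^sup>2)"
    unfolding R by (simp add: algebra_simps)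
  define m where "m = \<bar>x\<bar> + \<bar>p\<bar>"
  have m0: "0 \<le> m" by (simp add: m_def)
  have S0: "0 \<le> S" using S by linarith
  have nn: "0 \<le> K * k1" "0 \<le> R / \<omega>" using pos by auto
  have SQ: "S \<le> Q" "2 * K * k1 \<le> Q" "2 * K + R / \<omega> \<le> Q"
    unfolding Q using nn pos S0 by linarith+
  have Q0: "0 \<le> Q" using SQ S0 by linarith
  have \<sigma>Q: "\<bar>\<sigma>\<bar> \<le> Q" using S SQ by linarith
  have c1: "\<bar>2 * K * k1 * x - \<sigma> * p\<bar> \<le> Q * m"
  proof -
    have "\<bar>2 * K * k1 * x - \<sigma> * p\<bar> \<le> \<bar>2 * K * k1 * x\<bar> + \<bar>\<sigma> * p\<bar>" by (rule abs_triangle_ineq4)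
    also have "\<dots> = 2 * K * k1 * \<bar>x\<bar> + \<bar>\<sigma>\<bar> * \<bar>p\<bar>" using pos by (simp add: abs_mult)
    also have "\<dots> \<le> Q * \<bar>x\<bar> + Q * \<bar>p\<bar>"
      by (intro add_mono mult_right_mono SQ \<sigma>Q) auto
    finally show ?thesis by (simp add: m_def algebra_simps)
  qed
  have c2: "\<bar>2 * K * p - \<sigma> * x - \<sigma> * \<rho> / \<omega> * p\<bar> \<le> Q * m"
  proof -
    have "\<bar>2 * K * p - \<sigma> * x - \<sigma> * \<rho> / \<omega> * p\<bar> \<le> \<bar>2 * K * p\<bar> + \<bar>\<sigma> * x\<bar> + \<bar>\<sigma> * \<rho> / \<omega> * p\<bar>"
      by (intro order_trans[OF abs_triangle_ineq4] add_mono abs_triangle_ineq4 order_refl)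
    also have "\<dots> = 2 * K * \<bar>p\<bar> + \<bar>\<sigma>\<bar> * \<bar>x\<bar> + \<bar>\<sigma> * \<rho>\<bar> / \<omega> * \<bar>p\<bar>" using pos by (simp add: abs_mult)
    also have "\<dots> \<le> 2 * K * \<bar>p\<bar> + Q * \<bar>x\<bar> + R / \<omega> * \<bar>p\<bar>"
      using pos S by (intro add_mono mult_right_mono divide_right_mono \<sigma>Q) auto
    also have "\<dots> = (2 * K + R / \<omega>) * \<bar>p\<bar> + Q * \<bar>x\<bar>" by (simp add: algebra_simps)
    also have "\<dots> \<le> Q * \<bar>p\<bar> + Q * \<bar>x\<bar>"
      by (intro add_mono mult_right_mono SQ) auto
    finally show ?thesis by (simp add: m_def algebra_simps)
  qed
  have "(2 * K * k1 * x - \<sigma> * p) * u + (2 * K * p - \<sigma> * x - \<sigma> * \<rho> / \<omega> * p) * v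
     \<le> \<bar>2 * K * k1 * x - \<sigma> * p\<bar> * \<bar>u\<bar> + \<bar>2 * K * p - \<sigma> * x - \<sigma> * \<rho> / \<omega> * p\<bar> * \<bar>v\<bar>"
    unfolding abs_mult[symmetric] by (intro add_mono abs_ge_self)
  also have "\<dots> \<le> (Q * m) * (E * \<epsilon> * (\<bar>p\<bar> + 1)) + (Q * m) * (E * \<epsilon> * (\<bar>x\<bar> + 1))"
    using c1 c2 u v Q0 m0 by (intro add_mono mult_mono) auto
  also have "\<dots> = (Q * E) * \<epsilon> * (m * (m + 2))" by (simp add: m_def algebra_simps)
  \<comment> \<open>Linear terms are absorbed by \<open>2 * m \<le> m^2 + 1\<close>, which yields
    the shape \<open>V + 1\<close> of the perturbation in \<open>perturbed_decay\<close>.\<close>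
  also have "\<dots> \<le> (Q * E) * \<epsilon> * (4 * (x\<^sup>2 + p\<^sup>2 + 1))"
  proof (rule mult_left_mono)
    have "0 \<le> (m - 1)\<^sup>2" "0 \<le> (\<bar>x\<bar> - \<bar>p\<bar>)\<^sup>2" by auto
    then have "2 * m \<le> m\<^sup>2 + 1" "m\<^sup>2 \<le> 2 * (x\<^sup>2 + p\<^sup>2)"
      by (auto simp: m_def power2_diff power2_sum algebra_simps)
    then show "m * (m + 2) \<le> 4 * (x\<^sup>2 + p\<^sup>2 + 1)" by (simp add: power2_eq_square algebra_simps)
    show "0 \<le> Q * E * \<epsilon>" using Q0 pos by simp
  qed
  finally show ?thesis unfolding L using main by (simp add: algebra_simps)
qed

text \<open>The indefinite terms are at most \<open>S / 2 + R / (2 * \<omega>)\<close> times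
  \<open>x^2 + p^2\<close>, so a large weight \<open>K\<close> dominates them; the summand 1 in the
  condition on \<open>K\<close> normalises the lower bound.\<close>

lemma lyapunov_bounds:
  fixes x p \<sigma> \<rho> K S R k1 \<omega> :: real
  assumes pos: "0 < \<omega>" "0 \<le> K" "0 < k1" "0 \<le> R" and S: "\<bar>\<sigma>\<bar> \<le> S" "\<bar>\<sigma> * \<rho>\<bar> \<le> R"
    and K: "1 + S / 2 + R / (2 * \<omega>) \<le> K * min k1 1"
  defines "V \<equiv> K * (k1 * x\<^sup>2 + p\<^sup>2) - \<sigma> * x * p - \<sigma> * \<rho> / (2 * \<omega>) * p\<^sup>2"
  shows "x\<^sup>2 + p\<^sup>2 \<le> V" "V \<le> (K * (k1 + 1) + S / 2 + R / (2 * \<omega>)) * (x\<^sup>2 + p\<^sup>2)"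
proof -
  define N where "N = x\<^sup>2 + p\<^sup>2"
  have N: "0 \<le> N" "p\<^sup>2 \<le> N" "x\<^sup>2 \<le> N" by (auto simp: N_def)
  have "\<bar>\<sigma> * x * p\<bar> = \<bar>\<sigma>\<bar> * (\<bar>x\<bar> * \<bar>p\<bar>)" by (simp add: abs_mult)
  also have "\<dots> \<le> S * (N / 2)"
  proof (rule mult_mono[OF S(1)])
    have "0 \<le> (\<bar>x\<bar> - \<bar>p\<bar>)\<^sup>2" by simp
    then show "\<bar>x\<bar> * \<bar>p\<bar> \<le> N / 2" by (simp add: N_def power2_diff)
  qed (use S in auto)
  finally have 1: "\<bar>\<sigma> * x * p\<bar> \<le> S / 2 * N" by simp
  have "\<bar>\<sigma> * \<rho> / (2 * \<omega>) * p\<^sup>2\<bar> = \<bar>\<sigma> * \<rho>\<bar> / (2 * \<omega>) * p\<^sup>2" using pos by (simp add: abs_mult)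
  also have "\<dots> \<le> R / (2 * \<omega>) * N"
    using pos S N by (intro mult_mono divide_right_mono) auto
  finally have 2: "\<bar>\<sigma> * \<rho> / (2 * \<omega>) * p\<^sup>2\<bar> \<le> R / (2 * \<omega>) * N" .
  have "min k1 1 * N \<le> k1 * x\<^sup>2 + p\<^sup>2"
    unfolding N_def distrib_left by (intro add_mono mult_right_mono) (auto intro: order_trans[OF mult_right_mono[of _ 1]])
  then have "K * (min k1 1 * N) \<le> K * (k1 * x\<^sup>2 + p\<^sup>2)" using pos by (intro mult_left_mono) auto
  moreover have "(1 + S / 2 + R / (2 * \<omega>)) * N \<le> (K * min k1 1) * N" using K N by (intro mult_right_mono) auto
  ultimately have "N + S / 2 * N + R / (2 * \<omega>) * N \<le> K * (k1 * x\<^sup>2 + p\<^sup>2)"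
    by (simp add: algebra_simps)
  then show "x\<^sup>2 + p\<^sup>2 \<le> V" using 1 2 unfolding V_def N_def[symmetric] by linarith
  have "k1 * x\<^sup>2 + p\<^sup>2 \<le> k1 * N + 1 * N" using N pos by (intro add_mono mult_mono) auto
  then have "K * (k1 * x\<^sup>2 + p\<^sup>2) \<le> K * ((k1 + 1) * N)" using pos by (intro mult_left_mono) (auto simp: algebra_simps)
  then have "V \<le> K * ((k1 + 1) * N) + S / 2 * N + R / (2 * \<omega>) * N" using 1 2 unfolding V_def by linarith
  then show "V \<le> (K * (k1 + 1) + S / 2 + R / (2 * \<omega>)) * (x\<^sup>2 + p\<^sup>2)"
    unfolding N_def[symmetric] by (simp add: algebra_simps)
qed

text \<open>The filter state \<open>\<xi>\<close> converges to the sinusoid \<open>\<sigma>\<close>, and \<open>d\<^sub>2 - \<omega>\<^sup>2 \<xi> - \<iota> d\<^sub>1 - \<phi>\<close> converges to zero.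
  The remaining errors \<open>x = d\<^sub>1 - chi\<close> and \<open>p = \<omega>\<^sup>2 - \<theta>h\<close> obey the system of \<open>lyapunov_rate\<close> with exponentially
  decaying perturbations.\<close>

lemma adaptive_observer_convergence:
  fixes d1 d2 a :: "real \<Rightarrow> real"
  assumes pos: "0 < \<iota>" "0 < k0" "0 < k1" "0 < \<omega>" "0 < \<mu>" "\<mu> < \<iota>" "0 \<le> Ma"
    and d1: "\<And>s. 0 \<le> s \<Longrightarrow> (d1 has_real_derivative d2 s) (at s within {0..})"
    and d2: "\<And>s. 0 \<le> s \<Longrightarrow> (d2 has_real_derivative - \<omega>\<^sup>2 * d1 s) (at s within {0..})"
    and nz: "d1 0 \<noteq> 0 \<or> d2 0 \<noteq> 0"
    and a: "\<And>s. 0 \<le> s \<Longrightarrow> \<bar>a s\<bar> \<le> Ma * exp (- \<mu> * s)"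
  obtains M \<mu>' where "0 \<le> M" "0 < \<mu>'" "\<mu>' \<le> \<mu>"
    "\<And>T \<xi> chi \<phi> \<theta>h s. \<lbrakk>adaptive_observer \<iota> k0 k1 T (\<lambda>s. d1 s + a s) \<xi> chi \<phi> \<theta>h;
        \<xi> 0 = \<xi>0; chi 0 = chi0; \<phi> 0 = \<phi>0; \<theta>h 0 = \<theta>h0; s \<in> {0..T}\<rbrakk> \<Longrightarrow>
      \<bar>d1 s - chi s\<bar> \<le> M * exp (- \<mu>' * s) \<and> \<bar>\<omega>\<^sup>2 - \<theta>h s\<bar> \<le> M * exp (- \<mu>' * s) \<and>
      \<bar>d2 s - (\<phi> s + \<xi> s * \<theta>h s + \<iota> * chi s)\<bar> \<le> M * exp (- \<mu>' * s)"
proof -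
  define \<beta> where "\<beta> = 1 / (\<iota>\<^sup>2 + \<omega>\<^sup>2)"
  have \<beta>: "0 < \<beta>" "\<beta> * (\<iota>\<^sup>2 + \<omega>\<^sup>2) = 1" using pos by (auto simp: \<beta>_def add_pos_pos)
  \<comment> \<open>The sinusoidal solution of \<open>\<xi>' = - \<iota> * \<xi> - d1\<close>, found
    as a combination of \<open>d1\<close> and \<open>d2\<close>; \<open>\<rho>\<close> below is its
    derivative divided by \<open>\<omega>\<close>.\<close>
  define \<sigma> where "\<sigma> s = \<beta> * (d2 s - \<iota> * d1 s)" for s
  define \<rho> where "\<rho> s = - \<beta> * (\<omega> * d1 s + \<iota> * d2 s / \<omega>)" for s
  have \<sigma>': "(\<sigma> has_real_derivative \<omega> * \<rho> s) (at s within {0..})" if "0 \<le> s" for s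
    unfolding \<sigma>_def \<rho>_def using d1[OF that] d2[OF that] pos
    by (auto intro!: derivative_eq_intros simp: power2_eq_square field_simps)
  have \<rho>': "(\<rho> has_real_derivative - \<omega> * \<sigma> s) (at s within {0..})" if "0 \<le> s" for s
    unfolding \<sigma>_def \<rho>_def using d1[OF that] d2[OF that] pos
    by (auto intro!: derivative_eq_intros simp: power2_eq_square field_simps)
  have \<sigma>eq: "\<omega> * \<rho> s = - \<iota> * \<sigma> s - d1 s" for s
  proof -
    have "\<omega> * \<rho> s + \<iota> * \<sigma> s = - (\<beta> * (\<iota>\<^sup>2 + \<omega>\<^sup>2)) * d1 s"
      unfolding \<sigma>_def \<rho>_def using pos by (simp add: power2_eq_square field_simps)
    then show ?thesis unfolding \<beta>(2) by simp
  qed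
  \<comment> \<open>Squared amplitude of the excitation, constant in time. It is positive because
    \<open>\<sigma>\<close> and \<open>\<rho>\<close> determine \<open>d1\<close> and
    \<open>d2\<close>.\<close>
  define R where "R = (\<sigma> 0)\<^sup>2 + (\<rho> 0)\<^sup>2"
  have "\<exists>C. \<forall>s\<in>{0..}. (\<sigma> s)\<^sup>2 + (\<rho> s)\<^sup>2 = C"
  proof (rule has_field_derivative_zero_constant)
    fix s :: real assume "s \<in> {0..}"
    then show "((\<lambda>s. (\<sigma> s)\<^sup>2 + (\<rho> s)\<^sup>2) has_field_derivative 0) (at s within {0..})"
      using \<sigma>'[of s] \<rho>'[of s] by (auto intro!: derivative_eq_intros)
  qed auto
  then have R: "(\<sigma> s)\<^sup>2 + (\<rho> s)\<^sup>2 = R" if "0 \<le> s" for s using that unfolding R_def by fastforce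
  have Rpos: "0 < R"
  proof (rule ccontr)
    assume "\<not> 0 < R"
    then have z: "\<sigma> 0 = 0" "\<rho> 0 = 0" unfolding R_def by (auto simp: not_less sum_power2_le_zero_iff)
    then have "d1 0 = 0" using \<sigma>eq[of 0] by simp
    moreover have "d2 0 = 0" using z(1) \<beta>(1) \<open>d1 0 = 0\<close> by (simp add: \<sigma>_def)
    ultimately show False using nz by simp
  qed
  define S where "S = sqrt R"
  have S: "0 < S" "S * S = R" using Rpos by (auto simp: S_def)
  have \<sigma>S: "\<bar>\<sigma> s\<bar> \<le> S" and \<rho>S: "\<bar>\<rho> s\<bar> \<le> S" if "0 \<le> s" for s
  proof -
    have "\<bar>\<sigma> s\<bar>\<^sup>2 \<le> R" "\<bar>\<rho> s\<bar>\<^sup>2 \<le> R"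
      using R[OF that] zero_le_power2[of "\<sigma> s"] zero_le_power2[of "\<rho> s"] unfolding power2_abs by linarith+
    then show "\<bar>\<sigma> s\<bar> \<le> S" "\<bar>\<rho> s\<bar> \<le> S" unfolding S_def by (auto intro: real_le_rsqrt)
  qed
  have \<sigma>\<rho>: "\<bar>\<sigma> s * \<rho> s\<bar> \<le> R" if "0 \<le> s" for s
    unfolding abs_mult S(2)[symmetric] using \<sigma>S[OF that] \<rho>S[OF that] S by (intro mult_mono) auto
  define B where "B = \<omega> * S + k0 * S + k1 * R * S / \<omega>"
  have B: "\<bar>- \<omega> * \<rho> s + k0 * \<sigma> s + k1 * (\<sigma> s)\<^sup>2 * \<rho> s / \<omega>\<bar> \<le> B" if "0 \<le> s" for s
  proof -
    have "\<bar>- \<omega> * \<rho> s + k0 * \<sigma> s + k1 * (\<sigma> s)\<^sup>2 * \<rho> s / \<omega>\<bar> \<le> \<bar>- \<omega> * \<rho> s\<bar> + \<bar>k0 * \<sigma> s\<bar> + \<bar>k1 * (\<sigma> s)\<^sup>2 * \<rho> s / \<omega>\<bar>"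
      by (intro order_trans[OF abs_triangle_ineq] add_mono abs_triangle_ineq order_refl)
    also have "\<dots> = \<omega> * \<bar>\<rho> s\<bar> + k0 * \<bar>\<sigma> s\<bar> + k1 * (\<sigma> s)\<^sup>2 * \<bar>\<rho> s\<bar> / \<omega>" using pos by (simp add: abs_mult)
    also have "\<dots> \<le> B"
    proof -
      have "(\<sigma> s)\<^sup>2 \<le> R" using R[OF that] zero_le_power2[of "\<rho> s"] by linarith
      then have "k1 * (\<sigma> s)\<^sup>2 * \<bar>\<rho> s\<bar> / \<omega> \<le> k1 * R * S / \<omega>"
        using pos Rpos \<rho>S[OF that] by (intro divide_right_mono mult_mono mult_left_mono) auto
      then show ?thesis
        unfolding B_def using pos by (intro add_mono mult_left_mono \<sigma>S \<rho>S that) auto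
    qed
    finally show ?thesis .
  qed
  \<comment> \<open>Sum of the threshold that makes the rate negative in
    \<open>lyapunov_rate\<close> and the one that makes \<open>V\<close> definite in
    \<open>lyapunov_bounds\<close>; both summands are nonnegative, so each threshold is met.\<close>
  define K where "K = (k1 * R + B\<^sup>2 / R + R / 4) / (2 * k0 * k1) + (1 + S / 2 + R / (2 * \<omega>)) / min k1 1"
  have K0: "0 \<le> K" unfolding K_def using pos Rpos S by (intro add_nonneg_nonneg divide_nonneg_nonneg) auto
  have K1: "k1 * R + B\<^sup>2 / R + R / 4 \<le> 2 * K * k0 * k1"
  proof -
    have "(k1 * R + B\<^sup>2 / R + R / 4) / (2 * k0 * k1) \<le> K"
      unfolding K_def using pos Rpos S by simp
    then show ?thesis using pos by (simp add: divide_le_eq mult_ac)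
  qed
  have K2: "1 + S / 2 + R / (2 * \<omega>) \<le> K * min k1 1"
  proof -
    have "(1 + S / 2 + R / (2 * \<omega>)) / min k1 1 \<le> K"
      unfolding K_def using pos Rpos S by (simp add: add_nonneg_nonneg)
    then show ?thesis using pos by (simp add: divide_le_eq)
  qed
  define H where "H = K * (k1 + 1) + S / 2 + R / (2 * \<omega>)"
  have H: "0 < H" unfolding H_def using pos S Rpos K0 by (intro add_nonneg_pos add_nonneg_nonneg) auto
  define Q where "Q = 2 * K * k1 + 2 * K + S + R / \<omega>"
  have Q: "0 \<le> Q" unfolding Q_def using K0 pos S Rpos by simp
  \<comment> \<open>\<open>C1\<close> and \<open>C2\<close> are what \<open>linear_decay\<close>
    gives for \<open>\<xi> - \<sigma>\<close> and for \<open>ph\<close>. The constants are formed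
    from initial values before \<open>T\<close> and a solution are fixed, which makes the bound
    uniform in \<open>T\<close>.\<close>
  define C1 where "C1 = \<bar>\<xi>0 - \<sigma> 0\<bar> + Ma / (\<iota> - \<mu>)"
  define C2 where "C2 = \<bar>d2 0 - \<xi>0 * \<omega>\<^sup>2 - \<iota> * d1 0 - \<phi>0\<bar> + (\<iota>\<^sup>2 + \<omega>\<^sup>2) * Ma / (\<iota> - \<mu>)"
  have C: "0 \<le> C1" "0 \<le> C2" unfolding C1_def C2_def using pos by (auto intro!: add_nonneg_nonneg)
  define X where "X = S + C1"
  have X: "0 \<le> X" using S C by (simp add: X_def)
  define E where "E = C1 + C2 + (\<iota> + k0) * Ma + k1 * C1 + k1 * X * Ma"
  have E: "0 \<le> E" unfolding E_def using C X pos by (intro add_nonneg_nonneg) auto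
  define V0 where "V0 = K * (k1 * (d1 0 - chi0)\<^sup>2 + (\<omega>\<^sup>2 - \<theta>h0)\<^sup>2) - \<sigma> 0 * (d1 0 - chi0) * (\<omega>\<^sup>2 - \<theta>h0)
     - \<sigma> 0 * \<rho> 0 / (2 * \<omega>) * (\<omega>\<^sup>2 - \<theta>h0)\<^sup>2"
  define C where "C = 4 * (Q * E)"
  have C0: "0 \<le> C" using Q E by (simp add: C_def)
  \<comment> \<open>The upper bound \<open>V \<le> H * (x^2 + p^2)\<close> turns the rate
    \<open>- (R / 4) * (x^2 + p^2)\<close> into \<open>- c * V\<close>.\<close>
  define c where "c = R / (4 * H)"
  have c: "0 < c" using Rpos H by (simp add: c_def)
  define \<nu> where "\<nu> = min c (\<mu> / 2)"
  have \<nu>: "0 < \<nu>" "\<nu> \<le> c" "\<nu> \<le> \<mu> / 2" using c pos by (auto simp: \<nu>_def)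
  \<comment> \<open>Square root of the bound on the quadratic \<open>V\<close>, so the errors decay
    at half its rate. The absolute value keeps the radicand nonnegative before \<open>V0\<close> is
    known to be a value of \<open>V\<close>.\<close>
  define W where "W = sqrt (\<bar>(V0 + 2 * C / \<mu>) * exp (C / \<mu>)\<bar>)"
  have W: "0 \<le> W" by (simp add: W_def)
  define M where "M = C2 + (X + \<iota> + 1) * W"
  have M: "0 \<le> M" "W \<le> M"
  proof -
    have "0 \<le> C2 + (X + \<iota>) * W" using \<open>0 \<le> C2\<close> X pos W by simp
    then show "0 \<le> M" "W \<le> M" using W by (auto simp: M_def algebra_simps)
  qed
  show ?thesis
  proof (rule that[of M "\<nu> / 2"])
    show "0 \<le> M" "0 < \<nu> / 2" "\<nu> / 2 \<le> \<mu>" using M \<nu> pos by auto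
    fix T \<xi> chi \<phi> \<theta>h s
    assume obs: "adaptive_observer \<iota> k0 k1 T (\<lambda>s. d1 s + a s) \<xi> chi \<phi> \<theta>h"
      and init: "\<xi> 0 = \<xi>0" "chi 0 = chi0" "\<phi> 0 = \<phi>0" "\<theta>h 0 = \<theta>h0" and s: "s \<in> {0..T}"
    note o = obs[unfolded adaptive_observer_def, rule_format]
    have sub: "{0..T} \<subseteq> {0..}" by auto
    note D1 = DERIV_subset[OF d1 sub] and D2 = DERIV_subset[OF d2 sub]
      and S1 = DERIV_subset[OF \<sigma>' sub] and R1 = DERIV_subset[OF \<rho>' sub]
    have \<delta>: "\<bar>\<xi> r - \<sigma> r\<bar> \<le> C1 * exp (- \<mu> * r)" if r: "r \<in> {0..T}" for r
      unfolding C1_def init(1)[symmetric]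
    proof (rule linear_decay[where u = "\<lambda>s. \<xi> s - \<sigma> s" and g = "\<lambda>s. - a s", OF _ _ pos(6,7) r])
      fix r assume r: "r \<in> {0..T}"
      have "((\<lambda>s. \<xi> s - \<sigma> s) has_real_derivative (- \<iota> * \<xi> r - (d1 r + a r)) - \<omega> * \<rho> r) (at r within {0..T})"
        using o[OF r] S1[of r] r by (intro DERIV_diff) auto
      then show "((\<lambda>s. \<xi> s - \<sigma> s) has_real_derivative - \<iota> * (\<xi> r - \<sigma> r) + - a r) (at r within {0..T})"
        unfolding \<sigma>eq by (simp add: algebra_simps)
      show "\<bar>- a r\<bar> \<le> Ma * exp (- \<mu> * r)" using a[of r] r by simp
    qed
    \<comment> \<open>The mismatch in the filter representation
      \<open>d2 = \<phi> + \<omega>^2 * \<xi> + \<iota> * d1\<close>. It obeys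
      \<open>ph' = - \<iota> * ph + (\<iota>^2 + \<omega>^2) * a\<close>, driven by the decaying
      \<open>a\<close> alone.\<close>
    define ph where "ph r = d2 r - \<xi> r * \<omega>\<^sup>2 - \<iota> * d1 r - \<phi> r" for r
    have ph: "\<bar>ph r\<bar> \<le> C2 * exp (- \<mu> * r)" if r: "r \<in> {0..T}" for r
    proof -
      have ph0: "d2 0 - \<xi>0 * \<omega>\<^sup>2 - \<iota> * d1 0 - \<phi>0 = ph 0" by (simp add: ph_def init)
      show ?thesis
        unfolding C2_def ph0
      proof (rule linear_decay[where u = ph and g = "\<lambda>s. (\<iota>\<^sup>2 + \<omega>\<^sup>2) * a s", OF _ _ pos(6) _ r])
        fix r assume r: "r \<in> {0..T}"
        have "(ph has_real_derivative (- \<omega>\<^sup>2 * d1 r) - (- \<iota> * \<xi> r - (d1 r + a r)) * \<omega>\<^sup>2 - \<iota> * d2 r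
           - (- \<iota> * \<phi> r - \<iota>\<^sup>2 * (d1 r + a r))) (at r within {0..T})"
          unfolding ph_def using o[OF r] D1[of r] D2[of r] r
          by (intro DERIV_diff DERIV_cmult DERIV_cmult_right) auto
        then show "(ph has_real_derivative - \<iota> * ph r + (\<iota>\<^sup>2 + \<omega>\<^sup>2) * a r) (at r within {0..T})"
          unfolding ph_def by (simp add: power2_eq_square algebra_simps)
        have "\<bar>(\<iota>\<^sup>2 + \<omega>\<^sup>2) * a r\<bar> = (\<iota>\<^sup>2 + \<omega>\<^sup>2) * \<bar>a r\<bar>" by (simp add: abs_mult)
        also have "\<dots> \<le> (\<iota>\<^sup>2 + \<omega>\<^sup>2) * (Ma * exp (- \<mu> * r))" using a[of r] r by (intro mult_left_mono) auto
        finally show "\<bar>(\<iota>\<^sup>2 + \<omega>\<^sup>2) * a r\<bar> \<le> (\<iota>\<^sup>2 + \<omega>\<^sup>2) * Ma * exp (- \<mu> * r)" by simp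
      qed (use pos in auto)
    qed
    have expi: "exp (- \<mu> * r) \<le> 1" if "0 \<le> r" for r using that pos by simp
    have \<xi>X: "\<bar>\<xi> r\<bar> \<le> X" if r: "r \<in> {0..T}" for r
    proof -
      have "C1 * exp (- \<mu> * r) \<le> C1 * 1" using r \<open>0 \<le> C1\<close> expi by (intro mult_left_mono) auto
      then show ?thesis using \<delta>[OF r] \<sigma>S[of r] r unfolding X_def by auto
    qed
    define x where "x r = d1 r - chi r" for r
    define p where "p r = \<omega>\<^sup>2 - \<theta>h r" for r
    \<comment> \<open>\<open>u\<close> and \<open>v\<close> are what is left over after replacing
      \<open>\<xi>\<close> by \<open>\<sigma>\<close> and \<open>y\<close> by \<open>d1\<close> in
      the error equations. Every term has a factor decaying like \<open>exp (- \<mu> * s)\<close>,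
      some with an additional factor \<open>p\<close> or \<open>x\<close>.\<close>
    define u where "u r = (\<xi> r - \<sigma> r) * p r + (ph r - (\<iota> + k0) * a r)" for r
    define v where "v r = - k1 * (\<xi> r - \<sigma> r) * x r - k1 * \<xi> r * a r" for r
    have x': "(x has_real_derivative - k0 * x r + \<sigma> r * p r + u r) (at r within {0..T})" if r: "r \<in> {0..T}" for r
    proof -
      have "(x has_real_derivative d2 r - (\<phi> r + \<iota> * (d1 r + a r) + \<theta>h r * \<xi> r + k0 * (d1 r + a r - chi r))) (at r within {0..T})"
        unfolding x_def using o[OF r] D1[of r] r by (intro DERIV_diff) auto
      then show ?thesis unfolding x_def u_def p_def ph_def by (simp add: algebra_simps)
    qed
    have p': "(p has_real_derivative - k1 * \<sigma> r * x r + v r) (at r within {0..T})" if r: "r \<in> {0..T}" for r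
    proof -
      have "(p has_real_derivative 0 - k1 * \<xi> r * (d1 r + a r - chi r)) (at r within {0..T})"
        unfolding p_def using o[OF r] by (intro DERIV_diff DERIV_const) auto
      then show ?thesis unfolding x_def v_def by (simp add: algebra_simps)
    qed
    define V where "V r = K * (k1 * (x r)\<^sup>2 + (p r)\<^sup>2) - \<sigma> r * x r * p r - \<sigma> r * \<rho> r / (2 * \<omega>) * (p r)\<^sup>2" for r
    define V' where "V' r = 2 * K * (k1 * x r * (- k0 * x r + \<sigma> r * p r + u r) + p r * (- k1 * \<sigma> r * x r + v r))
      - (\<omega> * \<rho> r * x r * p r + \<sigma> r * (- k0 * x r + \<sigma> r * p r + u r) * p r + \<sigma> r * x r * (- k1 * \<sigma> r * x r + v r))
      - (((\<rho> r)\<^sup>2 - (\<sigma> r)\<^sup>2) / 2 * (p r)\<^sup>2 + \<sigma> r * \<rho> r / \<omega> * p r * (- k1 * \<sigma> r * x r + v r))" for r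
    have V': "(V has_real_derivative V' r) (at r within {0..T})" if r: "r \<in> {0..T}" for r
    proof -
      have "(\<sigma> has_real_derivative \<omega> * \<rho> r) (at r within {0..T})" "(\<rho> has_real_derivative - \<omega> * \<sigma> r) (at r within {0..T})"
        using S1 R1 r by auto
      note ds = this
      \<comment> \<open>Keeping the rates of \<open>x\<close> and \<open>p\<close> opaque reduces
        the comparison of the product rule with \<open>V'\<close> to an algebraic identity.\<close>
      define xx where "xx = - k0 * x r + \<sigma> r * p r + u r"
      define pp where "pp = - k1 * \<sigma> r * x r + v r"
      have dx: "(x has_real_derivative xx) (at r within {0..T})" and dp: "(p has_real_derivative pp) (at r within {0..T})"
        using x'[OF r] p'[OF r] by (simp_all add: xx_def pp_def)
      have dx2: "((\<lambda>r. (x r)\<^sup>2) has_real_derivative 2 * x r * xx) (at r within {0..T})"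
        and dp2: "((\<lambda>r. (p r)\<^sup>2) has_real_derivative 2 * p r * pp) (at r within {0..T})"
        by (auto intro!: derivative_eq_intros dx dp)
      have dsr: "((\<lambda>r. \<sigma> r * \<rho> r / (2 * \<omega>)) has_real_derivative ((\<rho> r)\<^sup>2 - (\<sigma> r)\<^sup>2) / 2) (at r within {0..T})"
        using DERIV_cdivide[OF DERIV_mult[OF ds], of "2 * \<omega>"] pos
        by (auto simp: power2_eq_square field_simps elim!: DERIV_cong)
      have "(V has_real_derivative K * (k1 * (2 * x r * xx) + 2 * p r * pp)
          - ((\<omega> * \<rho> r * x r + xx * \<sigma> r) * p r + pp * (\<sigma> r * x r))
          - (((\<rho> r)\<^sup>2 - (\<sigma> r)\<^sup>2) / 2 * (p r)\<^sup>2 + 2 * p r * pp * (\<sigma> r * \<rho> r / (2 * \<omega>)))) (at r within {0..T})"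
        unfolding V_def
        by (intro DERIV_diff DERIV_cmult DERIV_add DERIV_mult dx2 dp2 dsr ds dx dp)
      moreover have "V' r = 2 * K * (k1 * x r * xx + p r * pp) - (\<omega> * \<rho> r * x r * p r + \<sigma> r * xx * p r + \<sigma> r * x r * pp)
          - (((\<rho> r)\<^sup>2 - (\<sigma> r)\<^sup>2) / 2 * (p r)\<^sup>2 + \<sigma> r * \<rho> r / \<omega> * p r * pp)"
        by (simp only: V'_def xx_def pp_def)
      ultimately show ?thesis
        by (elim DERIV_cong) (simp add: algebra_simps)
    qed
    have Vb: "(x r)\<^sup>2 + (p r)\<^sup>2 \<le> V r" "V r \<le> H * ((x r)\<^sup>2 + (p r)\<^sup>2)" if r: "r \<in> {0..T}" for r
      unfolding V_def H_def
      using lyapunov_bounds[OF pos(4) K0 pos(3) _ \<sigma>S \<sigma>\<rho> K2, of r "x r" "p r"] r Rpos by auto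
    have rate: "V' r \<le> - c * V r + C * exp (- \<mu> * r) * (V r + 1)" if r: "r \<in> {0..T}" for r
    proof -
      let ?e = "exp (- \<mu> * r)"
      have r0: "0 \<le> r" using r by simp
      have ae: "\<bar>a r\<bar> \<le> Ma * ?e" by (rule a[OF r0])
      have d: "\<bar>\<xi> r - \<sigma> r\<bar> \<le> C1 * ?e" by (rule \<delta>[OF r])
      have E1: "C1 \<le> E" "C2 + (\<iota> + k0) * Ma \<le> E" "k1 * C1 \<le> E" "k1 * X * Ma \<le> E"
      proof -
        have "0 \<le> (\<iota> + k0) * Ma" "0 \<le> k1 * C1" "0 \<le> k1 * X * Ma" using pos X \<open>0 \<le> C1\<close> by auto
        then show "C1 \<le> E" "C2 + (\<iota> + k0) * Ma \<le> E" "k1 * C1 \<le> E" "k1 * X * Ma \<le> E"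
          unfolding E_def using \<open>0 \<le> C1\<close> \<open>0 \<le> C2\<close> by linarith+
      qed
      have u: "\<bar>u r\<bar> \<le> E * ?e * (\<bar>p r\<bar> + 1)"
      proof -
        have "\<bar>u r\<bar> \<le> \<bar>(\<xi> r - \<sigma> r) * p r\<bar> + \<bar>ph r\<bar> + \<bar>(\<iota> + k0) * a r\<bar>" unfolding u_def by linarith
        also have "\<dots> = \<bar>\<xi> r - \<sigma> r\<bar> * \<bar>p r\<bar> + \<bar>ph r\<bar> + (\<iota> + k0) * \<bar>a r\<bar>" using pos by (simp add: abs_mult)
        also have "\<dots> \<le> (C1 * ?e) * \<bar>p r\<bar> + C2 * ?e + (\<iota> + k0) * (Ma * ?e)"
          using d ph[OF r] ae pos by (intro add_mono mult_right_mono mult_left_mono) auto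
        also have "\<dots> = C1 * (?e * \<bar>p r\<bar>) + (C2 + (\<iota> + k0) * Ma) * ?e" by (simp add: algebra_simps)
        also have "\<dots> \<le> E * (?e * \<bar>p r\<bar>) + E * ?e" using E1 by (intro add_mono mult_right_mono) auto
        finally show ?thesis by (simp add: algebra_simps)
      qed
      have v: "\<bar>v r\<bar> \<le> E * ?e * (\<bar>x r\<bar> + 1)"
      proof -
        have "\<bar>v r\<bar> \<le> \<bar>k1 * (\<xi> r - \<sigma> r) * x r\<bar> + \<bar>k1 * \<xi> r * a r\<bar>" unfolding v_def by linarith
        also have "\<dots> = k1 * \<bar>\<xi> r - \<sigma> r\<bar> * \<bar>x r\<bar> + k1 * \<bar>\<xi> r\<bar> * \<bar>a r\<bar>" using pos by (simp add: abs_mult)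
        also have "\<dots> \<le> k1 * (C1 * ?e) * \<bar>x r\<bar> + k1 * X * (Ma * ?e)"
          using d \<xi>X[OF r] ae pos X by (intro add_mono mult_right_mono mult_left_mono mult_mono) auto
        also have "\<dots> = k1 * C1 * (?e * \<bar>x r\<bar>) + k1 * X * Ma * ?e" by (simp add: algebra_simps)
        also have "\<dots> \<le> E * (?e * \<bar>x r\<bar>) + E * ?e" using E1 by (intro add_mono mult_right_mono) auto
        finally show ?thesis by (simp add: algebra_simps)
      qed
      have "V' r \<le> - (R / 4) * ((x r)\<^sup>2 + (p r)\<^sup>2) + 4 * (Q * E) * ?e * ((x r)\<^sup>2 + (p r)\<^sup>2 + 1)"
        unfolding V'_def
        by (rule lyapunov_rate[OF pos(2,3,4) K0 Rpos E _ R[OF r0] \<sigma>S[OF r0] \<sigma>\<rho>[OF r0] B[OF r0] K1 u v Q_def]) simp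
      also have "\<dots> \<le> - c * V r + C * ?e * (V r + 1)"
      proof (rule add_mono)
        have "c * V r \<le> c * (H * ((x r)\<^sup>2 + (p r)\<^sup>2))" using Vb(2)[OF r] c by (intro mult_left_mono) auto
        also have "\<dots> = (R / 4) * ((x r)\<^sup>2 + (p r)\<^sup>2)" using H by (simp add: c_def)
        finally show "- (R / 4) * ((x r)\<^sup>2 + (p r)\<^sup>2) \<le> - c * V r" by simp
        show "4 * (Q * E) * ?e * ((x r)\<^sup>2 + (p r)\<^sup>2 + 1) \<le> C * ?e * (V r + 1)"
          unfolding C_def using Vb(1)[OF r] Q E by (intro mult_left_mono) auto
      qed
      finally show ?thesis .
    qed
    have Vpos: "0 \<le> V r" if "r \<in> {0..T}" for r
      using Vb(1)[OF that] sum_power2_ge_zero[of "x r" "p r"] by linarith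
    have V00: "V 0 = V0" by (simp add: V_def V0_def x_def p_def init)
    have Vs: "V s \<le> (V0 + 2 * C / \<mu>) * exp (C / \<mu>) * exp (- \<nu> * s)"
      using perturbed_decay[OF V' rate Vpos pos(5) C0 \<nu>(2,3) s] unfolding V00 .
    also have "\<dots> \<le> \<bar>(V0 + 2 * C / \<mu>) * exp (C / \<mu>)\<bar> * exp (- \<nu> * s)"
      by (intro mult_right_mono) auto
    also have "\<dots> = (W * exp (- (\<nu> / 2) * s))\<^sup>2"
      unfolding W_def power_mult_distrib by (simp add: power2_eq_square exp_add[symmetric])
    finally have Vs: "V s \<le> (W * exp (- (\<nu> / 2) * s))\<^sup>2" .
    have W0: "0 \<le> W * exp (- (\<nu> / 2) * s)" using W by simp
    have "\<bar>x s\<bar>\<^sup>2 \<le> (W * exp (- (\<nu> / 2) * s))\<^sup>2" "\<bar>p s\<bar>\<^sup>2 \<le> (W * exp (- (\<nu> / 2) * s))\<^sup>2"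
      using Vs Vb(1)[OF s] zero_le_power2[of "x s"] zero_le_power2[of "p s"] unfolding power2_abs by linarith+
    then have xs: "\<bar>x s\<bar> \<le> W * exp (- (\<nu> / 2) * s)" and ps: "\<bar>p s\<bar> \<le> W * exp (- (\<nu> / 2) * s)"
      using W0 by (auto intro: power2_le_imp_le)
    have WM: "W * exp (- (\<nu> / 2) * s) \<le> M * exp (- (\<nu> / 2) * s)" using M by (intro mult_right_mono) auto
    \<comment> \<open>Three decaying parts; the filter state enters only as a bounded factor of the
      parameter error.\<close>
    have "d2 s - (\<phi> s + \<xi> s * \<theta>h s + \<iota> * chi s) = ph s + \<xi> s * p s + \<iota> * x s"
      by (simp add: ph_def p_def x_def algebra_simps)
    then have "\<bar>d2 s - (\<phi> s + \<xi> s * \<theta>h s + \<iota> * chi s)\<bar> \<le> \<bar>ph s\<bar> + \<bar>\<xi> s * p s\<bar> + \<bar>\<iota> * x s\<bar>" by linarith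
    also have "\<dots> = \<bar>ph s\<bar> + \<bar>\<xi> s\<bar> * \<bar>p s\<bar> + \<iota> * \<bar>x s\<bar>" using pos by (simp add: abs_mult)
    also have "\<dots> \<le> C2 * exp (- (\<nu> / 2) * s) + X * (W * exp (- (\<nu> / 2) * s)) + \<iota> * (W * exp (- (\<nu> / 2) * s))"
    proof (intro add_mono mult_mono mult_left_mono)
      have "\<nu> / 2 * s \<le> \<mu> * s" using \<nu> pos s by (intro mult_right_mono) auto
      then have "C2 * exp (- \<mu> * s) \<le> C2 * exp (- (\<nu> / 2) * s)" using \<open>0 \<le> C2\<close> by (intro mult_left_mono) auto
      then show "\<bar>ph s\<bar> \<le> C2 * exp (- (\<nu> / 2) * s)" using ph[OF s] by linarith
    qed (use \<xi>X[OF s] xs ps pos X in auto)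
    also have "\<dots> \<le> M * exp (- (\<nu> / 2) * s)" using W0 by (simp add: M_def algebra_simps)
    finally have ds: "\<bar>d2 s - (\<phi> s + \<xi> s * \<theta>h s + \<iota> * chi s)\<bar> \<le> M * exp (- (\<nu> / 2) * s)" .
    show "\<bar>d1 s - chi s\<bar> \<le> M * exp (- (\<nu> / 2) * s) \<and> \<bar>\<omega>\<^sup>2 - \<theta>h s\<bar> \<le> M * exp (- (\<nu> / 2) * s) \<and>
      \<bar>d2 s - (\<phi> s + \<xi> s * \<theta>h s + \<iota> * chi s)\<bar> \<le> M * exp (- (\<nu> / 2) * s)"
      using xs ps ds WM unfolding x_def p_def by linarith
  qed
qed

section \<open>The output profile and the estimation error\<close>

text \<open>Gronwall's inequality for \<open>v'' = - \<nu> * v + g\<close>. Of the rate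
  \<open>2 + N\<close>, the part \<open>1 + N\<close> pays for the mixed term
  \<open>2 * v * v' * (1 - \<nu>)\<close> and the remaining 1 for the forcing; adding
  \<open>\<gamma>^2\<close> to the energy makes the inequality homogeneous.\<close>

lemma oscillator_energy_bound:
  fixes v v' g :: "real \<Rightarrow> real"
  assumes v: "\<And>x. x \<in> {0..1} \<Longrightarrow> (v has_real_derivative v' x) (at x within {0..1})"
    and v': "\<And>x. x \<in> {0..1} \<Longrightarrow> (v' has_real_derivative - \<nu> * v x + g x) (at x within {0..1})"
    and g: "\<And>x. x \<in> {0..1} \<Longrightarrow> \<bar>g x\<bar> \<le> \<gamma>" and \<nu>: "\<bar>\<nu>\<bar> \<le> N" and x: "x \<in> {0..1}"
  shows "(v x)\<^sup>2 + (v' x)\<^sup>2 \<le> ((v 0)\<^sup>2 + (v' 0)\<^sup>2 + \<gamma>\<^sup>2) * exp (2 + N)"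
proof -
  define L where "L = 2 + N"
  have L: "2 \<le> L" using \<nu> by (auto simp: L_def)
  let ?e = "\<lambda>x. (v x)\<^sup>2 + (v' x)\<^sup>2"
  let ?e' = "\<lambda>x. 2 * v x * v' x + 2 * v' x * (- \<nu> * v x + g x)"
  have "(?e x + \<gamma>\<^sup>2) * exp (- L * x) \<le> (?e 0 + \<gamma>\<^sup>2) * exp (- L * 0)"
  proof (rule nonincreasing_on_Icc[where V = "\<lambda>x. (?e x + \<gamma>\<^sup>2) * exp (- L * x)"
        and V' = "\<lambda>x. (?e' x - L * (?e x + \<gamma>\<^sup>2)) * exp (- L * x)", OF _ _ x])
    fix x :: real assume x: "x \<in> {0..1}"
    show "((\<lambda>x. (?e x + \<gamma>\<^sup>2) * exp (- L * x)) has_real_derivative (?e' x - L * (?e x + \<gamma>\<^sup>2)) * exp (- L * x)) (at x within {0..1})"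
      using v[OF x] v'[OF x] by (auto intro!: derivative_eq_intros simp: algebra_simps)
    have "2 * (v x * v' x) * (1 - \<nu>) \<le> ?e x * (1 + N)"
    proof -
      have "2 * (v x * v' x) * (1 - \<nu>) \<le> \<bar>2 * (v x * v' x) * (1 - \<nu>)\<bar>" by simp
      also have "\<dots> = (2 * (\<bar>v x\<bar> * \<bar>v' x\<bar>)) * \<bar>1 - \<nu>\<bar>" by (simp add: abs_mult)
      also have "\<dots> \<le> ?e x * (1 + N)"
      proof (rule mult_mono)
        have "0 \<le> (\<bar>v x\<bar> - \<bar>v' x\<bar>)\<^sup>2" by simp
        then show "2 * (\<bar>v x\<bar> * \<bar>v' x\<bar>) \<le> ?e x" by (simp add: power2_diff)
      qed (use \<nu> in auto)
      finally show ?thesis .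
    qed
    moreover have "2 * v' x * g x \<le> (v' x)\<^sup>2 + \<gamma>\<^sup>2"
    proof -
      have "(g x)\<^sup>2 \<le> \<gamma>\<^sup>2" using g[OF x] by (metis abs_ge_zero abs_le_square_iff abs_of_nonneg order_trans)
      moreover have "0 \<le> (v' x - g x)\<^sup>2" by simp
      ultimately show ?thesis by (simp add: power2_diff)
    qed
    moreover have "(v' x)\<^sup>2 \<le> ?e x" by simp
    moreover have "?e' x = 2 * (v x * v' x) * (1 - \<nu>) + 2 * v' x * g x" "L * ?e x = ?e x * (1 + N) + ?e x"
      by (simp_all add: L_def algebra_simps)
    ultimately have "?e' x \<le> L * ?e x + \<gamma>\<^sup>2" by linarith
    also have "\<dots> \<le> L * ?e x + L * \<gamma>\<^sup>2" using mult_right_mono[of 1 L "\<gamma>\<^sup>2"] L by simp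
    finally have "?e' x - L * (?e x + \<gamma>\<^sup>2) \<le> 0" by (simp add: algebra_simps)
    then show "(?e' x - L * (?e x + \<gamma>\<^sup>2)) * exp (- L * x) \<le> 0" by (rule mult_nonpos_nonneg) simp
  qed
  then have "(?e x + \<gamma>\<^sup>2) * exp (- L * x) * exp (L * x) \<le> (?e 0 + \<gamma>\<^sup>2) * exp (L * x)"
    by (intro mult_right_mono) auto
  then have "?e x + \<gamma>\<^sup>2 \<le> (?e 0 + \<gamma>\<^sup>2) * exp (L * x)" by (simp add: mult.assoc exp_add[symmetric])
  also have "\<dots> \<le> (?e 0 + \<gamma>\<^sup>2) * exp L"
    using x L mult_left_mono[of x 1 L] by (intro mult_left_mono) auto
  finally show ?thesis unfolding L_def using zero_le_power2[of \<gamma>] by linarith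
qed

lemma row_mult_S_c: "v v* S_c \<nu> = vector [- \<nu> * v $ 2, v $ 1]"
  unfolding S_c_def vec_eq_iff by (simp add: vector_matrix_mult_def sum_2 forall_2 vector_2)

lemma row_mult_S_c_sq: "v v* (S_c \<nu> ** S_c \<nu>) = - \<nu> *\<^sub>R v"
proof -
  have "v v* (S_c \<nu> ** S_c \<nu>) = (v v* S_c \<nu>) v* S_c \<nu>"
    by (simp add: vector_matrix_mul_assoc)
  also have "\<dots> = - \<nu> *\<^sub>R v"
    unfolding row_mult_S_c by (simp add: vec_eq_iff forall_2 vector_2)
  finally show ?thesis .
qed

text \<open>\<open>S_c \<nu>\<close> squares to \<open>- \<nu>\<close> times the identity, so the
  components of the row decouple: the second has zero data and vanishes, the first solves
  \<open>C'' = - \<nu> * C\<close> with \<open>C 0 = 1\<close>, \<open>C' 0 = 0\<close>. It is a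
  cosine or a hyperbolic cosine according to the sign of \<open>\<nu>\<close>; energy estimates
  treat both at once and give bounds for bounded \<open>\<nu>\<close>.\<close>

lemma output_profile_scalar:
  assumes "output_profile f1"
  obtains C C' where
    "\<And>\<nu> x d. x \<in> {0..1} \<Longrightarrow> f1 \<nu> x \<bullet> d = C \<nu> x * d $ 1"
    "\<And>\<nu> x d. x \<in> {0..1} \<Longrightarrow> (f1 \<nu> x v* S_c \<nu>) \<bullet> d = C \<nu> x * d $ 2"
    "\<And>\<nu>. has_h1_deriv (C \<nu>) (C' \<nu>)"
    "\<And>N. \<exists>B\<ge>0. \<forall>\<nu> \<nu>' x. \<bar>\<nu>\<bar> \<le> N \<longrightarrow> \<bar>\<nu>'\<bar> \<le> N \<longrightarrow> x \<in> {0..1} \<longrightarrow>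
        \<bar>C \<nu> x\<bar> \<le> B \<and> \<bar>C' \<nu> x\<bar> \<le> B \<and>
        \<bar>C \<nu> x - C \<nu>' x\<bar> \<le> B * \<bar>\<nu> - \<nu>'\<bar> \<and> \<bar>C' \<nu> x - C' \<nu>' x\<bar> \<le> B * \<bar>\<nu> - \<nu>'\<bar>"
proof -
  have "\<forall>\<nu>. \<exists>f1'. (\<forall>x\<in>{0..1}. (f1 \<nu> has_vector_derivative f1' x) (at x within {0..1}) \<and>
                  (f1' has_vector_derivative (- \<nu> *\<^sub>R f1 \<nu> x)) (at x within {0..1})) \<and> f1' 0 = 0"
    using assms unfolding output_profile_def row_mult_S_c_sq by blast
  then obtain F where F: "\<And>\<nu> x. x \<in> {0..1} \<Longrightarrow> (f1 \<nu> has_vector_derivative F \<nu> x) (at x within {0..1})"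
    "\<And>\<nu> x. x \<in> {0..1} \<Longrightarrow> (F \<nu> has_vector_derivative (- \<nu> *\<^sub>R f1 \<nu> x)) (at x within {0..1})" "\<And>\<nu>. F \<nu> 0 = 0"
    by metis
  have f10: "f1 \<nu> 0 = vector [1, 0]" for \<nu> using assms by (simp add: output_profile_def gamma_eta_def)
  have comp: "((\<lambda>x. f x $ i) has_real_derivative f' $ i) (at x within {0..1})"
    if "(f has_vector_derivative f') (at x within {0..1})" for f :: "real \<Rightarrow> real^2" and f' x i
    using bounded_linear.has_vector_derivative[OF bounded_linear_vec_nth that]
    by (simp add: has_real_derivative_iff_has_vector_derivative)
  have d1: "((\<lambda>x. f1 \<nu> x $ i) has_real_derivative F \<nu> x $ i) (at x within {0..1})"
    and d2: "((\<lambda>x. F \<nu> x $ i) has_real_derivative - \<nu> * f1 \<nu> x $ i) (at x within {0..1})"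
    if "x \<in> {0..1}" for \<nu> x i
    using comp[OF F(1)[OF that], where i = i] comp[OF F(2)[OF that], where i = i] by auto
  have z: "f1 \<nu> x $ 2 = 0" if x: "x \<in> {0..1}" for \<nu> x
  proof -
    have "(f1 \<nu> x $ 2)\<^sup>2 + (F \<nu> x $ 2)\<^sup>2 \<le> ((f1 \<nu> 0 $ 2)\<^sup>2 + (F \<nu> 0 $ 2)\<^sup>2 + 0\<^sup>2) * exp (2 + \<bar>\<nu>\<bar>)"
      using d2 by (intro oscillator_energy_bound[where g = "\<lambda>_. 0" and \<nu> = \<nu>, OF d1 _ _ _ x]) auto
    then have "(f1 \<nu> x $ 2)\<^sup>2 + (F \<nu> x $ 2)\<^sup>2 \<le> 0" by (simp add: f10 F vector_2)
    then show ?thesis by (simp add: sum_power2_le_zero_iff)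
  qed
  define C where "C \<nu> x = f1 \<nu> x $ 1" for \<nu> x
  define C' where "C' \<nu> x = F \<nu> x $ 1" for \<nu> x
  have C: "(C \<nu> has_real_derivative C' \<nu> x) (at x within {0..1})"
    and C': "(C' \<nu> has_real_derivative - \<nu> * C \<nu> x) (at x within {0..1})" if "x \<in> {0..1}" for \<nu> x
    using d1[OF that] d2[OF that] unfolding C_def C'_def by auto
  have init: "C \<nu> 0 = 1" "C' \<nu> 0 = 0" for \<nu> by (simp_all add: C_def C'_def f10 F vector_2)
  show ?thesis
  proof (rule that[of C C'])
    show "f1 \<nu> x \<bullet> d = C \<nu> x * d $ 1" if "x \<in> {0..1}" for \<nu> x d
      using z[OF that] by (simp add: inner_vec_def sum_2 C_def)
    show "(f1 \<nu> x v* S_c \<nu>) \<bullet> d = C \<nu> x * d $ 2" if "x \<in> {0..1}" for \<nu> x d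
      unfolding row_mult_S_c using z[OF that] by (simp add: inner_vec_def sum_2 C_def vector_2)
    show "has_h1_deriv (C \<nu>) (C' \<nu>)" for \<nu>
      unfolding has_h1_deriv_def
    proof (intro conjI ballI)
      have "continuous_on {0..1} (C' \<nu>)" by (rule DERIV_continuous_on) (rule C')
      then show "C' \<nu> \<in> L2" by (rule L2_continuous)
      fix x :: real assume x: "x \<in> {0..1}"
      show "(C' \<nu> has_integral C \<nu> x - C \<nu> 0) {0..x}"
      proof (rule fundamental_theorem_of_calculus)
        fix y assume "y \<in> {0..x}"
        then have "y \<in> {0..1}" "{0..x} \<subseteq> {0..1}" using x by auto
        then show "(C \<nu> has_vector_derivative C' \<nu> y) (at y within {0..x})"
          using DERIV_subset[OF C] by (simp add: has_real_derivative_iff_has_vector_derivative)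
      qed (use x in auto)
    qed
    show "\<exists>B\<ge>0. \<forall>\<nu> \<nu>' x. \<bar>\<nu>\<bar> \<le> N \<longrightarrow> \<bar>\<nu>'\<bar> \<le> N \<longrightarrow> x \<in> {0..1} \<longrightarrow>
        \<bar>C \<nu> x\<bar> \<le> B \<and> \<bar>C' \<nu> x\<bar> \<le> B \<and>
        \<bar>C \<nu> x - C \<nu>' x\<bar> \<le> B * \<bar>\<nu> - \<nu>'\<bar> \<and> \<bar>C' \<nu> x - C' \<nu>' x\<bar> \<le> B * \<bar>\<nu> - \<nu>'\<bar>" for N
    proof (cases "0 \<le> N")
      case True
      define G where "G = exp (2 + N)"
      have G: "1 \<le> G" "G \<le> G\<^sup>2" using True by (auto simp: G_def power2_eq_square)
      have sq: "\<bar>t\<bar> \<le> K" if "t\<^sup>2 + r\<^sup>2 \<le> K\<^sup>2" "0 \<le> K" for t r K :: real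
      proof (rule power2_le_imp_le[OF _ that(2)])
        show "\<bar>t\<bar>\<^sup>2 \<le> K\<^sup>2" using that zero_le_power2[of r] unfolding power2_abs by linarith
      qed
      have sq': "\<bar>r\<bar> \<le> K" if "t\<^sup>2 + r\<^sup>2 \<le> K\<^sup>2" "0 \<le> K" for t r K :: real
      proof (rule power2_le_imp_le[OF _ that(2)])
        show "\<bar>r\<bar>\<^sup>2 \<le> K\<^sup>2" using that zero_le_power2[of t] unfolding power2_abs by linarith
      qed
      have b: "(C \<nu> x)\<^sup>2 + (C' \<nu> x)\<^sup>2 \<le> G\<^sup>2" if "\<bar>\<nu>\<bar> \<le> N" "x \<in> {0..1}" for \<nu> x
      proof -
        have "(C \<nu> x)\<^sup>2 + (C' \<nu> x)\<^sup>2 \<le> ((C \<nu> 0)\<^sup>2 + (C' \<nu> 0)\<^sup>2 + 0\<^sup>2) * exp (2 + N)"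
          using C' that by (intro oscillator_energy_bound[where g = "\<lambda>_. 0" and \<nu> = \<nu>, OF C]) auto
        then show ?thesis using G by (simp add: init G_def)
      qed
      \<comment> \<open>The difference of two profiles has zero data and solves the oscillator
        equation with forcing \<open>(\<nu>' - \<nu>) * C \<nu>'\<close>, so the bound on
        \<open>C\<close> yields the Lipschitz estimate.\<close>
      have l: "(C \<nu> x - C \<nu>' x)\<^sup>2 + (C' \<nu> x - C' \<nu>' x)\<^sup>2 \<le> (G\<^sup>2 * \<bar>\<nu> - \<nu>'\<bar>)\<^sup>2"
        if "\<bar>\<nu>\<bar> \<le> N" "\<bar>\<nu>'\<bar> \<le> N" "x \<in> {0..1}" for \<nu> \<nu>' x
      proof -
        have "(C \<nu> x - C \<nu>' x)\<^sup>2 + (C' \<nu> x - C' \<nu>' x)\<^sup>2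
          \<le> ((C \<nu> 0 - C \<nu>' 0)\<^sup>2 + (C' \<nu> 0 - C' \<nu>' 0)\<^sup>2 + (\<bar>\<nu> - \<nu>'\<bar> * G)\<^sup>2) * exp (2 + N)"
        proof (rule oscillator_energy_bound[where v = "\<lambda>x. C \<nu> x - C \<nu>' x" and v' = "\<lambda>x. C' \<nu> x - C' \<nu>' x"
              and g = "\<lambda>x. (\<nu>' - \<nu>) * C \<nu>' x" and \<nu> = \<nu>])
          fix x assume x: "x \<in> {0..1::real}"
          show "((\<lambda>x. C \<nu> x - C \<nu>' x) has_real_derivative C' \<nu> x - C' \<nu>' x) (at x within {0..1})"
            by (intro DERIV_diff C x)
          have "((\<lambda>x. C' \<nu> x - C' \<nu>' x) has_real_derivative - \<nu> * C \<nu> x - - \<nu>' * C \<nu>' x) (at x within {0..1})"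
            by (intro DERIV_diff C' x)
          then show "((\<lambda>x. C' \<nu> x - C' \<nu>' x) has_real_derivative - \<nu> * (C \<nu> x - C \<nu>' x) + (\<nu>' - \<nu>) * C \<nu>' x) (at x within {0..1})"
            by (rule DERIV_cong) (simp add: algebra_simps)
          have "\<bar>C \<nu>' x\<bar> \<le> G" using b[OF that(2) x] G by (intro sq) auto
          then show "\<bar>(\<nu>' - \<nu>) * C \<nu>' x\<bar> \<le> \<bar>\<nu> - \<nu>'\<bar> * G"
            unfolding abs_mult abs_minus_commute[of \<nu>' \<nu>] by (rule mult_left_mono) simp
        qed (use that in auto)
        also have "\<dots> = \<bar>\<nu> - \<nu>'\<bar>\<^sup>2 * (G\<^sup>2 * G)" by (simp add: init G_def[symmetric] power_mult_distrib)
        also have "\<dots> \<le> \<bar>\<nu> - \<nu>'\<bar>\<^sup>2 * (G\<^sup>2 * G\<^sup>2)" using G by (intro mult_left_mono) auto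
        also have "\<dots> = (G\<^sup>2 * \<bar>\<nu> - \<nu>'\<bar>)\<^sup>2" by (simp add: power_mult_distrib power2_eq_square)
        finally show ?thesis .
      qed
      show ?thesis
      proof (intro exI[of _ "G\<^sup>2"] conjI allI impI)
        fix \<nu> \<nu>' x :: real assume n: "\<bar>\<nu>\<bar> \<le> N" "\<bar>\<nu>'\<bar> \<le> N" "x \<in> {0..1}"
        show "\<bar>C \<nu> x\<bar> \<le> G\<^sup>2" "\<bar>C' \<nu> x\<bar> \<le> G\<^sup>2"
          using sq[OF b[OF n(1,3)]] sq'[OF b[OF n(1,3)]] G by auto
        show "\<bar>C \<nu> x - C \<nu>' x\<bar> \<le> G\<^sup>2 * \<bar>\<nu> - \<nu>'\<bar>" "\<bar>C' \<nu> x - C' \<nu>' x\<bar> \<le> G\<^sup>2 * \<bar>\<nu> - \<nu>'\<bar>"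
          using sq[OF l[OF n]] sq'[OF l[OF n]] by auto
      qed simp
    \<comment> \<open>For negative \<open>N\<close> no \<open>\<nu>\<close> is admissible and the
      claim is vacuous.\<close>
    qed (auto intro: exI[of _ 0])
  qed
qed

text \<open>Separates the wave part \<open>z\<close>, \<open>w\<close> from the profile part
  \<open>g\<close>, \<open>k\<close>. The uniform bound gives \<open>2 * G\<close> in
  \<open>H1\<close> and \<open>G\<close> in \<open>L2\<close>; with the factors 4 and 2 of the sum
  estimates this is \<open>10 * G\<close>.\<close>

lemma norm_H3_perturbation_le:
  assumes z: "z \<in> H1" and w: "w \<in> L2" and g: "has_h1_deriv g g'" and k: "k \<in> L2"
    and b: "\<And>x. x \<in> {0..1} \<Longrightarrow> \<bar>g x\<bar> \<le> G \<and> \<bar>g' x\<bar> \<le> G \<and> \<bar>k x\<bar> \<le> G"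
    and f: "\<And>x. x \<in> {0..1} \<Longrightarrow> f x = z x + g x" and h: "\<And>x. x \<in> {0..1} \<Longrightarrow> h x = w x + k x"
  shows "norm_H3 (f, h) \<le> 4 * h1_norm z + 2 * l2_norm w + 10 * G"
proof -
  obtain z' where z': "has_h1_deriv z z'" using z by (rule H1_obtain)
  have G: "0 \<le> G" using b[of 0] by auto
  have "l2_norm g \<le> G" "l2_norm g' \<le> G" "l2_norm k \<le> G"
    using b G has_h1_deriv_L2[OF g] k by (auto intro!: l2_norm_bounded)
  then have g1: "h1_norm g \<le> 2 * G" and k1: "l2_norm k \<le> G" using h1_norm_le[OF g] by auto
  have "h1_norm f = h1_norm (\<lambda>x. z x + g x)" using f by (rule h1_norm_cong)
  also have "\<dots> \<le> 4 * (h1_norm z + h1_norm g)" by (rule h1_norm_add_le[OF z' g])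
  finally have 1: "h1_norm f \<le> 4 * (h1_norm z + h1_norm g)" .
  have "l2_norm h = l2_norm (\<lambda>x. w x + k x)" using h by (rule l2_norm_cong)
  also have "\<dots> \<le> 2 * (l2_norm w + l2_norm k)" by (rule l2_norm_add_le[OF w k])
  finally have 2: "l2_norm h \<le> 2 * (l2_norm w + l2_norm k)" .
  show ?thesis using norm_H3_le[of f h] 1 2 g1 k1 unfolding distrib_left by linarith
qed

lemma norm_H3_cong:
  assumes "eq_H3 X Y" "X \<in> H3" "Y \<in> H3"
  shows "norm_H3 X = norm_H3 Y"
proof -
  obtain f g f' g' where X: "X = (f, g)" "Y = (f', g')" by (metis surj_pair)
  have "h1_norm f = h1_norm f'" using assms(1) by (intro h1_norm_cong) (auto simp: X eq_H3_def h1_eq_def)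
  moreover have "l2_norm g = l2_norm g'" using assms by (intro l2_norm_cong_AE) (auto simp: X eq_H3_def H3_def)
  ultimately show ?thesis by (simp add: X norm_H3_def)
qed

lemma eq_H3_trans: "eq_H3 X Y \<Longrightarrow> eq_H3 Y Z \<Longrightarrow> eq_H3 X Z"
  and eq_H3_sym: "eq_H3 X Y \<Longrightarrow> eq_H3 Y X"
  by (auto simp: eq_H3_def h1_eq_def l2_eq_def split: prod.splits)

lemma estimation_error_cong:
  "eq_H4 \<Phi> \<Phi>' \<Longrightarrow> eq_H3 (estimation_error f1 \<theta> d \<Phi> dh \<theta>h) (estimation_error f1 \<theta> d \<Phi>' dh \<theta>h)"
  by (auto simp: eq_H4_def eq_H3_def estimation_error_def h1_eq_def l2_eq_def split: prod.splits)

section \<open>The disturbance in canonical coordinates\<close>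

lemma oscillator_bounded:
  fixes d1 d2 :: "real \<Rightarrow> real"
  assumes \<omega>: "0 < \<omega>"
    and d1: "\<And>s. 0 \<le> s \<Longrightarrow> (d1 has_real_derivative d2 s) (at s within {0..})"
    and d2: "\<And>s. 0 \<le> s \<Longrightarrow> (d2 has_real_derivative - \<omega>\<^sup>2 * d1 s) (at s within {0..})"
  obtains D where "0 \<le> D" "\<And>s. 0 \<le> s \<Longrightarrow> \<bar>d1 s\<bar> \<le> D" "\<And>s. 0 \<le> s \<Longrightarrow> \<bar>d2 s\<bar> \<le> D"
proof -
  have "\<exists>C. \<forall>s\<in>{0..}. \<omega>\<^sup>2 * (d1 s)\<^sup>2 + (d2 s)\<^sup>2 = C"
  proof (rule has_field_derivative_zero_constant)
    fix s :: real assume "s \<in> {0..}"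
    then show "((\<lambda>s. \<omega>\<^sup>2 * (d1 s)\<^sup>2 + (d2 s)\<^sup>2) has_field_derivative 0) (at s within {0..})"
      using d1[of s] d2[of s] by (auto intro!: derivative_eq_intros)
  qed auto
  then obtain C where C: "\<And>s. 0 \<le> s \<Longrightarrow> \<omega>\<^sup>2 * (d1 s)\<^sup>2 + (d2 s)\<^sup>2 = C" by auto
  have "\<bar>d1 s\<bar> \<le> sqrt C / \<omega> \<and> \<bar>d2 s\<bar> \<le> sqrt C" if "0 \<le> s" for s
  proof -
    have "0 \<le> \<omega>\<^sup>2 * (d1 s)\<^sup>2" "0 \<le> (d2 s)\<^sup>2" by auto
    then have "(\<omega> * \<bar>d1 s\<bar>)\<^sup>2 \<le> C" "\<bar>d2 s\<bar>\<^sup>2 \<le> C"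
      using C[OF that] unfolding power_mult_distrib power2_abs by linarith+
    then have "\<omega> * \<bar>d1 s\<bar> \<le> sqrt C" "\<bar>d2 s\<bar> \<le> sqrt C" by (auto intro: real_le_rsqrt)
    then show ?thesis using \<omega> by (simp add: field_simps)
  qed
  then show ?thesis
    using that[of "max 0 (max (sqrt C / \<omega>) (sqrt C))"] by (auto simp: le_max_iff_disj)
qed

text \<open>\<open>T\<close> conjugates \<open>S_eta \<omega>\<close> to companion form, so
  \<open>d\<close> is a harmonic oscillator in its first component. Being invertible,
  \<open>T\<close> does not annihilate the nonzero initial value; this is the source of the
  excitation.\<close>

lemma canonical_disturbance:
  assumes dist: "disturbance \<omega> A B \<eta>" and can: "canonical_transformation \<omega> \<theta> g1 T"
    and AB: "A\<^sup>2 + B\<^sup>2 > 0" and d: "\<And>s. d s = T *v \<eta> s" and s: "0 \<le> s"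
  shows "((\<lambda>s. d s $ 1) has_real_derivative d s $ 2) (at s within {0..})"
    and "((\<lambda>s. d s $ 2) has_real_derivative - \<theta> * d s $ 1) (at s within {0..})"
    and "d 0 $ 1 \<noteq> 0 \<or> d 0 $ 2 \<noteq> 0"
proof -
  have inv: "invertible T" and S: "S_c \<theta> = T ** S_eta \<omega> ** matrix_inv T"
    using can by (auto simp: canonical_transformation_def)
  have TT: "matrix_inv T ** T = mat 1" 
    using someI_ex[OF inv[unfolded invertible_def]] unfolding matrix_inv_def by blast
  have "((\<lambda>s. T *v \<eta> s) has_vector_derivative T *v (S_eta \<omega> *v \<eta> s)) (at s within {0..})"
    using dist s by (intro bounded_linear.has_vector_derivative[OF matrix_vector_mul_bounded_linear])
      (auto simp: disturbance_def)
  moreover have "T *v (S_eta \<omega> *v \<eta> s) = S_c \<theta> *v d s"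
  proof -
    have "S_c \<theta> *v d s = (T ** S_eta \<omega> ** (matrix_inv T ** T)) *v \<eta> s"
      unfolding S d by (simp only: matrix_vector_mul_assoc matrix_mul_assoc)
    then show ?thesis by (simp add: TT matrix_vector_mul_assoc)
  qed
  ultimately have dd: "(d has_vector_derivative S_c \<theta> *v d s) (at s within {0..})"
  proof -
    have "d = (\<lambda>s. T *v \<eta> s)" using d by (rule ext)
    then show "((\<lambda>s. T *v \<eta> s) has_vector_derivative T *v (S_eta \<omega> *v \<eta> s)) (at s within {0..}) \<Longrightarrow>
      T *v (S_eta \<omega> *v \<eta> s) = S_c \<theta> *v d s \<Longrightarrow> ?thesis" by simp
  qed
  have comp: "((\<lambda>s. d s $ i) has_real_derivative (S_c \<theta> *v d s) $ i) (at s within {0..})" for i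
    using bounded_linear.has_vector_derivative[OF bounded_linear_vec_nth dd]
    by (simp add: has_real_derivative_iff_has_vector_derivative)
  have c: "(S_c \<theta> *v d s) $ 1 = d s $ 2" "(S_c \<theta> *v d s) $ 2 = - \<theta> * d s $ 1"
    by (simp_all add: S_c_def matrix_vector_mult_def sum_2 vector_2)
  show "((\<lambda>s. d s $ 1) has_real_derivative d s $ 2) (at s within {0..})"
    "((\<lambda>s. d s $ 2) has_real_derivative - \<theta> * d s $ 1) (at s within {0..})"
    using comp[of 1] comp[of 2] unfolding c by auto
  show "d 0 $ 1 \<noteq> 0 \<or> d 0 $ 2 \<noteq> 0"
  proof (rule ccontr)
    assume "\<not> ?thesis"
    then have "T *v \<eta> 0 = 0" using d[of 0] by (simp add: vec_eq_iff forall_2)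
    then have "(matrix_inv T ** T) *v \<eta> 0 = 0" by (metis matrix_vector_mul_assoc matrix_vector_mult_0_right)
    then have "\<eta> 0 = 0" by (simp add: TT)
    moreover have "\<eta> 0 = vector [A, B]" using dist by (simp add: disturbance_def)
    ultimately have "A = 0" "B = 0" by (metis vector_2(1) zero_index, metis vector_2(2) zero_index)
    then show False using AB by simp
  qed
qed

theorem theorem2p1:
  fixes \<tau> q c2 \<iota> k0 k1 \<omega> \<theta> A B :: real
    and \<eta> d g1 g2 :: "real \<Rightarrow> real^2"
    and T :: "real^2^2"
    and f1 :: "real \<Rightarrow> real \<Rightarrow> real^2"
    and e0 e1 z0 w0 Y0 :: "real \<Rightarrow> real"
    and \<xi>0 chi0 \<phi>0 \<theta>h0 :: real
  assumes "\<tau> > 0" and "q > 0" and "0 < c2" and "c2 < 1"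
    and "\<iota> > 0" and "k0 > 1 / (4 * \<iota>)" and "k1 > 0"
    and "\<omega> > 0" and "\<theta> = \<omega>\<^sup>2" and "A\<^sup>2 + B\<^sup>2 > 0"
    and "disturbance \<omega> A B \<eta>"
    and "decoupling \<omega> c2 g1 g2"
    and "canonical_transformation \<omega> \<theta> g1 T"
    and "\<And>s. d s = T *v \<eta> s"
    and "output_profile f1"
    and "(z0, w0, Y0) \<in> H4 c2"
    and "(e0, e1) \<in> H3"
    and "eq_H3 (e0, e1)
           (estimation_error f1 \<theta> (d 0) (z0, w0, Y0) (d_hat \<iota> \<xi>0 chi0 \<phi>0 \<theta>h0) \<theta>h0)"
  shows "\<exists>M3 > 0. \<exists>\<mu>3 > 0. \<forall>t > \<tau>.
     (\<exists>E. error_solution c2 \<iota> k0 k1 \<theta> f1 d (z0, w0, Y0) \<xi>0 chi0 \<phi>0 \<theta>h0 (e0, e1) (t - \<tau>) E) \<and>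
     (\<forall>E E'. error_solution c2 \<iota> k0 k1 \<theta> f1 d (z0, w0, Y0) \<xi>0 chi0 \<phi>0 \<theta>h0 (e0, e1) (t - \<tau>) E \<longrightarrow>
             error_solution c2 \<iota> k0 k1 \<theta> f1 d (z0, w0, Y0) \<xi>0 chi0 \<phi>0 \<theta>h0 (e0, e1) (t - \<tau>) E' \<longrightarrow>
             (\<forall>s\<in>{0..t - \<tau>}. eq_H3 (E s) (E' s))) \<and>
     (\<forall>E. error_solution c2 \<iota> k0 k1 \<theta> f1 d (z0, w0, Y0) \<xi>0 chi0 \<phi>0 \<theta>h0 (e0, e1) (t - \<tau>) E \<longrightarrow>
          (\<forall>s\<in>{0..t - \<tau>}. norm_H3 (E s) \<le> M3 * exp (- \<mu>3 * s)))"
proof -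
  let ?sol = "error_solution c2 \<iota> k0 k1 \<theta> f1 d (z0, w0, Y0) \<xi>0 chi0 \<phi>0 \<theta>h0 (e0, e1)"
  have k0: "0 < k0" using assms(5,6) by (smt (verit) divide_pos_pos)
  have dd: "((\<lambda>s. d s $ 1) has_real_derivative d s $ 2) (at s within {0..})"
    "((\<lambda>s. d s $ 2) has_real_derivative - \<omega>\<^sup>2 * d s $ 1) (at s within {0..})" if "0 \<le> s" for s
    using canonical_disturbance[OF assms(11,13,10,14) that] assms(9) by auto
  have d0: "d 0 $ 1 \<noteq> 0 \<or> d 0 $ 2 \<noteq> 0"
    using canonical_disturbance(3)[OF assms(11,13,10,14), of 0] by simp
  obtain D where D: "0 \<le> D" "\<And>s. 0 \<le> s \<Longrightarrow> \<bar>d s $ 1\<bar> \<le> D" "\<And>s. 0 \<le> s \<Longrightarrow> \<bar>d s $ 2\<bar> \<le> D"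
    by (rule oscillator_bounded[OF assms(8) dd]) (assumption | rule that)+
  obtain C C' where C: "\<And>\<nu> x d. x \<in> {0..1} \<Longrightarrow> f1 \<nu> x \<bullet> d = C \<nu> x * d $ 1"
    "\<And>\<nu> x d. x \<in> {0..1} \<Longrightarrow> (f1 \<nu> x v* S_c \<nu>) \<bullet> d = C \<nu> x * d $ 2"
    and CH: "\<And>\<nu>. has_h1_deriv (C \<nu>) (C' \<nu>)"
    and CB: "\<And>N. \<exists>B\<ge>0. \<forall>\<nu> \<nu>' x. \<bar>\<nu>\<bar> \<le> N \<longrightarrow> \<bar>\<nu>'\<bar> \<le> N \<longrightarrow> x \<in> {0..1} \<longrightarrow>
        \<bar>C \<nu> x\<bar> \<le> B \<and> \<bar>C' \<nu> x\<bar> \<le> B \<and>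
        \<bar>C \<nu> x - C \<nu>' x\<bar> \<le> B * \<bar>\<nu> - \<nu>'\<bar> \<and> \<bar>C' \<nu> x - C' \<nu>' x\<bar> \<le> B * \<bar>\<nu> - \<nu>'\<bar>"
    by (rule output_profile_scalar[OF assms(15)]) (assumption | rule that)+
  define \<kappa> where "\<kappa> = 2 * c2 - 1"
  \<comment> \<open>Bounded away from 0, so that \<open>ln k\<close> is meaningful also for
    \<open>c2 = 1 / 2\<close>, where \<open>\<kappa>\<close> vanishes.\<close>
  define k where "k = max \<bar>\<kappa>\<bar> (1 / 2)"
  have k: "0 < k" "k < 1" "\<bar>\<kappa>\<bar> \<le> k" using assms(3,4) by (auto simp: k_def \<kappa>_def)
  \<comment> \<open>The first entry converts the factor \<open>k\<close> per two time units into a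
    rate; the second keeps \<open>\<mu>\<close> below \<open>\<iota>\<close>, the rate of the
    observer filters.\<close>
  define \<mu> where "\<mu> = min (- ln k / 2) (\<iota> / 2)"
  have \<mu>: "0 < \<mu>" "\<mu> < \<iota>" using k assms(5) by (auto simp: \<mu>_def)
  have "ln k \<le> - 2 * \<mu>" by (simp add: \<mu>_def)
  then have "exp (ln k) \<le> exp (- 2 * \<mu>)" by (simp only: exp_le_cancel_iff)
  then have \<kappa>: "\<bar>\<kappa>\<bar> \<le> exp (- 2 * \<mu>)" using k by simp
  obtain a \<alpha> y \<upsilon> where a: "locH1 a \<alpha>" and y: "locH1 y \<upsilon>"
    and data: "\<And>x. x \<in> {0..1} \<Longrightarrow> (a x + a (- x)) / 2 = z0 x"
      "l2_eq (\<lambda>x. (\<alpha> x + \<alpha> (- x)) / 2) w0" "\<And>x. x \<in> {0..1} \<Longrightarrow> y (- x) = Y0 x"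
      "\<And>s. 0 \<le> s \<Longrightarrow> a (s + 1) + a (s - 1) = - 2 * y (s - 1)" "\<And>s. 0 \<le> s \<Longrightarrow> y s = - c2 * a s"
    and rec: "\<And>s. 0 \<le> s \<Longrightarrow> a (s + 2) = (2 * c2 - 1) * a s" "\<And>s. 0 \<le> s \<Longrightarrow> \<alpha> (s + 2) = (2 * c2 - 1) * \<alpha> s"
    by (rule dAlembert_data[OF assms(16)]) (assumption | rule that)+
  define \<Phi> where "\<Phi> = dAlembert_state a \<alpha> y"
  \<comment> \<open>One explicit state serves every horizon \<open>S\<close>, so constants derived
    from it are independent of \<open>t\<close>.\<close>
  have mild: "mild_solution c2 S (z0, w0, Y0) \<Phi>" for S
    unfolding \<Phi>_def by (rule dAlembert_mild_solution[OF a y data])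
  define z where "z s x = (a (s + x) + a (s - x)) / 2" for s x
  define w where "w s x = (\<alpha> (s + x) + \<alpha> (s - x)) / 2" for s x
  have \<Phi>: "\<Phi> s = (z s, w s, \<lambda>x. y (s - x))" for s
    by (simp add: \<Phi>_def dAlembert_state_def z_def[abs_def] w_def[abs_def])
  obtain M1 where M1: "0 \<le> M1" "\<And>s. 0 \<le> s \<Longrightarrow> \<bar>a s\<bar> \<le> M1 * exp (- \<mu> * s)"
    "\<And>s. 0 \<le> s \<Longrightarrow> h1_norm (z s) \<le> M1 * exp (- \<mu> * s)" "\<And>s. 0 \<le> s \<Longrightarrow> l2_norm (w s) \<le> M1 * exp (- \<mu> * s)"
    by (rule dAlembert_decay[OF a \<kappa> less_imp_le[OF \<mu>(1)] rec[folded \<kappa>_def]])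
      (assumption | rule that[unfolded z_def[abs_def] w_def[abs_def]])+
  have zH: "z s \<in> H1" and wL: "w s \<in> L2" if "0 \<le> s" for s
  proof -
    have "\<Phi> s \<in> H4 c2" using mild[of s] that unfolding mild_solution_def continuous_into_def by auto
    then show "z s \<in> H1" "w s \<in> L2" by (auto simp: \<Phi> H4_def)
  qed
  obtain M2 \<nu> where M2: "0 \<le> M2" and \<nu>: "0 < \<nu>" "\<nu> \<le> \<mu>"
    and conv: "\<And>S \<xi> chi \<phi> \<theta>h s. \<lbrakk>adaptive_observer \<iota> k0 k1 S (\<lambda>s. d s $ 1 + a s) \<xi> chi \<phi> \<theta>h;
        \<xi> 0 = \<xi>0; chi 0 = chi0; \<phi> 0 = \<phi>0; \<theta>h 0 = \<theta>h0; s \<in> {0..S}\<rbrakk> \<Longrightarrow>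
      \<bar>d s $ 1 - chi s\<bar> \<le> M2 * exp (- \<nu> * s) \<and> \<bar>\<omega>\<^sup>2 - \<theta>h s\<bar> \<le> M2 * exp (- \<nu> * s) \<and>
      \<bar>d s $ 2 - (\<phi> s + \<xi> s * \<theta>h s + \<iota> * chi s)\<bar> \<le> M2 * exp (- \<nu> * s)"
    by (rule adaptive_observer_convergence[OF assms(5) k0 assms(7,8) \<mu> M1(1) dd d0 M1(2)]) (assumption | rule that)+
  \<comment> \<open>\<open>conv\<close> keeps \<open>\<theta>h\<close> within \<open>M2\<close> of
    \<open>\<theta>\<close>; on the resulting range of \<open>\<nu>\<close> the profile is Lipschitz
    with a constant independent of the horizon.\<close>
  obtain Bn where Bn: "0 \<le> Bn" "\<And>\<nu> \<nu>' x. \<bar>\<nu>\<bar> \<le> \<theta> + M2 \<Longrightarrow> \<bar>\<nu>'\<bar> \<le> \<theta> + M2 \<Longrightarrow> x \<in> {0..1} \<Longrightarrow>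
        \<bar>C \<nu> x\<bar> \<le> Bn \<and> \<bar>C' \<nu> x\<bar> \<le> Bn \<and>
        \<bar>C \<nu> x - C \<nu>' x\<bar> \<le> Bn * \<bar>\<nu> - \<nu>'\<bar> \<and> \<bar>C' \<nu> x - C' \<nu>' x\<bar> \<le> Bn * \<bar>\<nu> - \<nu>'\<bar>"
    using CB[of "\<theta> + M2"] by metis
  \<comment> \<open>Arranged so that, apart from differences, only \<open>v\<close> and
    \<open>p\<close> have to be bounded; in the decay estimate \<open>p\<close> is a component of
    the bounded \<open>d\<close>.\<close>
  have lin: "\<bar>u * p - v * r\<bar> \<le> B * \<bar>p - r\<bar> + B * \<delta> * \<bar>p\<bar>"
    if "\<bar>v\<bar> \<le> B" "\<bar>u - v\<bar> \<le> B * \<delta>" for u v p r B \<delta> :: real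
  proof -
    have "u * p - v * r = v * (p - r) + (u - v) * p" by (simp add: algebra_simps)
    then have "\<bar>u * p - v * r\<bar> \<le> \<bar>v\<bar> * \<bar>p - r\<bar> + \<bar>u - v\<bar> * \<bar>p\<bar>"
      unfolding abs_mult[symmetric] by linarith
    also have "\<dots> \<le> B * \<bar>p - r\<bar> + B * \<delta> * \<bar>p\<bar>" using that by (intro add_mono mult_right_mono) auto
    finally show ?thesis .
  qed
  let ?err = "\<lambda>\<xi> chi \<phi> \<theta>h s. estimation_error f1 \<theta> (d s) (\<Phi> s) (d_hat \<iota> (\<xi> s) (chi s) (\<phi> s) (\<theta>h s)) (\<theta>h s)"
  define obs where "obs S \<xi> chi \<phi> \<theta>h \<longleftrightarrow> adaptive_observer \<iota> k0 k1 S (\<lambda>s. d s $ 1 + a s) \<xi> chi \<phi> \<theta>h \<and>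
      \<xi> 0 = \<xi>0 \<and> chi 0 = chi0 \<and> \<phi> 0 = \<phi>0 \<and> \<theta>h 0 = \<theta>h0" for S \<xi> chi \<phi> \<theta>h
  have gd: "gamma_eta \<bullet> v = v $ 1" for v by (simp add: gamma_eta_def inner_vec_def sum_2 vector_2)
  have \<Phi>a: "fst (\<Phi> s) 0 = a s" for s by (simp add: \<Phi> z_def)
  define dh2 where "dh2 \<xi> chi \<phi> \<theta>h s = \<phi> s + \<xi> s * \<theta>h s + \<iota> * chi s" for \<xi> chi \<phi> \<theta>h :: "real \<Rightarrow> real" and s
  have err: "fst (?err \<xi> chi \<phi> \<theta>h s) x = z s x + (C \<theta> x * d s $ 1 - C (\<theta>h s) x * chi s)"
    "snd (?err \<xi> chi \<phi> \<theta>h s) x = w s x + (C \<theta> x * d s $ 2 - C (\<theta>h s) x * dh2 \<xi> chi \<phi> \<theta>h s)"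
    if "x \<in> {0..1}" for \<xi> chi \<phi> \<theta>h s x
    using C[OF that] by (simp_all add: estimation_error_def \<Phi> d_hat_def vector_2 dh2_def)
  have CL: "(\<lambda>x. C \<theta> x * p - C \<nu> x * r) \<in> L2" and CD: "has_h1_deriv (\<lambda>x. C \<theta> x * p - C \<nu> x * r) (\<lambda>x. C' \<theta> x * p - C' \<nu> x * r)" for \<nu> p r
  proof -
    show h: "has_h1_deriv (\<lambda>x. C \<theta> x * p - C \<nu> x * r) (\<lambda>x. C' \<theta> x * p - C' \<nu> x * r)"
      using has_h1_deriv_diff[OF has_h1_deriv_cmult[OF CH, of p] has_h1_deriv_cmult[OF CH, of r]]
      by (simp add: mult.commute)
    show "(\<lambda>x. C \<theta> x * p - C \<nu> x * r) \<in> L2" by (rule has_h1_deriv_L2(1)[OF h])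
  qed
  have errH: "?err \<xi> chi \<phi> \<theta>h s \<in> H3" if "0 \<le> s" for \<xi> chi \<phi> \<theta>h s
  proof -
    let ?E = "?err \<xi> chi \<phi> \<theta>h s"
    have "(\<lambda>x. z s x + (C \<theta> x * d s $ 1 - C (\<theta>h s) x * chi s)) \<in> H1"
      by (intro H1_add zH that has_h1_deriv_H1[OF CD])
    then obtain g where g: "has_h1_deriv (\<lambda>x. z s x + (C \<theta> x * d s $ 1 - C (\<theta>h s) x * chi s)) g" by (rule H1_obtain)
    have "has_h1_deriv (fst ?E) g" by (rule has_h1_deriv_cong[OF g]) (simp_all add: err)
    then have "fst ?E \<in> H1" by (rule has_h1_deriv_H1)
    moreover have "(\<lambda>x. w s x + (C \<theta> x * d s $ 2 - C (\<theta>h s) x * dh2 \<xi> chi \<phi> \<theta>h s)) \<in> L2"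
      by (intro L2_add wL that CL)
    then have "snd ?E \<in> L2"
      by (subst L2_cong[where g = "\<lambda>x. w s x + (C \<theta> x * d s $ 2 - C (\<theta>h s) x * dh2 \<xi> chi \<phi> \<theta>h s)"]) (simp_all add: err)
    ultimately show ?thesis unfolding H3_def by (metis mem_Sigma_iff prod.collapse)
  qed
  \<comment> \<open>The 6 is \<open>4 + 2\<close> from the wave terms of
    \<open>norm_H3_perturbation_le\<close>, the 10 belongs to the profile terms, and the 1 makes the
    constant positive.\<close>
  define M3 where "M3 = 6 * M1 + 10 * (Bn * M2 + Bn * M2 * D) + 1"
  have M3: "0 < M3" using M1(1) M2 Bn(1) D(1) unfolding M3_def by (intro add_nonneg_pos add_nonneg_nonneg mult_nonneg_nonneg) auto
  have bound: "norm_H3 (?err \<xi> chi \<phi> \<theta>h s) \<le> M3 * exp (- \<nu> * s)"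
    if o: "obs S \<xi> chi \<phi> \<theta>h" and s: "s \<in> {0..S}" for S \<xi> chi \<phi> \<theta>h s
  proof -
    let ?e = "exp (- \<nu> * s)"
    have s0: "0 \<le> s" using s by simp
    have e1: "?e \<le> 1" using s0 \<nu> by simp
    have cv: "\<bar>d s $ 1 - chi s\<bar> \<le> M2 * ?e" "\<bar>\<theta> - \<theta>h s\<bar> \<le> M2 * ?e" "\<bar>d s $ 2 - dh2 \<xi> chi \<phi> \<theta>h s\<bar> \<le> M2 * ?e"
      using conv[of S \<xi> chi \<phi> \<theta>h s] o s assms(9) unfolding obs_def dh2_def by auto
    have "M2 * ?e \<le> M2 * 1" using e1 M2 by (intro mult_left_mono) auto
    moreover have "0 \<le> \<theta>" using assms(9) by simp
    ultimately have n: "\<bar>\<theta>h s\<bar> \<le> \<theta> + M2" "\<bar>\<theta>\<bar> \<le> \<theta> + M2" using cv(2) M2 by linarith+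
    define G where "G = (Bn * M2 + Bn * M2 * D) * ?e"
    have G: "\<bar>u * p - v * r\<bar> \<le> G"
      if "\<bar>v\<bar> \<le> Bn" "\<bar>u - v\<bar> \<le> Bn * \<bar>\<theta> - \<theta>h s\<bar>" "\<bar>p - r\<bar> \<le> M2 * ?e" "\<bar>p\<bar> \<le> D" for u v p r
    proof -
      have "\<bar>u * p - v * r\<bar> \<le> Bn * \<bar>p - r\<bar> + Bn * \<bar>\<theta> - \<theta>h s\<bar> * \<bar>p\<bar>" by (rule lin[OF that(1,2)])
      also have "\<dots> \<le> Bn * (M2 * ?e) + Bn * (M2 * ?e) * D"
        using that cv Bn(1) M2 by (intro add_mono mult_mono) auto
      also have "\<dots> = G" by (simp add: G_def algebra_simps)
      finally show ?thesis .
    qed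
    have "norm_H3 (fst (?err \<xi> chi \<phi> \<theta>h s), snd (?err \<xi> chi \<phi> \<theta>h s)) \<le> 4 * h1_norm (z s) + 2 * l2_norm (w s) + 10 * G"
    proof (rule norm_H3_perturbation_le[OF zH[OF s0] wL[OF s0] CD CL _ err])
      fix x :: real assume x: "x \<in> {0..1}"
      note b = Bn(2)[OF n(2,1) x] Bn(2)[OF n(1,2) x]
      show "\<bar>C \<theta> x * d s $ 1 - C (\<theta>h s) x * chi s\<bar> \<le> G \<and> \<bar>C' \<theta> x * d s $ 1 - C' (\<theta>h s) x * chi s\<bar> \<le> G \<and>
        \<bar>C \<theta> x * d s $ 2 - C (\<theta>h s) x * dh2 \<xi> chi \<phi> \<theta>h s\<bar> \<le> G"
        using b by (intro conjI G cv D s0) auto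
    qed
    also have "\<dots> \<le> 4 * (M1 * ?e) + 2 * (M1 * ?e) + 10 * G"
    proof -
      have "- \<mu> * s \<le> - \<nu> * s" using \<nu>(2) s0 by (simp add: mult_right_mono)
      then have "M1 * exp (- \<mu> * s) \<le> M1 * ?e" using M1(1) by (intro mult_left_mono) auto
      then show ?thesis using M1(3)[OF s0] M1(4)[OF s0] by linarith
    qed
    also have "\<dots> = (M3 - 1) * ?e" by (simp add: G_def M3_def algebra_simps)
    also have "\<dots> \<le> M3 * ?e" by simp
    finally show ?thesis by simp
  qed
  \<comment> \<open>A solution may carry its own mild solution. Uniqueness identifies it with
    \<open>\<Phi>\<close>, and since equality in \<open>H4\<close> includes the boundary value at
    \<open>x = 0\<close>, the observer receives the same input.\<close>
  have char: "\<exists>\<xi> chi \<phi> \<theta>h. obs S \<xi> chi \<phi> \<theta>h \<and> (\<forall>s\<in>{0..S}. eq_H3 (E s) (?err \<xi> chi \<phi> \<theta>h s))"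
    if sol: "?sol S E" for S E
  proof -
    obtain \<Phi>' \<xi> chi \<phi> \<theta>h where m: "mild_solution c2 S (z0, w0, Y0) \<Phi>'"
      and ob: "adaptive_observer \<iota> k0 k1 S (\<lambda>s. gamma_eta \<bullet> d s + fst (\<Phi>' s) 0) \<xi> chi \<phi> \<theta>h"
      and init: "\<xi> 0 = \<xi>0" "chi 0 = chi0" "\<phi> 0 = \<phi>0" "\<theta>h 0 = \<theta>h0"
      and E: "\<And>s. s \<in> {0..S} \<Longrightarrow> eq_H3 (E s) (estimation_error f1 \<theta> (d s) (\<Phi>' s) (d_hat \<iota> (\<xi> s) (chi s) (\<phi> s) (\<theta>h s)) (\<theta>h s))"
      using sol unfolding error_solution_def by blast
    have eq: "eq_H4 (\<Phi>' s) (\<Phi> s)" if "s \<in> {0..S}" for s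
      using mild_solution_unique[OF m mild that] .
    have "fst (\<Phi>' s) 0 = a s" if "s \<in> {0..S}" for s
      using eq[OF that] \<Phi>a[of s] by (auto simp: eq_H4_def h1_eq_def \<Phi> split: prod.splits)
    then have "adaptive_observer \<iota> k0 k1 S (\<lambda>s. d s $ 1 + a s) \<xi> chi \<phi> \<theta>h"
      using ob unfolding adaptive_observer_def gd by simp
    then have "obs S \<xi> chi \<phi> \<theta>h" using init by (simp add: obs_def)
    moreover have "eq_H3 (E s) (?err \<xi> chi \<phi> \<theta>h s)" if "s \<in> {0..S}" for s
      using eq_H3_trans[OF E[OF that] estimation_error_cong[OF eq[OF that]]] .
    ultimately show ?thesis by blast
  qed
  have exist: "\<exists>E. ?sol S E" if S: "0 < S" for S
  proof -
    have dc: "continuous_on {0..S} (\<lambda>s. d s $ 1)" "continuous_on {0..S} (\<lambda>s. d s $ 2)"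
      by (rule DERIV_continuous_on[OF DERIV_subset[OF dd(1)]]; simp)
         (rule DERIV_continuous_on[OF DERIV_subset[OF dd(2)]]; auto)
    have yc: "continuous_on {0..S} (\<lambda>s. d s $ 1 + a s)"
      by (intro continuous_on_add dc locH1_continuous[OF a])
    obtain \<xi> chi \<phi> \<theta>h where ob: "adaptive_observer \<iota> k0 k1 S (\<lambda>s. d s $ 1 + a s) \<xi> chi \<phi> \<theta>h"
      and init: "\<xi> 0 = \<xi>0" "chi 0 = chi0" "\<phi> 0 = \<phi>0" "\<theta>h 0 = \<theta>h0"
      by (rule adaptive_observer_exists[OF yc less_imp_le[OF S]]) (rule that)
    note o = ob[unfolded adaptive_observer_def, rule_format]
    have oc: "continuous_on {0..S} \<xi>" "continuous_on {0..S} chi" "continuous_on {0..S} \<phi>" "continuous_on {0..S} \<theta>h"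
      by (rule DERIV_continuous_on, use o in blast)+
    let ?E = "?err \<xi> chi \<phi> \<theta>h"
    let ?dh2 = "dh2 \<xi> chi \<phi> \<theta>h"
    have dhc: "continuous_on {0..S} ?dh2" unfolding dh2_def by (intro continuous_intros oc)
    have "bounded (\<theta>h ` {0..S})" by (intro compact_imp_bounded compact_continuous_image oc) auto
    then obtain N where N: "\<And>s. s \<in> {0..S} \<Longrightarrow> \<bar>\<theta>h s\<bar> \<le> N" unfolding bounded_iff by fastforce
    \<comment> \<open>On a bounded horizon continuity already bounds \<open>\<theta>h\<close>; this
      fixes the Lipschitz constant for continuity in time.\<close>
    define N' where "N' = max N \<theta>"
    obtain B where B: "0 \<le> B" "\<And>\<nu> \<nu>' x. \<bar>\<nu>\<bar> \<le> N' \<Longrightarrow> \<bar>\<nu>'\<bar> \<le> N' \<Longrightarrow> x \<in> {0..1} \<Longrightarrow>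
        \<bar>C \<nu> x\<bar> \<le> B \<and> \<bar>C' \<nu> x\<bar> \<le> B \<and>
        \<bar>C \<nu> x - C \<nu>' x\<bar> \<le> B * \<bar>\<nu> - \<nu>'\<bar> \<and> \<bar>C' \<nu> x - C' \<nu>' x\<bar> \<le> B * \<bar>\<nu> - \<nu>'\<bar>"
      using CB[of N'] by metis
    have \<theta>N: "\<bar>\<theta>\<bar> \<le> N'" using assms(9) by (simp add: N'_def)
    have hN: "\<bar>\<theta>h s\<bar> \<le> N'" if "s \<in> {0..S}" for s using N[OF that] by (simp add: N'_def)
    have cont: "((\<lambda>r. norm_H3 (?E r - ?E s)) \<longlongrightarrow> 0) (at s within {0..S})" if s: "s \<in> {0..S}" for s
    proof (rule Lim_null_comparison)
      let ?G = "\<lambda>r. B * \<bar>d r $ 1 - d s $ 1\<bar> + B * \<bar>d r $ 2 - d s $ 2\<bar> + (B * \<bar>chi r - chi s\<bar> + B * \<bar>\<theta>h r - \<theta>h s\<bar> * \<bar>chi r\<bar>)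
          + (B * \<bar>?dh2 r - ?dh2 s\<bar> + B * \<bar>\<theta>h r - \<theta>h s\<bar> * \<bar>?dh2 r\<bar>)"
      let ?g = "\<lambda>r. 6 * norm_H4 (\<Phi> r - \<Phi> s) + 10 * ?G r"
      have lim: "(h \<longlongrightarrow> h s) (at s within {0..S})" if "continuous_on {0..S} h" for h :: "real \<Rightarrow> real"
        using that s by (simp add: continuous_on_def)
      have m0: "((\<lambda>r. norm_H4 (\<Phi> r - \<Phi> s)) \<longlongrightarrow> 0) (at s within {0..S})"
        using mild[of S] s unfolding mild_solution_def continuous_into_def by auto
      have "(?g \<longlongrightarrow> 6 * 0 + 10 * (B * \<bar>d s $ 1 - d s $ 1\<bar> + B * \<bar>d s $ 2 - d s $ 2\<bar> + (B * \<bar>chi s - chi s\<bar> + B * \<bar>\<theta>h s - \<theta>h s\<bar> * \<bar>chi s\<bar>)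
          + (B * \<bar>?dh2 s - ?dh2 s\<bar> + B * \<bar>\<theta>h s - \<theta>h s\<bar> * \<bar>?dh2 s\<bar>))) (at s within {0..S})"
        by (intro tendsto_intros m0 lim dc oc dhc)
      then show "(?g \<longlongrightarrow> 0) (at s within {0..S})" by simp
      have "norm (norm_H3 (?E r - ?E s)) \<le> ?g r" if r: "r \<in> {0..S}" for r
      proof -
        have r0: "0 \<le> r" "0 \<le> s" using r s by auto
        \<comment> \<open>Time increment of the profile part of the error, with \<open>K\<close>
          standing for \<open>C\<close> or \<open>C'\<close>, and \<open>p\<close>, \<open>q\<close>
          for a component of \<open>d\<close> and its estimate.\<close>
        define gg where "gg K p p' q q' x = (K \<theta> x * p - K (\<theta>h r) x * q) - (K \<theta> x * p' - K (\<theta>h s) x * q')"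
          for K :: "real \<Rightarrow> real \<Rightarrow> real" and p p' q q' x :: real
        have gb: "\<bar>gg K p p' q q' x\<bar> \<le> B * \<bar>p - p'\<bar> + (B * \<bar>q - q'\<bar> + B * \<bar>\<theta>h r - \<theta>h s\<bar> * \<bar>q\<bar>)"
          if "\<bar>K \<theta> x\<bar> \<le> B" "\<bar>K (\<theta>h s) x\<bar> \<le> B" "\<bar>K (\<theta>h r) x - K (\<theta>h s) x\<bar> \<le> B * \<bar>\<theta>h r - \<theta>h s\<bar>" for K p p' q q' x
        proof -
          have "gg K p p' q q' x = K \<theta> x * (p - p') - (K (\<theta>h r) x * q - K (\<theta>h s) x * q')"
            by (simp add: gg_def algebra_simps)
          then have "\<bar>gg K p p' q q' x\<bar> \<le> \<bar>K \<theta> x\<bar> * \<bar>p - p'\<bar> + \<bar>K (\<theta>h r) x * q - K (\<theta>h s) x * q'\<bar>"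
            unfolding abs_mult[symmetric] by linarith
          also have "\<dots> \<le> B * \<bar>p - p'\<bar> + (B * \<bar>q - q'\<bar> + B * \<bar>\<theta>h r - \<theta>h s\<bar> * \<bar>q\<bar>)"
            using that by (intro add_mono mult_right_mono lin) auto
          finally show ?thesis .
        qed
        have comb: "u' \<le> p' + q' + m' + n' \<and> v' \<le> p' + q' + m' + n' \<and> k' \<le> p' + q' + m' + n'"
          if "0 \<le> p'" "0 \<le> q'" "0 \<le> m'" "0 \<le> n'" "u' \<le> p' + m'" "v' \<le> p' + m'" "k' \<le> q' + n'"
          for u' v' k' p' q' m' n' :: real
          using that by linarith
        have G0: "0 \<le> B * \<bar>d r $ 1 - d s $ 1\<bar>" "0 \<le> B * \<bar>d r $ 2 - d s $ 2\<bar>"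
          "0 \<le> B * \<bar>chi r - chi s\<bar> + B * \<bar>\<theta>h r - \<theta>h s\<bar> * \<bar>chi r\<bar>" "0 \<le> B * \<bar>?dh2 r - ?dh2 s\<bar> + B * \<bar>\<theta>h r - \<theta>h s\<bar> * \<bar>?dh2 r\<bar>"
          using B(1) by auto
        have "norm_H3 (fst (?E r - ?E s), snd (?E r - ?E s)) \<le> 4 * h1_norm (\<lambda>x. z r x - z s x) + 2 * l2_norm (\<lambda>x. w r x - w s x) + 10 * ?G r"
        proof (rule norm_H3_perturbation_le[where g = "gg C (d r $ 1) (d s $ 1) (chi r) (chi s)" and g' = "gg C' (d r $ 1) (d s $ 1) (chi r) (chi s)"
              and k = "gg C (d r $ 2) (d s $ 2) (?dh2 r) (?dh2 s)"])
          show "has_h1_deriv (gg C (d r $ 1) (d s $ 1) (chi r) (chi s)) (gg C' (d r $ 1) (d s $ 1) (chi r) (chi s))"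
            unfolding gg_def[abs_def] by (intro has_h1_deriv_diff CD)
          show "gg C (d r $ 2) (d s $ 2) (?dh2 r) (?dh2 s) \<in> L2"
            unfolding gg_def[abs_def] by (intro L2_diff CL)
          fix x :: real assume x: "x \<in> {0..1}"
          note b = B(2)[OF \<theta>N \<theta>N x] B(2)[OF hN[OF s] \<theta>N x] B(2)[OF hN[OF r] hN[OF s] x]
          have "\<bar>gg C (d r $ 1) (d s $ 1) (chi r) (chi s) x\<bar> \<le> B * \<bar>d r $ 1 - d s $ 1\<bar> + (B * \<bar>chi r - chi s\<bar> + B * \<bar>\<theta>h r - \<theta>h s\<bar> * \<bar>chi r\<bar>)"
            "\<bar>gg C' (d r $ 1) (d s $ 1) (chi r) (chi s) x\<bar> \<le> B * \<bar>d r $ 1 - d s $ 1\<bar> + (B * \<bar>chi r - chi s\<bar> + B * \<bar>\<theta>h r - \<theta>h s\<bar> * \<bar>chi r\<bar>)"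
            "\<bar>gg C (d r $ 2) (d s $ 2) (?dh2 r) (?dh2 s) x\<bar> \<le> B * \<bar>d r $ 2 - d s $ 2\<bar> + (B * \<bar>?dh2 r - ?dh2 s\<bar> + B * \<bar>\<theta>h r - \<theta>h s\<bar> * \<bar>?dh2 r\<bar>)"
            using b by (intro gb; blast)+
          then show "\<bar>gg C (d r $ 1) (d s $ 1) (chi r) (chi s) x\<bar> \<le> ?G r \<and> \<bar>gg C' (d r $ 1) (d s $ 1) (chi r) (chi s) x\<bar> \<le> ?G r \<and>
            \<bar>gg C (d r $ 2) (d s $ 2) (?dh2 r) (?dh2 s) x\<bar> \<le> ?G r"
            by (rule comb[OF G0])
          show "fst (?E r - ?E s) x = (z r x - z s x) + gg C (d r $ 1) (d s $ 1) (chi r) (chi s) x"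
            using err(1)[OF x, where \<xi> = \<xi> and chi = chi and \<phi> = \<phi> and \<theta>h = \<theta>h] by (simp add: gg_def)
          show "snd (?E r - ?E s) x = (w r x - w s x) + gg C (d r $ 2) (d s $ 2) (?dh2 r) (?dh2 s) x"
            using err(2)[OF x, where \<xi> = \<xi> and chi = chi and \<phi> = \<phi> and \<theta>h = \<theta>h] by (simp add: gg_def)
        qed (use zH wL r0 in \<open>auto intro: H1_diff L2_diff\<close>)
        then have E: "norm_H3 (?E r - ?E s) \<le> 4 * h1_norm (\<lambda>x. z r x - z s x) + 2 * l2_norm (\<lambda>x. w r x - w s x) + 10 * ?G r"
          unfolding prod.collapse .
        have "\<Phi> r - \<Phi> s = (\<lambda>x. z r x - z s x, \<lambda>x. w r x - w s x, \<lambda>x. y (r - x) - y (s - x))"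
          by (simp add: \<Phi> fun_eq_iff)
        then have \<Phi>n: "h1_norm (\<lambda>x. z r x - z s x) \<le> norm_H4 (\<Phi> r - \<Phi> s)" "l2_norm (\<lambda>x. w r x - w s x) \<le> norm_H4 (\<Phi> r - \<Phi> s)"
          using le_norm_H4 by auto
        have comb2: "norm n \<le> 6 * m + 10 * g" if "n \<le> 4 * h + 2 * l + 10 * g" "h \<le> m" "l \<le> m" "0 \<le> n"
          for n h l m g :: real
          using that by simp
        show ?thesis by (rule comb2[OF E \<Phi>n norm_H3_nonneg])
      qed
      then show "\<forall>\<^sub>F r in at s within {0..S}. norm (norm_H3 (?E r - ?E s)) \<le> ?g r"
        by (simp add: eventually_at_filter)
    qed
    have "continuous_into H3 norm_H3 S ?E"
      unfolding continuous_into_def using errH cont by auto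
    moreover have "eq_H3 (?E 0) (e0, e1)"
    proof -
      have "eq_H4 (\<Phi> 0) (z0, w0, Y0)" using mild[of S] by (simp add: mild_solution_def)
      then have "eq_H3 (?E 0) (estimation_error f1 \<theta> (d 0) (z0, w0, Y0) (d_hat \<iota> \<xi>0 chi0 \<phi>0 \<theta>h0) \<theta>h0)"
        unfolding init by (rule estimation_error_cong)
      then show ?thesis using eq_H3_trans eq_H3_sym assms(18) by blast
    qed
    moreover have "adaptive_observer \<iota> k0 k1 S (\<lambda>s. gamma_eta \<bullet> d s + fst (\<Phi> s) 0) \<xi> chi \<phi> \<theta>h"
      unfolding gd \<Phi>a by (rule ob)
    moreover have "eq_H3 X X" for X by (auto simp: eq_H3_def h1_eq_def l2_eq_def split: prod.splits)
    ultimately show ?thesis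
      unfolding error_solution_def using mild[of S] init by blast
  qed
  \<comment> \<open>By \<open>char\<close> both solutions are expressed through the same wave state,
    so uniqueness rests on that of the observer variables.\<close>
  have unique: "eq_H3 (E s) (E' s)" if sol: "?sol S E" "?sol S E'" and s: "s \<in> {0..S}" for S E E' s
  proof -
    obtain \<xi> chi \<phi> \<theta>h where 1: "obs S \<xi> chi \<phi> \<theta>h" "eq_H3 (E s) (?err \<xi> chi \<phi> \<theta>h s)"
      using char[OF sol(1)] s by blast
    obtain \<xi>' chi' \<phi>' \<theta>h' where 2: "obs S \<xi>' chi' \<phi>' \<theta>h'" "eq_H3 (E' s) (?err \<xi>' chi' \<phi>' \<theta>h' s)"
      using char[OF sol(2)] s by blast
    have o: "adaptive_observer \<iota> k0 k1 S (\<lambda>s. d s $ 1 + a s) \<xi> chi \<phi> \<theta>h"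
      "adaptive_observer \<iota> k0 k1 S (\<lambda>s. d s $ 1 + a s) \<xi>' chi' \<phi>' \<theta>h'"
      and i: "\<xi> 0 = \<xi>' 0" "chi 0 = chi' 0" "\<phi> 0 = \<phi>' 0" "\<theta>h 0 = \<theta>h' 0"
      using 1(1) 2(1) by (simp_all add: obs_def)
    have "\<xi> s = \<xi>' s" "chi s = chi' s" "\<phi> s = \<phi>' s" "\<theta>h s = \<theta>h' s"
      by (rule adaptive_observer_unique[OF o refl i less_imp_le[OF assms(5)] less_imp_le[OF k0] assms(7) s])+
    then show ?thesis using 1(2) 2(2) eq_H3_trans eq_H3_sym by metis
  qed
  have decay: "norm_H3 (E s) \<le> M3 * exp (- \<nu> * s)" if sol: "?sol S E" and s: "s \<in> {0..S}" for S E s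
  proof -
    obtain \<xi> chi \<phi> \<theta>h where o: "obs S \<xi> chi \<phi> \<theta>h" and eq: "eq_H3 (E s) (?err \<xi> chi \<phi> \<theta>h s)"
      using char[OF sol] s by blast
    have "E s \<in> H3" using sol s unfolding error_solution_def continuous_into_def by auto
    then have "norm_H3 (E s) = norm_H3 (?err \<xi> chi \<phi> \<theta>h s)" using s by (intro norm_H3_cong eq errH) auto
    then show ?thesis using bound[OF o s] by simp
  qed
  show ?thesis
  proof (rule exI[of _ M3], rule conjI[OF M3], rule exI[of _ \<nu>], rule conjI[OF \<nu>(1)], intro allI impI conjI ballI)
    fix t assume "\<tau> < t"
    then show "\<exists>E. ?sol (t - \<tau>) E" by (intro exist) simp
  next
    fix t E E' s
    assume "?sol (t - \<tau>) E" "?sol (t - \<tau>) E'" "s \<in> {0..t - \<tau>}"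
    then show "eq_H3 (E s) (E' s)" by (rule unique)
  next
    fix t E s
    assume "?sol (t - \<tau>) E" "s \<in> {0..t - \<tau>}"
    then show "norm_H3 (E s) \<le> M3 * exp (- \<nu> * s)" by (rule decay)
  qed
qed

end
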